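(* For every $\omega\in\Omega^1(K)$ there exist $U_E\in\mathcal F$ and $\omega_H\in\Omega^1(K)$ such that $$\omega=dU_E+\omega_H,\qquad \omega_H=\sum_{\sigma\in\Sigma}k_\sigma\,dz_\sigma ,$$ where $k=A^*c$ is determined by the periods $c_\sigma=\int_{\ell_\sigma}\omega$, and the series converges in the norm $\|\cdot\|_{\sup}$.
   Context: Sierpinski gasket: $p_0=(0,0)$, $p_1=(\frac12,\frac{\sqrt3}2)$, $p_2=(1,0)$, $w_i(x)=p_i+\frac12(x-p_i)$, and $K\subset\mathbb R^2$ is the unique nonempty compact set with $K=\bigcup_{i=0}^2w_i(K)$. $\Sigma=\bigcup_m\{0,1,2\}^m$ is the set of finite words, $|\sigma|$ the length, $w_\sigma=w_{\sigma_1}\circ\dots\circ w_{\sigma_m}$; $\tau\le\sigma$ means $\tau$ is a truncation (prefix) of $\sigma$. Cells: $C_\sigma=w_\sigma(K)$. $E_0$ is the set of sides of the triangle $p_0p_1p_2$, $E_m=\bigcup_{|\sigma|=m}w_\sigma(E_0)$, $E_*=\bigcup_mE_m$. An oriented edge $e$ has source $e_-$, target $e_+$. $\ell_\emptyset$ is the boundary of the triangle whose vertices are the midpoints of the sides of $p_0p_1p_2$; the lacunas are $\ell_\sigma=w_\sigma(\ell_\emptyset)$, traversed clockwise. Energy: for real-valued $f\in C(K)$, $\mathcal E[f]=\lim_{m}(5/3)^m\sum_{e\in E_m}|f(e_+)-f(e_-)|^2$; $\mathcal F=\{f\in C(K):\mathcal E[f]<\infty\}$, an algebra; for a function $f$ on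 a cell $C$, $\mathcal E_C[f]$ is the same limit with the sum over edges contained in $C$. Forms and integrals: $\Omega^1(\mathcal F)\subset\mathcal F\otimes\mathcal F$ is the $\mathcal F$-bimodule generated by the elements $f\,dg$, $dg=g\otimes1-1\otimes g$. An elementary path is a finite concatenation of consecutive oriented edges in $E_*$; for $\omega=\sum_if_i\,dg_i$, $\int_\gamma\omega=\lim_n\sum_{e}\sum_if_i(e_+)(g_i(e_+)-g_i(e_-))$, the sum being over the level-$n$ edges $e$ of $\gamma$ oriented as $\gamma$ (the limit exists). $\Omega^1(K)$ (smooth 1-forms) is the quotient of $\Omega^1(\mathcal F)$ by the forms with $\int_e\omega=0$ for all $e\in E_*$. Put $Q_n[\omega]=(5/3)^n\sum_{e\in E_n}|\int_e\omega|^2$, $Q[\omega]=\lim_nQ_n[\omega]$ (which exists), and $\|\omega\|_{\sup}=\sup_nQ_n[\omega]^{1/2}$, a norm on $\Omega^1(K)$. $n$-exact forms: $\omega\in\Omega^1(K)$ is $n$-exact if for every $|\sigma|=n$ there is a continuous $f_\sigma:C_\sigma\to\mathbb R$ with $\mathcal E_{C_\sigma}[f_\sigma]<\infty$ and $\int_\gamma\omega=f_\sigma(\gamma(1))-f_\sigma(\gamma(0))$ for all elementary paths $\gamma\subset C_\sigma$ (local potentials). The forms $dz_\sigma$: for $|\sigma|=n$, $dz_\sigma$ is the $(n+1)$-exact form minimizing $Q^{1/2}$ among the $(n+1)$-exact $\omega$ with $\int_{\ell_\sigma}\omega=1$. Explicitly, it vanishes on $C_\tau$ for $|\tau|=n,\tau\ne\sigma$,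 and on $C_{\sigma i}$ its local potential is the harmonic function (energy minimizer given its values at the three vertices of $C_{\sigma i}$) equal to $0$ at $w_\sigma(p_i)$ and to $\pm\frac16$ at the other two vertices, with signs such that its increment along the side of $\ell_\sigma$ in $C_{\sigma i}$, traversed clockwise, is $+\frac13$. Matrices: $B_{\rho\tau}=\int_{\ell_\tau}dz_\rho$ ($\rho,\tau\in\Sigma$) satisfies $B_{\rho\rho}=1$ and $B_{\rho\tau}=0$ unless $\tau\le\rho$; $A=B^{-1}$ is its inverse in the group of such lower unitriangular matrices. $k=A^*c$ means $k_\tau=\sum_{\sigma\ge\tau}A_{\sigma\tau}c_\sigma$ (the series converges absolutely for periods of smooth forms). *)

theory Defs
  imports "HOL-Analysis.Analysis" "HOL-Library.Sublist"
begin

section \<open>The gasket, its cells, edges and lacunas\<close>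

text \<open>Letters are the elements \<open>0, 1, 2\<close> of the three-element type \<open>3\<close>, so that \<open>\<Sigma>\<close> is
  the whole type \<open>3 list\<close>; truncation is \<^const>\<open>prefix\<close>.\<close>

type_synonym point = "real \<times> real"
type_synonym word = "3 list"
type_synonym edge = "point \<times> point"  \<comment> \<open>(source, target)\<close>

definition corner :: "3 \<Rightarrow> point" where
  "corner i = (if i = 0 then (0, 0) else if i = 1 then (1/2, sqrt 3 / 2) else (1, 0))"

definition contr :: "3 \<Rightarrow> point \<Rightarrow> point" where
  "contr i x = corner i + (1/2) *\<^sub>R (x - corner i)"

primrec contr_word :: "word \<Rightarrow> point \<Rightarrow> point" where
  "contr_word [] = id"
| "contr_word (i # \<sigma>) = contr i \<circ> contr_word \<sigma>"

definition gasket :: "point set" where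
  "gasket = (THE K. K \<noteq> {} \<and> compact K \<and> K = (\<Union>i. contr i ` K))"

definition cell :: "word \<Rightarrow> point set" where
  "cell \<sigma> = contr_word \<sigma> ` gasket"

text \<open>\<open>edges m\<close> is \<open>E\<^sub>m\<close>, each edge being listed once, with a reference orientation. Only
  orientation-independent quantities are summed over it. \<open>oedges m\<close> contains every level-\<open>m\<close>
  edge with both orientations.\<close>

definition edges0 :: "edge set" where
  "edges0 = {(corner 0, corner 1), (corner 1, corner 2), (corner 2, corner 0)}"

definition map_edge :: "word \<Rightarrow> edge \<Rightarrow> edge" where
  "map_edge \<sigma> = map_prod (contr_word \<sigma>) (contr_word \<sigma>)"

definition edges :: "nat \<Rightarrow> edge set" where
  "edges m = (\<Union>\<sigma>\<in>{\<sigma>. length \<sigma> = m}. map_edge \<sigma> ` edges0)"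

definition oedges :: "nat \<Rightarrow> edge set" where
  "oedges m = edges m \<union> (edges m)\<inverse>"

definition all_oedges :: "edge set" where
  "all_oedges = (\<Union>m. oedges m)"

definition segment :: "edge \<Rightarrow> point set" where
  "segment e = closed_segment (fst e) (snd e)"

definition elementary_path :: "edge list \<Rightarrow> bool" where
  "elementary_path \<gamma> \<longleftrightarrow>
     \<gamma> \<noteq> [] \<and> set \<gamma> \<subseteq> all_oedges \<and> successively (\<lambda>e e'. snd e = fst e') \<gamma>"

definition path_start :: "edge list \<Rightarrow> point" where
  "path_start \<gamma> = fst (hd \<gamma>)"

definition path_end :: "edge list \<Rightarrow> point" where
  "path_end \<gamma> = snd (last \<gamma>)"

definition path_support :: "edge list \<Rightarrow> point set" where
  "path_support \<gamma> = (\<Union>e\<in>set \<gamma>. segment e)"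

text \<open>The vertices below are visited clockwise, since \<open>corner 0\<close>, \<open>corner 1\<close>, \<open>corner 2\<close> are the
  left, top and right corners; the maps \<^const>\<open>contr_word\<close> are homotheties of positive ratio and
  preserve the orientation.\<close>

definition lacuna0 :: "edge list" where
  "lacuna0 =
     (let m01 = midpoint (corner 0) (corner 1);
          m12 = midpoint (corner 1) (corner 2);
          m20 = midpoint (corner 2) (corner 0)
      in [(m01, m12), (m12, m20), (m20, m01)])"

definition lacuna :: "word \<Rightarrow> edge list" where
  "lacuna \<sigma> = map (map_edge \<sigma>) lacuna0"


section \<open>Energy and finite-energy functions\<close>

definition energy :: "(point \<Rightarrow> real) \<Rightarrow> ennreal" where
  "energy f = lim (\<lambda>m. ennreal ((5/3)^m * (\<Sum>(x, y)\<in>edges m. \<bar>f y - f x\<bar>\<^sup>2)))"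

definition energy_on :: "point set \<Rightarrow> (point \<Rightarrow> real) \<Rightarrow> ennreal" where
  "energy_on C f =
     lim (\<lambda>m. ennreal ((5/3)^m * (\<Sum>(x, y)\<in>{e \<in> edges m. segment e \<subseteq> C}. \<bar>f y - f x\<bar>\<^sup>2)))"

text \<open>A function on \<open>K\<close> is represented by its extension by \<open>0\<close>, so that equality of functions
  on \<open>K\<close> is equality in the logic. In particular the constant \<open>1\<close> is the indicator of \<open>K\<close>.\<close>

definition finite_energy :: "(point \<Rightarrow> real) set" where
  "finite_energy =
     {f. continuous_on gasket f \<and> (\<forall>x. x \<notin> gasket \<longrightarrow> f x = 0) \<and> energy f < \<infinity>}"


section \<open>Forms and their integrals\<close>

text \<open>\<open>\<F> \<otimes> \<F>\<close> is realised inside the functions on \<open>K \<times> K\<close>, the tensor \<open>f \<otimes> g\<close> being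
  \<open>(x, y) \<mapsto> f x * g y\<close>. This loses nothing: if \<open>\<Sum>\<^sub>i f\<^sub>i \<otimes> g\<^sub>i\<close> vanishes as a function and the
  \<open>g\<^sub>i\<close> are linearly independent, fixing \<open>x\<close> gives \<open>f\<^sub>i x = 0\<close>. The left and right actions
  are multiplication by functions of the first and of the second variable.\<close>

type_synonym tensor = "point \<times> point \<Rightarrow> real"

definition tens :: "(point \<Rightarrow> real) \<Rightarrow> (point \<Rightarrow> real) \<Rightarrow> tensor" where
  "tens f g = (\<lambda>(x, y). f x * g y)"

definition differential :: "(point \<Rightarrow> real) \<Rightarrow> tensor" where
  "differential g =
     (\<lambda>z. tens g (indicat_real gasket) z - tens (indicat_real gasket) g z)"

inductive_set forms :: "tensor set" where
  gen: "\<lbrakk>f \<in> finite_energy; g \<in> finite_energy\<rbrakk> \<Longrightarrow> (\<lambda>(x, y). f x * differential g (x, y)) \<in> forms"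
| add: "\<lbrakk>\<omega> \<in> forms; \<eta> \<in> forms\<rbrakk> \<Longrightarrow> (\<lambda>z. \<omega> z + \<eta> z) \<in> forms"
| left: "\<lbrakk>f \<in> finite_energy; \<omega> \<in> forms\<rbrakk> \<Longrightarrow> (\<lambda>(x, y). f x * \<omega> (x, y)) \<in> forms"
| right: "\<lbrakk>\<omega> \<in> forms; f \<in> finite_energy\<rbrakk> \<Longrightarrow> (\<lambda>(x, y). \<omega> (x, y) * f y) \<in> forms"

text \<open>The level-\<open>n\<close> edges contained in \<open>e\<close>, oriented as \<open>e\<close>.\<close>

definition refine :: "nat \<Rightarrow> edge \<Rightarrow> edge set" where
  "refine n e =
     {e' \<in> oedges n. segment e' \<subseteq> segment e \<and> (snd e' - fst e') \<bullet> (snd e - fst e) > 0}"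

text \<open>For \<open>\<omega> = \<Sum>\<^sub>i f\<^sub>i dg\<^sub>i\<close> one has \<open>\<omega> (y, x) = (\<Sum>\<^sub>i f\<^sub>i y * (g\<^sub>i y - g\<^sub>i x))\<close> for \<open>x, y \<in> K\<close>:
  the target of the edge is the first argument.\<close>

definition path_integral :: "edge list \<Rightarrow> tensor \<Rightarrow> real" where
  "path_integral \<gamma> \<omega> = lim (\<lambda>n. \<Sum>e\<leftarrow>\<gamma>. \<Sum>(x, y)\<in>refine n e. \<omega> (y, x))"

definition form_rel :: "(tensor \<times> tensor) set" where
  "form_rel = {(\<omega>, \<eta>). \<omega> \<in> forms \<and> \<eta> \<in> forms \<and>
                       (\<forall>e\<in>all_oedges. path_integral [e] (\<lambda>z. \<omega> z - \<eta> z) = 0)}"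

definition smooth_forms :: "tensor set set" where
  "smooth_forms = forms // form_rel"

text \<open>Linear operations on the quotient, where \<open>form_lincomb S c V\<close> is \<open>\<Sum>\<sigma>\<in>S. c \<sigma> V \<sigma>\<close>. All
  the representatives that occur on the right-hand sides are equivalent, so that the image
  under \<^const>\<open>form_rel\<close> is a single class.\<close>

definition form_class :: "tensor \<Rightarrow> tensor set" where
  "form_class \<omega> = form_rel `` {\<omega>}"

definition form_add :: "tensor set \<Rightarrow> tensor set \<Rightarrow> tensor set" where
  "form_add V W = form_rel `` {(\<lambda>z. \<omega> z + \<eta> z) | \<omega> \<eta>. \<omega> \<in> V \<and> \<eta> \<in> W}"

definition form_diff :: "tensor set \<Rightarrow> tensor set \<Rightarrow> tensor set" where
  "form_diff V W = form_rel `` {(\<lambda>z. \<omega> z - \<eta> z) | \<omega> \<eta>. \<omega> \<in> V \<and> \<eta> \<in> W}"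

definition form_lincomb :: "'i set \<Rightarrow> ('i \<Rightarrow> real) \<Rightarrow> ('i \<Rightarrow> tensor set) \<Rightarrow> tensor set" where
  "form_lincomb S c V =
     form_rel `` {(\<lambda>z. \<Sum>\<sigma>\<in>S. c \<sigma> * \<omega> \<sigma> z) | \<omega>. \<forall>\<sigma>\<in>S. \<omega> \<sigma> \<in> V \<sigma>}"

definition exact_form :: "(point \<Rightarrow> real) \<Rightarrow> tensor set" where
  "exact_form U = form_class (differential U)"

text \<open>Equivalent forms have the same integral along every elementary path.\<close>

definition form_integral :: "edge list \<Rightarrow> tensor set \<Rightarrow> real" where
  "form_integral \<gamma> W = the_elem (path_integral \<gamma> ` W)"

definition Q_level :: "nat \<Rightarrow> tensor set \<Rightarrow> real" where
  "Q_level n W = (5/3)^n * (\<Sum>e\<in>edges n. \<bar>form_integral [e] W\<bar>\<^sup>2)"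

definition Q_form :: "tensor set \<Rightarrow> real" where
  "Q_form W = lim (\<lambda>n. Q_level n W)"

definition form_norm :: "tensor set \<Rightarrow> ennreal" where
  "form_norm W = (SUP n. ennreal (sqrt (Q_level n W)))"


section \<open>Locally exact forms\<close>

definition n_exact :: "nat \<Rightarrow> tensor set \<Rightarrow> bool" where
  "n_exact n W \<longleftrightarrow> W \<in> smooth_forms \<and>
     (\<forall>\<sigma>. length \<sigma> = n \<longrightarrow>
        (\<exists>f. continuous_on (cell \<sigma>) f \<and> energy_on (cell \<sigma>) f < \<infinity> \<and>
             (\<forall>\<gamma>. elementary_path \<gamma> \<and> path_support \<gamma> \<subseteq> cell \<sigma> \<longrightarrow>
                  form_integral \<gamma> W = f (path_end \<gamma>) - f (path_start \<gamma>))))"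

definition dz :: "word \<Rightarrow> tensor set" where
  "dz \<sigma> = (THE W. is_arg_min (\<lambda>W. sqrt (Q_form W))
                    (\<lambda>W. n_exact (length \<sigma> + 1) W \<and> form_integral (lacuna \<sigma>) W = 1) W)"


section \<open>The period matrix and its inverse\<close>

type_synonym matrix = "word \<Rightarrow> word \<Rightarrow> real"

definition unitriangular :: "matrix \<Rightarrow> bool" where
  "unitriangular M \<longleftrightarrow>
     (\<forall>\<rho>. M \<rho> \<rho> = 1) \<and> (\<forall>\<rho> \<tau>. \<not> prefix \<tau> \<rho> \<longrightarrow> M \<rho> \<tau> = 0)"

text \<open>If \<open>M\<close> is unitriangular, only the finitely many prefixes of the row index contribute.\<close>

definition matrix_mul :: "matrix \<Rightarrow> matrix \<Rightarrow> matrix" where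
  "matrix_mul M N = (\<lambda>\<rho> \<tau>. \<Sum>\<upsilon> | prefix \<upsilon> \<rho>. M \<rho> \<upsilon> * N \<upsilon> \<tau>)"

definition identity_matrix :: matrix where
  "identity_matrix = (\<lambda>\<rho> \<tau>. if \<rho> = \<tau> then 1 else 0)"

definition period_matrix :: matrix where
  "period_matrix = (\<lambda>\<rho> \<tau>. form_integral (lacuna \<tau>) (dz \<rho>))"

definition inverse_period_matrix :: matrix where
  "inverse_period_matrix =
     (THE A. unitriangular A \<and>
             matrix_mul A period_matrix = identity_matrix \<and>
             matrix_mul period_matrix A = identity_matrix)"

text \<open>\<open>k = A\<^sup>* c\<close>, including the convergence of the series that define \<open>k\<close>.\<close>

definition is_adjoint_image :: "matrix \<Rightarrow> (word \<Rightarrow> real) \<Rightarrow> (word \<Rightarrow> real) \<Rightarrow> bool" where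
  "is_adjoint_image A c k \<longleftrightarrow>
     (\<forall>\<tau>. ((\<lambda>\<sigma>. A \<sigma> \<tau> * c \<sigma>) has_sum k \<tau>) {\<sigma>. prefix \<tau> \<sigma>})"

text \<open>\<open>\<Sum>\<^sub>\<sigma> k \<sigma> V \<sigma> = W\<close> as an unordered sum over all words, in the norm \<^const>\<open>form_norm\<close>.\<close>

definition form_has_sum :: "(word \<Rightarrow> real) \<Rightarrow> (word \<Rightarrow> tensor set) \<Rightarrow> tensor set \<Rightarrow> bool" where
  "form_has_sum k V W \<longleftrightarrow>
     ((\<lambda>S. form_norm (form_diff W (form_lincomb S k V))) \<longlongrightarrow> 0) (finite_subsets_at_top UNIV)"

end

theory Submission
  imports Defs
begin

text \<open>The additivity defect of a form along the edges is of second order, so the circulations around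
  the cells of level \<open>m\<close>, and with them the periods, have absolute sum \<open>O((3/5)\<^sup>m)\<close>. The entries of
  \<open>A\<close> are at most \<open>1\<close>, because \<open>B\<close> has the value \<open>- 1/3\<close> at \<open>(\<rho>, \<tau>)\<close> exactly if the letter that
  follows \<open>\<tau>\<close> in \<open>\<rho>\<close> does not occur again, which happens for at most three proper prefixes \<open>\<tau>\<close>.
  Hence \<open>k\<close> decays like the periods, whereas the norm of \<open>dz\<^sub>\<sigma>\<close> grows only like \<open>(5/3)\<close> to
  the power \<open>|\<sigma>|/2\<close>, and \<open>\<Sum> k\<^sub>\<sigma> dz\<^sub>\<sigma>\<close> converges absolutely. The difference of \<open>\<omega>\<close> and this
  series has no periods; its circulation around a cell is the sum of those around the subcells of any
  level, thus zero, and it integrates to a potential on the vertices. Finite energy makes the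
  potential uniformly continuous.\<close>

section \<open>Letters and words\<close>

text \<open>A class of forms is determined by its integrals along edges, so everything is computed
  with numbers: the edge from vertex i to vertex j of C_s is addressed by s, i, j, and antisymmetry
  and additivity under halving are the rules that these cochains obey. The obstacle is that absolute
  convergence produces such numbers and not yet an element of \<open>smooth_forms\<close>. Therefore
  the potential U is found first, from the numbers of \<omega> minus those of the series, and
  \<open>\<omega>\<^sub>H\<close> is then taken to be \<omega> - dU; its integrals are those of the
  series by construction. Since \<open>dz\<close> is given as a minimizer, existence and uniqueness
  have to be proved. A candidate is assembled from products f dg whose integrals vanish outside one
  cell, and its pairing with a locally exact form is proportional to the period of that form around
  the lacuna, which makes it orthogonal to all admissible variations. The exponents balance because
  circulations decay by 3/5 per level and norms grow by sqrt(5/3), with product sqrt(3/5) <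
  1.\<close>

lemma three_cases: "i = 0 \<or> i = 1 \<or> i = (2::3)"
  using exhaust_3[of i] by auto

lemma three_neq [simp]: "(2::3) \<noteq> 0" "(2::3) \<noteq> 1" "(0::3) \<noteq> 2" "(1::3) \<noteq> 2"
  by simp_all

lemma three_add [simp]: "(1::3) + 1 = 2" "(2::3) + 1 = 0" "(1::3) + 2 = 0" "(2::3) + 2 = 1"
  by simp_all

lemma UNIV_three: "(UNIV :: 3 set) = {0, 1, 2}"
  using three_cases by auto

lemma sum_three: "(\<Sum>i\<in>UNIV. f i) = f 0 + f 1 + f (2::3)"
  for f :: "3 \<Rightarrow> 'a::comm_monoid_add"
  unfolding UNIV_three by (simp add: add.assoc)

lemma all_three: "(\<forall>i. P i) \<longleftrightarrow> P 0 \<and> P 1 \<and> P (2::3)"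
proof -
  have "(\<forall>i. P i) \<longleftrightarrow> (\<forall>i\<in>UNIV. P i)" by simp
  then show ?thesis unfolding UNIV_three by simp
qed

definition words :: "nat \<Rightarrow> word set" where
  "words m = {s. length s = m}"

lemma finite_words [simp]: "finite (words m)"
  using finite_lists_length_eq[of "UNIV :: 3 set" m] by (simp add: words_def)

lemma words_0 [simp]: "words 0 = {[]}"
  by (auto simp: words_def)

lemma words_Suc_Cons: "words (Suc m) = (\<lambda>(i, s). i # s) ` (UNIV \<times> words m)"
  by (auto simp: words_def length_Suc_conv image_iff)

lemma words_Suc_snoc: "words (Suc m) = (\<lambda>(i, s). s @ [i]) ` (UNIV \<times> words m)"
  by (auto simp: words_def length_Suc_conv_rev image_iff)

lemma words_add: "words (m + n) = (\<lambda>(s, t). s @ t) ` (words m \<times> words n)"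
proof -
  have "\<exists>\<alpha> \<beta>. s = \<alpha> @ \<beta> \<and> length \<alpha> = m \<and> length \<beta> = n" if "length s = m + n" for s :: word
    using that by (intro exI[of _ "take m s"] exI[of _ "drop m s"]) auto
  then show ?thesis by (auto simp: words_def image_iff)
qed

lemma sum_words_Suc_Cons: "(\<Sum>s\<in>words (Suc m). f s) = (\<Sum>i\<in>UNIV. \<Sum>s\<in>words m. f (i # s))"
  for f :: "word \<Rightarrow> 'a::comm_monoid_add"
  unfolding words_Suc_Cons
  by (subst sum.reindex) (auto simp: inj_on_def sum.cartesian_product case_prod_beta)

lemma sum_words_Suc_snoc: "(\<Sum>s\<in>words (Suc m). f s) = (\<Sum>s\<in>words m. \<Sum>i\<in>UNIV. f (s @ [i]))"
  for f :: "word \<Rightarrow> 'a::comm_monoid_add"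
  unfolding words_Suc_snoc
  by (subst sum.reindex, force simp: inj_on_def, subst sum.swap)
    (auto simp: sum.cartesian_product case_prod_beta)

lemma sum_words_add: "(\<Sum>s\<in>words (m + n). f s) = (\<Sum>s\<in>words m. \<Sum>t\<in>words n. f (s @ t))"
  for f :: "word \<Rightarrow> 'a::comm_monoid_add"
  unfolding words_add
  by (subst sum.reindex) (auto simp: inj_on_def words_def sum.cartesian_product case_prod_beta)


section \<open>Barycentric coordinates and cells\<close>

text \<open>Incidences between cells become inequalities in these coordinates:
  \<open>contr i\<close> halves all three and then adds 1/2 to the i-th.\<close>

definition bary :: "3 \<Rightarrow> point \<Rightarrow> real" where
  "bary i p = (if i = 0 then 1 - fst p - snd p / sqrt 3
               else if i = 1 then 2 * snd p / sqrt 3 else fst p - snd p / sqrt 3)"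

lemma bary_sum: "bary 0 p + bary 1 p + bary 2 p = 1"
  by (simp add: bary_def)

lemma bary_corner: "bary i (corner j) = (if i = j then 1 else 0)"
  using three_cases[of i] three_cases[of j] by (auto simp: bary_def corner_def)

lemma bary_add: "bary i ((1 - t) *\<^sub>R x + t *\<^sub>R y) = (1 - t) * bary i x + t * bary i y"
  by (simp add: bary_def field_simps)

lemma contr_eq: "contr i x = (1/2) *\<^sub>R corner i + (1/2) *\<^sub>R x"
  unfolding contr_def by (simp add: algebra_simps flip: scaleR_left_distrib)

lemma bary_contr: "bary a (contr i x) = (bary a x + (if a = i then 1 else 0)) / 2"
  using bary_add[of a "1/2" "corner i" x] by (simp add: contr_eq bary_corner field_simps)

lemma bary_eqI: "x = y" if "\<And>i. bary i x = bary i y"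
proof -
  have "snd x = snd y" using that[of 1] by (simp add: bary_def)
  moreover from this have "fst x = fst y" using that[of 2] by (simp add: bary_def)
  ultimately show ?thesis by (rule prod_eqI[rotated])
qed

lemma continuous_on_bary [continuous_intros]: "continuous_on S (bary i)"
  unfolding bary_def by (cases "i = 0"; cases "i = 1") (auto intro!: continuous_intros)

definition base_triangle :: "point set" where
  "base_triangle = {x. \<forall>i. 0 \<le> bary i x}"

lemma closed_triangle: "closed base_triangle"
proof -
  have "base_triangle = (\<Inter>i. {x. 0 \<le> bary i x})" by (auto simp: base_triangle_def)
  moreover have "closed {x. 0 \<le> bary i x}" for i
    using continuous_on_bary[of UNIV i] by (intro closed_Collect_le) auto
  ultimately show ?thesis by (metis (no_types, lifting) UNIV_I closed_INT)
qed

lemma bary_le_1: "bary i x \<le> 1" if "x \<in> base_triangle"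
  using that bary_sum[of x] three_cases[of i] unfolding base_triangle_def all_three mem_Collect_eq by auto

lemma bary_ge_0: "0 \<le> bary i x" if "x \<in> base_triangle"
  using that by (simp add: base_triangle_def)

lemma corner_in_triangle: "corner i \<in> base_triangle"
  by (simp add: base_triangle_def bary_corner)

lemma eq_corner: "x = corner i" if "x \<in> base_triangle" "bary i x = 1"
proof (rule bary_eqI)
  fix j
  show "bary j x = bary j (corner i)"
    using that bary_sum[of x] three_cases[of i] three_cases[of j]
    unfolding base_triangle_def all_three mem_Collect_eq bary_corner by auto
qed

lemma contr_triangle: "contr i x \<in> base_triangle" if "x \<in> base_triangle"
  using that by (auto simp: base_triangle_def bary_contr)

lemma inj_contr: "contr i x = contr i y \<longleftrightarrow> x = y"
  by (simp add: contr_eq)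

lemma contr_corner: "contr i (corner i) = corner i"
  by (simp add: contr_def)

lemma contr_corner_swap: "contr i (corner j) = contr j (corner i)"
  by (simp add: contr_eq add.commute)

text \<open>Comparing the a-coordinates gives \<open>bary a y = bary a x + 1\<close>, and
  coordinates in the triangle lie between 0 and 1; likewise for b.\<close>

lemma contr_meet:
  assumes "contr a x = contr b y" "a \<noteq> b" "x \<in> base_triangle" "y \<in> base_triangle"
  shows "x = corner b \<and> y = corner a"
proof -
  have "bary a x + 1 = bary a y" "bary b x = bary b y + 1"
    using assms(1,2) bary_contr[of a a x] bary_contr[of a b y] bary_contr[of b a x] bary_contr[of b b y]
    by simp_all
  moreover have "bary a y \<le> 1" "0 \<le> bary a x" "bary b x \<le> 1" "0 \<le> bary b y"
    using assms by (simp_all add: bary_le_1 bary_ge_0)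
  ultimately have "bary a y = 1" "bary b x = 1" by simp_all
  then show ?thesis using eq_corner assms by blast
qed

lemma contr_eq_corner: "a = b \<and> x = corner b" if "contr a x = corner b" "x \<in> base_triangle"
proof -
  have "bary b x + (if b = a then 1 else 0) = 2"
    using bary_contr[of b a x] that(1) by (simp add: bary_corner)
  with bary_le_1[OF that(2), of b] have "a = b" "bary b x = 1" by (auto split: if_splits)
  with eq_corner that(2) show ?thesis by auto
qed

lemma contr_word_append: "contr_word (s @ t) x = contr_word s (contr_word t x)"
  by (induction s) auto

lemma contr_word_triangle: "contr_word s x \<in> base_triangle" if "x \<in> base_triangle"
  using that by (induction s) (auto simp: contr_triangle)

lemma inj_contr_word: "contr_word s x = contr_word s y \<longleftrightarrow> x = y"
  by (induction s) (auto simp: inj_contr)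

lemma contr_word_affine: "contr_word s x = contr_word s 0 + (1/2) ^ length s *\<^sub>R x"
  by (induction s) (auto simp: contr_eq algebra_simps)

lemma contr_word_diff: "contr_word s x - contr_word s y = (1/2) ^ length s *\<^sub>R (x - y)"
  using contr_word_affine[of s x] contr_word_affine[of s y] by (simp add: algebra_simps)

lemma bary_contr_word_diff:
  "bary i (contr_word s x) - bary i (contr_word s y) = (1/2) ^ length s * (bary i x - bary i y)"
  by (induction s) (auto simp: bary_contr field_simps)

lemma contr_word_segment:
  "contr_word s ` closed_segment x y = closed_segment (contr_word s x) (contr_word s y)"
proof -
  have "contr_word s ((1 - u) *\<^sub>R x + u *\<^sub>R y) = (1 - u) *\<^sub>R contr_word s x + u *\<^sub>R contr_word s y" for u
    by (subst (1 2 3) contr_word_affine) (simp add: algebra_simps)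
  then show ?thesis unfolding closed_segment_def setcompr_eq_image image_image by (simp add: image_image)
qed

text \<open>Two cells of one level share at most one point, expressed through two coincidences.
  After the common prefix the cells differ in a letter, and \<open>contr_meet\<close> fixes the
  meeting point.\<close>

lemma contr_word_meet:
  assumes "length s = length t" "s \<noteq> t" "x \<in> base_triangle" "y \<in> base_triangle" "x' \<in> base_triangle" "y' \<in> base_triangle"
    and "contr_word s x = contr_word t y" "contr_word s x' = contr_word t y'"
  shows "x = x'"
  using assms
proof (induction s t rule: list_induct2)
  case (Cons a s b t)
  show ?case
  proof (cases "a = b")
    case True
    with Cons show ?thesis by (auto simp: inj_contr)
  next
    case False
    have "contr_word s x = corner b" "contr_word s x' = corner b"
      using contr_meet[OF _ False, of "contr_word s x" "contr_word t y"]
        contr_meet[OF _ False, of "contr_word s x'" "contr_word t y'"] Cons.prems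
      by (simp_all add: contr_word_triangle)
    then show ?thesis by (metis inj_contr_word)
  qed
qed simp

lemma contr_word_eq_corner: "x = corner b" if "contr_word s x = corner b" "x \<in> base_triangle"
  using that by (induction s) (auto dest!: contr_eq_corner simp: contr_word_triangle)

section \<open>Vertices of the cells and their coincidences\<close>

definition vtx :: "word \<Rightarrow> 3 \<Rightarrow> point" where
  "vtx s i = contr_word s (corner i)"

lemma vtx_Nil [simp]: "vtx [] i = corner i"
  by (simp add: vtx_def)

lemma vtx_Cons: "vtx (a # s) i = contr a (vtx s i)"
  by (simp add: vtx_def)

lemma vtx_append: "vtx (s @ t) i = contr_word s (vtx t i)"
  by (simp add: vtx_def contr_word_append)

lemma vtx_snoc_same: "vtx (s @ [i]) i = vtx s i"
  by (simp add: vtx_def contr_word_append contr_corner)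

lemma vtx_snoc_swap: "vtx (s @ [i]) j = vtx (s @ [j]) i"
  by (simp add: vtx_def contr_word_append contr_corner_swap)

lemma vtx_in_triangle: "vtx s i \<in> base_triangle"
  by (simp add: vtx_def contr_word_triangle corner_in_triangle)

lemma corner_inject [simp]: "corner i = corner j \<longleftrightarrow> i = j"
  by (metis bary_corner zero_neq_one)

text \<open>Two cells of one level may share a vertex, but then it carries different letters in
  them: where the words first differ, by a and b, the shared vertex has letter b in one cell and
  letter a in the other.\<close>

lemma vtx_inject: "s = t" if "length s = length t" "vtx s i = vtx t i"
  using that
proof (induction s t rule: list_induct2)
  case (Cons a s b t)
  show ?case
  proof (cases "a = b")
    case True
    with Cons show ?thesis by (auto simp: inj_contr vtx_Cons)
  next
    case False
    have "vtx s i = corner b" "vtx t i = corner a"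
      using contr_meet[OF _ False] Cons.prems by (auto simp: vtx_Cons vtx_in_triangle)
    then have "i = b" "i = a"
      using contr_word_eq_corner[of _ "corner i"] corner_in_triangle by (auto simp: vtx_def)
    with False show ?thesis by simp
  qed
qed simp

lemma vtx_inject_letter: "vtx s i = vtx s j \<longleftrightarrow> i = j"
  by (simp add: vtx_def inj_contr_word)

text \<open>Points are pairs; with these rules the simplifier would split every quantifier over
  points into two over the reals.\<close>

declare split_paired_All [simp del] split_paired_Ex [simp del]

text \<open>A point of X lies, for every n, in the image of X under some \<open>contr_word s\<close>
  with |s| = n. The image of a point of Y under the same map lies in Y, at distance at most a
  constant times 2^-n. Besides the uniqueness of the gasket this yields that it contains the sides
  of the triangle.\<close>

lemma invariant_subset:
  assumes "bounded X" "X \<subseteq> (\<Union>i. contr i ` X)" "closed Y" "Y \<noteq> {}" "(\<Union>i. contr i ` Y) \<subseteq> Y"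
  shows "X \<subseteq> Y"
proof
  fix x assume "x \<in> X"
  obtain y where y: "y \<in> Y" using assms(4) by blast
  obtain M where M: "\<And>z. z \<in> X \<Longrightarrow> dist y z \<le> M"
    using assms(1) bounded_any_center by blast
  have ex: "\<exists>s x'. length s = n \<and> x' \<in> X \<and> x = contr_word s x'" for n
  proof (induction n)
    case 0
    show ?case using \<open>x \<in> X\<close> by (intro exI[of _ "[]"] exI[of _ x]) simp
  next
    case (Suc n)
    then obtain s x' where *: "length s = n" "x' \<in> X" "x = contr_word s x'" by blast
    then obtain i x'' where "x'' \<in> X" "x' = contr i x''" using assms(2) by blast
    with * show ?case
      by (intro exI[of _ "s @ [i]"] exI[of _ x'']) (auto simp: contr_word_append)
  qed
  have inY: "contr_word s y \<in> Y" for s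
    using assms(5) y by (induction s) auto
  have "\<exists>z\<in>Y. dist z x < e" if "e > 0" for e
  proof -
    have "(\<lambda>n. (1/2)^n * M) \<longlonglongrightarrow> 0 * M"
      by (intro tendsto_intros LIMSEQ_realpow_zero) auto
    then have "\<forall>\<^sub>F n in sequentially. (1/2)^n * M < e" using that by (intro order_tendstoD) auto
    then obtain n where n: "(1/2)^n * M < e" by (auto simp: eventually_sequentially)
    obtain s x' where *: "length s = n" "x' \<in> X" "x = contr_word s x'" using ex by blast
    have "dist (contr_word s y) x = (1/2)^n * dist y x'"
      using * by (simp add: dist_norm contr_word_diff)
    also have "\<dots> \<le> (1/2)^n * M" using M * by (intro mult_left_mono) auto
    finally show ?thesis using n inY by (intro bexI[of _ "contr_word s y"]) auto
  qed
  then show "x \<in> Y" using closed_approachable[OF assms(3)] by blast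
qed

lemma invariant_set_subset:
  assumes "compact X" "X = (\<Union>i. contr i ` X)" "compact Y" "Y \<noteq> {}" "Y = (\<Union>i. contr i ` Y)"
  shows "X \<subseteq> Y"
  by (rule invariant_subset[OF compact_imp_bounded[OF assms(1)] equalityD1[OF assms(2)]
        compact_imp_closed[OF assms(3)] assms(4) equalityD2[OF assms(5)]])

lemma compact_triangle: "compact base_triangle"
proof -
  have "base_triangle \<subseteq> cbox (0, 0) (1, sqrt 3)"
  proof
    fix p assume p: "p \<in> base_triangle"
    have b: "0 \<le> bary i p" "bary i p \<le> 1" for i
      using p bary_ge_0 bary_le_1 by auto
    have "fst p = bary 2 p + bary 1 p / 2" "snd p = sqrt 3 / 2 * bary 1 p"
      by (auto simp: bary_def)
    moreover have "0 \<le> bary 2 p + bary 1 p / 2" "bary 2 p + bary 1 p / 2 \<le> 1"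
      using b[of 0] b[of 1] b[of 2] bary_sum[of p] by linarith+
    moreover have "0 \<le> sqrt 3 / 2 * bary 1 p" "sqrt 3 / 2 * bary 1 p \<le> sqrt 3"
      using b[of 1] by (auto intro!: mult_nonneg_nonneg mult_left_le)
    ultimately have "0 \<le> fst p" "fst p \<le> 1" "0 \<le> snd p" "snd p \<le> sqrt 3"
      by (simp_all only:)
    then show "p \<in> cbox (0, 0) (1, sqrt 3)"
      by (cases p) (simp add: cbox_Pair_eq)
  qed
  then show ?thesis
    using closed_triangle bounded_subset[OF bounded_cbox] by (simp add: compact_eq_bounded_closed)
qed

text \<open>Existence of the invariant compact set. The vertices are reproduced by the contractions
  because \<open>corner i\<close> is fixed by \<open>contr i\<close>, and closure commutes with
  similarities and finite unions.\<close>

lemma vertex_closure: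
  defines "V \<equiv> {vtx s i | s i. True}"
  shows "V \<noteq> {}" "compact (closure V)" "closure V = (\<Union>i. contr i ` closure V)"
proof -
  have vtx_V: "vtx s i \<in> V" for s i unfolding V_def by blast
  then show "V \<noteq> {}" by blast
  have "V \<subseteq> base_triangle" by (auto simp: V_def vtx_in_triangle)
  then show "compact (closure V)"
    using bounded_subset[OF compact_imp_bounded[OF compact_triangle]] by (simp add: compact_closure)
  have "V = (\<Union>i. contr i ` V)"
  proof
    show "V \<subseteq> (\<Union>i. contr i ` V)"
    proof
      fix x assume "x \<in> V"
      then obtain s i where x: "x = vtx s i" by (auto simp: V_def)
      show "x \<in> (\<Union>i. contr i ` V)"
      proof (cases s)
        case Nil
        then have "x = contr i (vtx [] i)" using x by (simp add: contr_corner)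
        then show ?thesis using vtx_V by blast
      next
        case (Cons a t)
        then have "x = contr a (vtx t i)" using x by (simp add: vtx_Cons)
        then show ?thesis using vtx_V by blast
      qed
    qed
    show "(\<Union>i. contr i ` V) \<subseteq> V"
    proof
      fix x assume "x \<in> (\<Union>i. contr i ` V)"
      then obtain a s i where "x = contr a (vtx s i)" by (auto simp: V_def)
      then have "x = vtx (a # s) i" by (simp add: vtx_Cons)
      then show "x \<in> V" using vtx_V by simp
    qed
  qed
  moreover have "closure (contr i ` V) = contr i ` closure V" for i
  proof -
    have "contr i = (\<lambda>x. (1/2) *\<^sub>R corner i + (1/2) *\<^sub>R x)" by (auto simp: contr_eq)
    then have "contr i ` S = (\<lambda>x. (1/2) *\<^sub>R corner i + x) ` ((*\<^sub>R) (1/2) ` S)" for S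
      by (simp add: image_image)
    then show ?thesis by (simp add: closure_translation closure_scaleR)
  qed
  moreover have "closure (\<Union>i. contr i ` V) = (\<Union>i. closure (contr i ` V))"
    unfolding UNIV_three by simp
  ultimately show "closure V = (\<Union>i. contr i ` closure V)" by simp
qed

lemma gasket_eq: "gasket = closure {vtx s i | s i. True}"
  unfolding gasket_def
proof (rule the_equality)
  note L = vertex_closure
  have ne: "closure {vtx s i |s i. True} \<noteq> {}" unfolding closure_eq_empty by (rule L(1))
  show "closure {vtx s i |s i. True} \<noteq> {} \<and> compact (closure {vtx s i |s i. True}) \<and>
      closure {vtx s i |s i. True} = (\<Union>i. contr i ` closure {vtx s i |s i. True})"
    by (intro conjI ne L)
  fix K assume "K \<noteq> {} \<and> compact K \<and> K = (\<Union>i. contr i ` K)"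
  note K = conjunct1[OF this] conjunct1[OF conjunct2[OF this]] conjunct2[OF conjunct2[OF this]]
  show "K = closure {vtx s i |s i. True}"
    by (rule equalityI)
      (rule invariant_set_subset[OF K(2,3) L(2) ne L(3)], rule invariant_set_subset[OF L(2,3) K(2,1,3)])
qed

lemma gasket_invariant: "gasket = (\<Union>i. contr i ` gasket)"
  unfolding gasket_eq by (rule vertex_closure)

lemma compact_gasket: "compact gasket"
  unfolding gasket_eq by (rule vertex_closure)

lemma contr_gasket: "contr i x \<in> gasket" if "x \<in> gasket"
  using that gasket_invariant by blast

lemma gasketE:
  assumes "x \<in> gasket"
  obtains i y where "y \<in> gasket" "x = contr i y"
  using assms gasket_invariant by blast

lemma vtx_gasket [simp]: "vtx s i \<in> gasket"
  unfolding gasket_eq by (rule subsetD[OF closure_subset]) blast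

lemma corner_gasket [simp]: "corner i \<in> gasket"
  using vtx_gasket[of "[]" i] by simp

lemma gasket_triangle: "x \<in> base_triangle" if "x \<in> gasket"
proof -
  have "closure {vtx s i | s i. True} \<subseteq> base_triangle"
    by (rule closure_minimal) (auto simp: vtx_in_triangle closed_triangle)
  with that show ?thesis unfolding gasket_eq by blast
qed

lemma contr_word_gasket: "contr_word s x \<in> gasket" if "x \<in> gasket"
  using that by (induction s) (auto simp: contr_gasket)

text \<open>A side is covered by its images under the contractions towards its two ends, so
  \<open>invariant_subset\<close> applies.\<close>

lemma side_gasket: "closed_segment (corner i) (corner j) \<subseteq> gasket"
proof (rule invariant_subset)
  show "bounded (closed_segment (corner i) (corner j))"
    by (intro compact_imp_bounded compact_segment)
  show "closed gasket" "gasket \<noteq> {}" "(\<Union>i. contr i ` gasket) \<subseteq> gasket"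
    using compact_gasket compact_imp_closed gasket_invariant corner_gasket by blast+
  show "closed_segment (corner i) (corner j) \<subseteq> (\<Union>k. contr k ` closed_segment (corner i) (corner j))"
  proof
    fix x assume "x \<in> closed_segment (corner i) (corner j)"
    then obtain u where u: "0 \<le> u" "u \<le> 1" and x: "x = (1 - u) *\<^sub>R corner i + u *\<^sub>R corner j"
      by (auto simp: in_segment)
    show "x \<in> (\<Union>k. contr k ` closed_segment (corner i) (corner j))"
    proof (cases "u \<le> 1/2")
      case True
      have "x = contr i ((1 - 2 * u) *\<^sub>R corner i + (2 * u) *\<^sub>R corner j)"
        unfolding x contr_eq by (simp add: algebra_simps) (simp flip: scaleR_left_distrib)
      moreover have "(1 - 2 * u) *\<^sub>R corner i + (2 * u) *\<^sub>R corner j \<in> closed_segment (corner i) (corner j)"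
        unfolding in_segment using True u by (intro exI[of _ "2 * u"]) auto
      ultimately show ?thesis by blast
    next
      case False
      have "x = contr j ((1 - (2 * u - 1)) *\<^sub>R corner i + (2 * u - 1) *\<^sub>R corner j)"
        unfolding x contr_eq by (simp add: algebra_simps)
      moreover have "(1 - (2 * u - 1)) *\<^sub>R corner i + (2 * u - 1) *\<^sub>R corner j \<in> closed_segment (corner i) (corner j)"
        unfolding in_segment using False u by (intro exI[of _ "2 * u - 1"]) auto
      ultimately show ?thesis by blast
    qed
  qed
qed


section \<open>Edges and their subdivision\<close>

definition oedge :: "word \<Rightarrow> 3 \<Rightarrow> 3 \<Rightarrow> edge" where
  "oedge s i j = (vtx s i, vtx s j)"

lemma edges_eq: "edges m = (\<Union>s\<in>words m. {oedge s 0 1, oedge s 1 2, oedge s 2 0})"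
  by (simp add: edges_def edges0_def words_def map_edge_def oedge_def vtx_def)

lemma neq_three: "i \<noteq> j \<Longrightarrow> (i = 0 \<and> j = 1) \<or> (i = 1 \<and> j = 2) \<or> (i = 2 \<and> j = 0) \<or>
    (i = 1 \<and> j = 0) \<or> (i = 2 \<and> j = 1) \<or> (i = 0 \<and> j = (2::3))"
  using three_cases[of i] three_cases[of j] by auto

lemma third_letter:
  assumes "i \<noteq> j"
  obtains l :: 3 where "\<forall>k. k = i \<or> k = j \<or> k = l" "l \<noteq> i" "l \<noteq> j"
  using neq_three[OF assms]
proof (elim disjE conjE)
  assume "i = 0" "j = 1"
  then show thesis using three_cases by (intro that[of 2]) auto
next
  assume "i = 1" "j = 2"
  then show thesis using three_cases by (intro that[of 0]) auto
next
  assume "i = 2" "j = 0"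
  then show thesis using three_cases by (intro that[of 1]) auto
next
  assume "i = 1" "j = 0"
  then show thesis using three_cases by (intro that[of 2]) auto
next
  assume "i = 2" "j = 1"
  then show thesis using three_cases by (intro that[of 0]) auto
next
  assume "i = 0" "j = 2"
  then show thesis using three_cases by (intro that[of 1]) auto
qed

lemma oedges_eq: "oedges m = {oedge s i j | s i j. length s = m \<and> i \<noteq> j}"
  unfolding oedges_def edges_eq
  by (auto simp: words_def oedge_def converse_def dest!: neq_three) (metis three_neq zero_neq_one)+

lemma all_oedges_eq: "all_oedges = {oedge s i j | s i j. i \<noteq> j}"
  by (auto simp: all_oedges_def oedges_eq)

lemma oedge_vector: "vtx s j - vtx s i = (1/2) ^ length s *\<^sub>R (corner j - corner i)"
  by (simp add: vtx_def contr_word_diff)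

text \<open>At a fixed level the difference of the end points is a fixed positive multiple of
  \<open>corner j - corner i\<close>, and the six such vectors are distinct. One end point then
  determines the word through \<open>vtx_inject\<close>.\<close>

lemma oedge_inject: "s = t \<and> i = i' \<and> j = j'"
  if eq: "oedge s i j = oedge t i' j'" and "length s = length t" and ne: "i \<noteq> j"
proof -
  have "(1/2) ^ length s *\<^sub>R (corner j - corner i) = (1/2) ^ length s *\<^sub>R (corner j' - corner i')"
    using eq \<open>length s = length t\<close> oedge_vector by (metis Pair_inject oedge_def)
  then have c: "corner j - corner i = corner j' - corner i'" by simp
  \<comment> \<open>\<open>bary k\<close> is affine; its value at 0 corrects the difference.\<close>
  have b: "bary k x - bary k y = bary k (x - y) - bary k 0" for k x y
    by (simp add: bary_def field_simps)
  have "bary k (corner j) - bary k (corner i) = bary k (corner j') - bary k (corner i')" for k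
    using b[of k "corner j" "corner i"] b[of k "corner j'" "corner i'"] c by simp
  from this[of i] this[of j] have "i = i' \<and> j = j'"
    using ne by (auto simp: bary_corner split: if_splits)
  with eq vtx_inject that show ?thesis by (auto simp: oedge_def)
qed

lemma sum_edges:
  "(\<Sum>e\<in>edges m. f e) = (\<Sum>s\<in>words m. f (oedge s 0 1) + f (oedge s 1 2) + f (oedge s 2 0))"
  for f :: "edge \<Rightarrow> 'a::comm_monoid_add"
proof -
  have "(\<Sum>e\<in>edges m. f e) = (\<Sum>s\<in>words m. \<Sum>e\<in>{oedge s 0 1, oedge s 1 2, oedge s 2 0}. f e)"
    unfolding edges_eq
    by (intro sum.UNION_disjoint) (auto simp: finite_words[unfolded words_def] words_def dest!: oedge_inject)
  also have "\<dots> = (\<Sum>s\<in>words m. f (oedge s 0 1) + f (oedge s 1 2) + f (oedge s 2 0))"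
    by (intro sum.cong) (auto simp: oedge_def vtx_inject_letter add.assoc)
  finally show ?thesis .
qed

lemma segment_oedge: "segment (oedge s i j) = contr_word s ` closed_segment (corner i) (corner j)"
  by (simp add: segment_def oedge_def vtx_def contr_word_segment)

lemma side_triangle: "closed_segment (corner i) (corner j) \<subseteq> base_triangle"
  using side_gasket gasket_triangle by blast

lemma vtx_segment: "vtx s i \<in> segment (oedge s i j)" "vtx s j \<in> segment (oedge s i j)"
  by (auto simp: segment_def oedge_def)

text \<open>An edge has two end points, and two different cells of one level have at most one point
  in common.\<close>

lemma prefix_if_subset:
  assumes "segment (oedge r i j) \<subseteq> contr_word s ` base_triangle" "length s \<le> length r" "i \<noteq> j"
  shows "prefix s r"
proof (rule ccontr)
  assume np: "\<not> prefix s r"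
  define s' t where "s' = take (length s) r" and "t = drop (length s) r"
  have r: "r = s' @ t" and len: "length s' = length s" using assms(2) by (auto simp: s'_def t_def)
  have ne: "s' \<noteq> s" using np r by auto
  obtain x y where "vtx r i = contr_word s x" "x \<in> base_triangle"
      "vtx r j = contr_word s y" "y \<in> base_triangle"
    using assms(1) vtx_segment[of r] by blast
  then have "vtx t i = vtx t j"
    using contr_word_meet[OF len ne, of "vtx t i" x "vtx t j" y]
    by (simp add: r vtx_append vtx_in_triangle)
  with assms(3) show False by (simp add: vtx_inject_letter)
qed

text \<open>Edges of levels coarser than that of s are excluded by size: the i-coordinate varies by
  2^-|r| along the edge, but by at most 2^-|s| on \<open>cell s\<close>.\<close>

lemma segment_subset_cell: "segment (oedge r i j) \<subseteq> cell s \<longleftrightarrow> prefix s r" if "i \<noteq> j"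
proof
  assume "prefix s r"
  then obtain t where "r = s @ t" by (auto simp: prefix_def)
  then show "segment (oedge r i j) \<subseteq> cell s"
    using side_gasket contr_word_gasket
    by (auto simp: segment_oedge cell_def contr_word_append image_iff) blast
next
  assume sub: "segment (oedge r i j) \<subseteq> cell s"
  have "length s \<le> length r"
  proof (rule ccontr)
    assume "\<not> length s \<le> length r"
    then have less: "(1/2 :: real) ^ length s < (1/2) ^ length r"
      by (intro power_strict_decreasing) auto
    obtain x y where xy: "vtx r i = contr_word s x" "x \<in> gasket" "vtx r j = contr_word s y" "y \<in> gasket"
      using sub vtx_segment[of r] unfolding cell_def by blast
    have "(1/2) ^ length r * (bary i (corner i) - bary i (corner j)) = (1/2) ^ length s * (bary i x - bary i y)"
      using xy(1,3) bary_contr_word_diff by (metis vtx_def)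
    then have "(1/2) ^ length r = (1/2) ^ length s * (bary i x - bary i y)"
      using that by (simp add: bary_corner)
    also have "\<dots> \<le> (1/2) ^ length s * 1"
      using bary_le_1[OF gasket_triangle, of x i] bary_ge_0[OF gasket_triangle, of y i] xy
      by (intro mult_left_mono) auto
    finally show False using less by simp
  qed
  moreover have "segment (oedge r i j) \<subseteq> contr_word s ` base_triangle"
    using sub gasket_triangle by (auto simp: cell_def)
  ultimately show "prefix s r" using prefix_if_subset that by blast
qed

section \<open>Subdivision of a side into edges of a finer level\<close>

definition side_words :: "nat \<Rightarrow> 3 \<Rightarrow> 3 \<Rightarrow> word set" where
  "side_words k i j = {t. length t = k \<and> set t \<subseteq> {i, j}}"

lemma side_words_subset: "side_words k i j \<subseteq> words k"
  by (auto simp: side_words_def words_def)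

lemma finite_side_words [simp]: "finite (side_words k i j)"
  using finite_subset[OF side_words_subset finite_words] .

lemma side_words_0 [simp]: "side_words 0 i j = {[]}"
  by (auto simp: side_words_def)

lemma side_words_swap: "side_words k i j = side_words k j i"
  by (auto simp: side_words_def)

lemma sum_side_words_Suc_snoc:
  fixes f :: "word \<Rightarrow> 'a::comm_monoid_add"
  assumes "i \<noteq> j"
  shows "(\<Sum>t\<in>side_words (Suc k) i j. f t) = (\<Sum>t\<in>side_words k i j. f (t @ [i]) + f (t @ [j]))"
proof -
  have *: "side_words (Suc k) i j = (\<lambda>t. t @ [i]) ` side_words k i j \<union> (\<lambda>t. t @ [j]) ` side_words k i j"
    by (auto simp: side_words_def length_Suc_conv_rev image_iff)
  show ?thesis
    unfolding * sum.distrib using assms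
    by (subst sum.union_disjoint) (auto simp: sum.reindex inj_on_def)
qed

lemma sum_side_words_Suc_Cons:
  fixes f :: "word \<Rightarrow> 'a::comm_monoid_add"
  assumes "i \<noteq> j"
  shows "(\<Sum>t\<in>side_words (Suc k) i j. f t) = (\<Sum>t\<in>side_words k i j. f (i # t)) + (\<Sum>t\<in>side_words k i j. f (j # t))"
proof -
  have *: "side_words (Suc k) i j = (\<lambda>t. i # t) ` side_words k i j \<union> (\<lambda>t. j # t) ` side_words k i j"
    by (auto simp: side_words_def length_Suc_conv image_iff)
  show ?thesis
    unfolding * using assms
    by (subst sum.union_disjoint) (auto simp: sum.reindex inj_on_def)
qed

lemma bary_contr_word_eq_0:
  "bary k (contr_word t x) = 0 \<Longrightarrow> x \<in> base_triangle \<Longrightarrow> bary k x = 0 \<and> k \<notin> set t"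
proof (induction t)
  case (Cons a t)
  have "0 \<le> bary k (contr_word t x)"
    using Cons.prems by (simp add: bary_ge_0 contr_word_triangle)
  with Cons.prems Cons.IH show ?case by (auto simp: bary_contr split: if_splits)
qed simp

lemma contr_word_side:
  "x \<in> closed_segment (corner i) (corner j) \<Longrightarrow> set t \<subseteq> {i, j} \<Longrightarrow>
   contr_word t x \<in> closed_segment (corner i) (corner j)"
proof (induction t)
  case (Cons a t)
  then have "corner a \<in> closed_segment (corner i) (corner j)"
    "contr_word t x \<in> closed_segment (corner i) (corner j)" by auto
  then have "(1/2) *\<^sub>R corner a + (1/2) *\<^sub>R contr_word t x \<in> closed_segment (corner i) (corner j)"
    by (rule convexD[OF convex_closed_segment]) auto
  then show ?case by (simp add: contr_eq)
qed simp

text \<open>A finer edge inside the side from i to j stays where the coordinate of the third letter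
  l vanishes, so neither its cell within C_s nor its ends involve l. The positive inner product then
  leaves the orientation from i to j.\<close>

lemma refine_oedge:
  assumes "i \<noteq> j"
  shows "refine (length s + k) (oedge s i j) = (\<lambda>t. oedge (s @ t) i j) ` side_words k i j"
proof (intro equalityI subsetI)
  fix e assume "e \<in> (\<lambda>t. oedge (s @ t) i j) ` side_words k i j"
  then obtain t where t: "length t = k" "set t \<subseteq> {i, j}" and e: "e = oedge (s @ t) i j"
    by (auto simp: side_words_def)
  have "segment e \<subseteq> segment (oedge s i j)"
    unfolding e segment_oedge using contr_word_side t by (auto simp: contr_word_append image_iff)
  moreover have "(snd e - fst e) \<bullet> (snd (oedge s i j) - fst (oedge s i j)) > 0"
    using assms by (simp add: e oedge_def oedge_vector)
  ultimately show "e \<in> refine (length s + k) (oedge s i j)"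
    unfolding refine_def oedges_eq mem_Collect_eq using assms t e
    by (intro conjI exI[of _ "s @ t"] exI[of _ i] exI[of _ j]) auto
next
  fix e assume "e \<in> refine (length s + k) (oedge s i j)"
  then obtain r i' j' where r: "length r = length s + k" "i' \<noteq> j'" and e: "e = oedge r i' j'"
    and sub: "segment e \<subseteq> segment (oedge s i j)"
    and pos: "(snd e - fst e) \<bullet> (snd (oedge s i j) - fst (oedge s i j)) > 0"
    unfolding refine_def oedges_eq by auto
  have "segment (oedge s i j) \<subseteq> contr_word s ` base_triangle"
    unfolding segment_oedge using side_triangle by blast
  then have "prefix s r"
    using sub r e by (intro prefix_if_subset[of _ i' j']) auto
  then obtain t where t: "r = s @ t" by (auto simp: prefix_def)
  obtain l where l: "\<forall>k. k = i \<or> k = j \<or> k = l" "l \<noteq> i" "l \<noteq> j" using third_letter[OF assms] .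
  have seg: "bary l x = 0" if "x \<in> closed_segment (corner i) (corner j)" for x
    using that l(2,3) by (auto simp: in_segment bary_add bary_corner)
  have mem: "vtx t a \<in> closed_segment (corner i) (corner j)" if v: "vtx r a \<in> segment e" for a
  proof -
    obtain x where "x \<in> closed_segment (corner i) (corner j)" "vtx r a = contr_word s x"
      using subsetD[OF sub v] unfolding segment_oedge by (elim imageE)
    then show ?thesis by (simp add: t vtx_append inj_contr_word)
  qed
  have "bary l (vtx t i') = 0" "bary l (vtx t j') = 0"
    by (rule seg[OF mem], simp add: e vtx_segment)+
  then have "l \<notin> set t" "bary l (corner i') = 0" "bary l (corner j') = 0"
    unfolding vtx_def using bary_contr_word_eq_0 corner_in_triangle by blast+
  then have ls: "l \<notin> set t" "i' \<noteq> l" "j' \<noteq> l" by (auto simp: bary_corner)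
  have "\<not> (i' = j \<and> j' = i)"
  proof
    assume "i' = j \<and> j' = i"
    then have "snd e - fst e = - ((1/2) ^ length r *\<^sub>R (corner j - corner i))"
      by (simp add: e oedge_def oedge_vector flip: scaleR_minus_right)
    moreover have "snd (oedge s i j) - fst (oedge s i j) = (1/2) ^ length s *\<^sub>R (corner j - corner i)"
      by (simp add: oedge_def oedge_vector)
    ultimately have "(snd e - fst e) \<bullet> (snd (oedge s i j) - fst (oedge s i j)) =
       - (((1/2) ^ length r * (1/2) ^ length s) * ((corner j - corner i) \<bullet> (corner j - corner i)))"
      by (simp only: inner_minus_left inner_scaleR_left inner_scaleR_right mult_minus_right mult.assoc mult.left_commute)
    moreover have "0 \<le> ((1/2) ^ length r * (1/2) ^ length s) * ((corner j - corner i) \<bullet> (corner j - corner i))"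
      by (intro mult_nonneg_nonneg) auto
    ultimately show False using pos by linarith
  qed
  with ls l(1)[THEN spec, of i'] l(1)[THEN spec, of j'] r(2) have "i' = i" "j' = j" by auto
  moreover have "set t \<subseteq> {i, j}" using ls l(1) by blast
  ultimately show "e \<in> (\<lambda>t. oedge (s @ t) i j) ` side_words k i j"
    using r e t by (auto simp: side_words_def)
qed

lemma sum_refine:
  fixes w :: tensor
  assumes "i \<noteq> j"
  shows "(\<Sum>(x, y)\<in>refine (length s + k) (oedge s i j). w (y, x)) =
    (\<Sum>t\<in>side_words k i j. w (vtx (s @ t) j, vtx (s @ t) i))"
proof -
  have "inj_on (\<lambda>t. oedge (s @ t) i j) (side_words k i j)"
  proof (rule inj_onI)
    fix t t' assume "t \<in> side_words k i j" "t' \<in> side_words k i j"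
      and "oedge (s @ t) i j = oedge (s @ t') i j"
    then have "s @ t = s @ t'"
      using oedge_inject[OF _ _ assms, of "s @ t" "s @ t'" i j] by (simp add: side_words_def)
    then show "t = t'" by simp
  qed
  then show ?thesis
    unfolding refine_oedge[OF assms] by (simp add: sum.reindex oedge_def)
qed

section \<open>Functions with prescribed values at the vertices\<close>

text \<open>\<open>F a\<close> is transplanted to the a-th subcell,
  \<open>2 *\<^sub>R x - corner a\<close> being the inverse of \<open>contr a\<close>. A point may
  lie in two subcells; the choice is immaterial under \<open>matching\<close>, which compares the
  two values at each of the three midpoints.\<close>

definition glue :: "(3 \<Rightarrow> point \<Rightarrow> real) \<Rightarrow> point \<Rightarrow> real" where
  "glue F x = (if x \<in> gasket then F (SOME a. x \<in> contr a ` gasket)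
                 (2 *\<^sub>R x - corner (SOME a. x \<in> contr a ` gasket)) else 0)"

definition matching :: "(3 \<Rightarrow> point \<Rightarrow> real) \<Rightarrow> bool" where
  "matching F \<longleftrightarrow> (\<forall>a b. F a (corner b) = F b (corner a))"

lemma expand_contr: "2 *\<^sub>R contr a x - corner a = x"
  by (simp add: contr_eq algebra_simps)

lemma glue_contr:
  assumes "matching F" "x \<in> gasket"
  shows "glue F (contr a x) = F a x"
proof -
  define b where "b = (SOME b. contr a x \<in> contr b ` gasket)"
  have "contr a x \<in> contr b ` gasket"
    unfolding b_def using assms(2) by (intro someI[of "\<lambda>b. contr a x \<in> contr b ` gasket" a]) blast
  then obtain z where z: "z \<in> gasket" "contr a x = contr b z" by blast
  have "glue F (contr a x) = F b (2 *\<^sub>R contr b z - corner b)"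
    unfolding glue_def b_def[symmetric] using contr_gasket[OF assms(2), of a] z(2) by simp
  also have "\<dots> = F b z" by (simp add: expand_contr)
  also have "\<dots> = F a x"
  proof (cases "a = b")
    case True
    then show ?thesis using z(2) by (simp add: inj_contr)
  next
    case False
    then have "x = corner b \<and> z = corner a"
      using contr_meet[OF z(2)] z(1) assms(2) gasket_triangle by simp
    then show ?thesis using assms(1) by (simp add: matching_def)
  qed
  finally show ?thesis .
qed

lemma continuous_on_glue:
  assumes "matching F" "\<And>a. continuous_on gasket (F a)"
  shows "continuous_on gasket (glue F)"
proof -
  have 1: "continuous_on (contr a ` gasket) (glue F)" for a
  proof -
    have "continuous_on (contr a ` gasket) (\<lambda>x. F a (2 *\<^sub>R x - corner a))"
      by (intro continuous_on_compose2[OF assms(2)] continuous_intros) (auto simp: expand_contr)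
    then show ?thesis
      by (rule continuous_on_eq) (auto simp: expand_contr glue_contr[OF assms(1)])
  qed
  have 2: "closed (contr a ` gasket)" for a
    unfolding contr_def by (intro compact_imp_closed compact_continuous_image continuous_intros compact_gasket)
  have "continuous_on (\<Union>a\<in>UNIV. contr a ` gasket) (glue F)"
    by (rule continuous_on_closed_Union) (simp_all add: 1 2)
  then show ?thesis by (subst gasket_invariant)
qed

text \<open>\<open>u s i\<close> stands for the value at \<open>vtx s i\<close>. The equations are
  the coincidences \<open>vtx_snoc_same\<close> and \<open>vtx_snoc_swap\<close>, so functions on
  the vertices can be handled without choosing a representation of each vertex.\<close>

definition compat :: "(word \<Rightarrow> 3 \<Rightarrow> real) \<Rightarrow> bool" where
  "compat u \<longleftrightarrow> (\<forall>s i j. u (s @ [i]) i = u s i \<and> u (s @ [i]) j = u (s @ [j]) i)"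

lemma compat_same: "compat u \<Longrightarrow> u (s @ [i]) i = u s i"
  by (simp add: compat_def)

lemma compat_swap: "compat u \<Longrightarrow> u (s @ [i]) j = u (s @ [j]) i"
  unfolding compat_def by blast

lemma compat_append: "compat (\<lambda>s. u (t @ s))" if "compat u"
  unfolding compat_def using compat_same[OF that, of "t @ _"] compat_swap[OF that, of "t @ _"] by simp

lemma compat_Cons: "compat (\<lambda>s. u (a # s))" if "compat u"
  using compat_append[OF that, of "[a]"] by simp

lemma compat_vtx: "compat (\<lambda>s i. f (vtx s i))"
  by (simp add: compat_def vtx_snoc_same vtx_snoc_swap[of _ i j for i j])

lemma compat_diff: "compat (\<lambda>s i. u s i - v s i)" if "compat u" "compat v"
  using that unfolding compat_def by metis

text \<open>Barycentric interpolation on each cell of level m. The recursion over the first letter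
  lets continuity and the error estimate pass through \<open>glue\<close>.\<close>

primrec approx :: "nat \<Rightarrow> (word \<Rightarrow> 3 \<Rightarrow> real) \<Rightarrow> point \<Rightarrow> real" where
  "approx 0 u = (\<lambda>x. \<Sum>i\<in>UNIV. bary i x * u [] i)"
| "approx (Suc m) u = glue (\<lambda>a. approx m (\<lambda>s. u (a # s)))"

lemma approx_matching:
  assumes "compat u" "\<And>v i. compat v \<Longrightarrow> approx m v (corner i) = v [] i"
  shows "matching (\<lambda>a. approx m (\<lambda>s. u (a # s)))"
  unfolding matching_def using assms(2)[OF compat_Cons[OF assms(1)]] compat_swap[OF assms(1), of "[]"]
  by simp

lemma approx_corner: "compat u \<Longrightarrow> approx m u (corner i) = u [] i"
proof (induction m arbitrary: u i)
  case 0
  show ?case using three_cases[of i] by (auto simp: sum_three bary_corner)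
next
  case (Suc m)
  have "approx (Suc m) u (contr i (corner i)) = u [i] i"
    using glue_contr[OF approx_matching[OF Suc.prems Suc.IH], of "corner i" i]
      Suc.IH[OF compat_Cons[OF Suc.prems]] by simp
  then show ?case using compat_same[OF Suc.prems, of "[]"] by (simp add: contr_corner)
qed

lemma approx_contr:
  assumes "compat u" "x \<in> gasket"
  shows "approx (Suc m) u (contr a x) = approx m (\<lambda>s. u (a # s)) x"
  using glue_contr[OF approx_matching[OF assms(1) approx_corner] assms(2)] by simp

lemma approx_vtx: "compat u \<Longrightarrow> length s \<le> m \<Longrightarrow> approx m u (vtx s i) = u s i"
proof (induction s arbitrary: m u)
  case Nil
  then show ?case by (simp add: approx_corner)
next
  case (Cons a s)
  then obtain n where n: "m = Suc n" "length s \<le> n" by (cases m) auto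
  show ?case
    unfolding n vtx_Cons approx_contr[OF Cons.prems(1) vtx_gasket]
    using Cons.IH[OF compat_Cons[OF Cons.prems(1)] n(2)] .
qed

lemma continuous_on_approx: "compat u \<Longrightarrow> continuous_on gasket (approx m u)"
proof (induction m arbitrary: u)
  case 0
  show ?case by (auto intro!: continuous_intros)
next
  case (Suc m)
  then show ?case
    using continuous_on_glue[OF approx_matching[OF Suc.prems approx_corner]] compat_Cons by simp
qed

lemma bary_combination_close:
  assumes "x \<in> base_triangle" "\<And>i. \<bar>v i - v a\<bar> \<le> c"
  shows "\<bar>(\<Sum>i\<in>UNIV. bary i x * v i) - v a\<bar> \<le> c"
proof -
  have "(\<Sum>i\<in>UNIV. bary i x * v i) - v a = (\<Sum>i\<in>UNIV. bary i x * (v i - v a))"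
    using arg_cong[OF bary_sum, of "\<lambda>t. t * v a" x] by (simp add: sum_three algebra_simps)
  also have "\<bar>\<dots>\<bar> \<le> (\<Sum>i\<in>UNIV. \<bar>bary i x * (v i - v a)\<bar>)" by (rule sum_abs)
  also have "\<dots> \<le> (\<Sum>i\<in>UNIV. bary i x * c)"
    using assms bary_ge_0[OF assms(1)] by (intro sum_mono) (auto simp: abs_mult intro!: mult_left_mono)
  also have "\<dots> = c" using bary_sum[of x] by (simp add: sum_three flip: distrib_right)
  finally show ?thesis .
qed

text \<open>In the base case both interpolations are within C, respectively C r, of the common value
  at \<open>corner a\<close>; the induction passes to the subcell with C replaced by C r.\<close>

lemma approx_step:
  assumes "compat u" "\<And>s i j. \<bar>u s i - u s j\<bar> \<le> C * r ^ length s" "0 \<le> r" "r \<le> 1" "x \<in> gasket"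
  shows "\<bar>approx (Suc m) u x - approx m u x\<bar> \<le> 2 * C * r ^ m"
  using assms
proof (induction m arbitrary: u C x)
  case 0
  obtain y a where y: "y \<in> gasket" "x = contr a y" using gasketE[OF \<open>x \<in> gasket\<close>] .
  have C: "C \<ge> 0" using 0(2)[of "[]" 0 0] by simp
  have "\<bar>approx 0 (\<lambda>s. u (a # s)) y - u [a] a\<bar> \<le> C * r"
    using bary_combination_close[OF gasket_triangle[OF y(1)], of "u [a]" a "C * r"] 0(2)[of "[a]"] by simp
  moreover have "\<bar>approx 0 u x - u [] a\<bar> \<le> C"
    using bary_combination_close[OF gasket_triangle[OF 0(5)], of "u []" a "C"] 0(2)[of "[]"] by simp
  moreover have "approx (Suc 0) u x = approx 0 (\<lambda>s. u (a # s)) y"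
    using approx_contr[OF 0(1) y(1)] y(2) by (simp del: approx.simps)
  moreover have "u [a] a = u [] a" using compat_same[OF 0(1), of "[]"] by simp
  moreover have "C * r \<le> C" using C 0 mult_left_mono[of r 1 C] by simp
  ultimately show ?case by (simp del: approx.simps)
next
  case (Suc m)
  obtain y a where y: "y \<in> gasket" "x = contr a y" using gasketE[OF \<open>x \<in> gasket\<close>] .
  have "\<bar>u (a # s) i - u (a # s) j\<bar> \<le> C * r * r ^ length s" for s i j
    using Suc.prems(2)[of "a # s"] by (simp add: mult.assoc)
  then have "\<bar>approx (Suc m) (\<lambda>s. u (a # s)) y - approx m (\<lambda>s. u (a # s)) y\<bar> \<le> 2 * (C * r) * r ^ m"
    using Suc.prems y(1) by (intro Suc.IH compat_Cons) auto
  then show ?case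
    unfolding y(2) approx_contr[OF Suc.prems(1) y(1)] by (simp add: mult_ac)
qed

text \<open>Geometric decay of the oscillation makes the interpolations converge uniformly, and at
  each vertex they are constant from its level on.\<close>

lemma continuous_extension:
  assumes "compat u" "\<And>s i j. \<bar>u s i - u s j\<bar> \<le> C * r ^ length s" "0 \<le> r" "r < 1"
  shows "\<exists>U. continuous_on gasket U \<and> (\<forall>x. x \<notin> gasket \<longrightarrow> U x = 0) \<and> (\<forall>s i. U (vtx s i) = u s i)"
proof -
  define d where "d m x = approx (Suc m) u x - approx m u x" for m x
  define V where "V x = approx 0 u x + (\<Sum>m. d m x)" for x
  have "uniform_limit gasket (\<lambda>n x. \<Sum>m<n. d m x) (\<lambda>x. \<Sum>m. d m x) sequentially"
  proof (rule Weierstrass_m_test)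
    show "norm (d n x) \<le> 2 * C * r ^ n" if "x \<in> gasket" for n x
      unfolding d_def real_norm_def using assms that by (intro approx_step) auto
    show "summable (\<lambda>n. 2 * C * r ^ n)" using assms by (intro summable_mult summable_geometric) auto
  qed
  then have "uniform_limit gasket (\<lambda>n x. approx 0 u x + (\<Sum>m<n. d m x)) V sequentially"
    unfolding V_def by (intro uniform_limit_add uniform_limit_const)
  moreover have "approx 0 u x + (\<Sum>m<n. d m x) = approx n u x" for n x
    unfolding d_def sum_lessThan_telescope[of "\<lambda>m. approx m u x"] by simp
  ultimately have lim: "uniform_limit gasket (\<lambda>n. approx n u) V sequentially" by simp
  have cont: "continuous_on gasket V"
    by (rule uniform_limit_theorem[OF _ lim]) (auto intro!: always_eventually continuous_on_approx assms)
  have val: "V (vtx s i) = u s i" for s i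
  proof -
    have "(\<lambda>n. approx n u (vtx s i)) \<longlonglongrightarrow> V (vtx s i)"
      by (rule tendsto_uniform_limitI[OF lim]) simp
    moreover have "\<forall>\<^sub>F n in sequentially. approx n u (vtx s i) = u s i"
      using eventually_ge_at_top[of "length s"] by eventually_elim (rule approx_vtx[OF assms(1)])
    then have "(\<lambda>n. approx n u (vtx s i)) \<longlonglongrightarrow> u s i" by (rule tendsto_eventually)
    ultimately show ?thesis by (rule LIMSEQ_unique)
  qed
  have "continuous_on gasket (\<lambda>x. if x \<in> gasket then V x else 0)"
    by (rule continuous_on_eq[OF cont]) simp
  then show ?thesis
    using val by (intro exI[of _ "\<lambda>x. if x \<in> gasket then V x else 0"]) simp
qed


section \<open>Energy and harmonic functions\<close>

definition edge_prod :: "(3 \<Rightarrow> real) \<Rightarrow> (3 \<Rightarrow> real) \<Rightarrow> real" where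
  "edge_prod a b = (a 1 - a 0) * (b 1 - b 0) + (a 2 - a 1) * (b 2 - b 1) + (a 0 - a 2) * (b 0 - b 2)"

lemma edge_prod_self_nonneg: "0 \<le> edge_prod a a"
  by (simp add: edge_prod_def)

lemma square_le_edge_prod: "(a i - a j)\<^sup>2 \<le> edge_prod a a"
proof -
  have "edge_prod a a = (a 1 - a 0)\<^sup>2 + (a 2 - a 1)\<^sup>2 + (a 0 - a 2)\<^sup>2"
    by (simp add: edge_prod_def power2_eq_square)
  then show ?thesis
    using three_cases[of i] three_cases[of j] power2_commute[of "a 0" "a 1"]
      power2_commute[of "a 1" "a 2"] power2_commute[of "a 0" "a 2"]
    by auto
qed

text \<open>The \<open>2/5, 2/5, 1/5\<close> rule: \<open>a j\<close> are the values at the vertices of a cell, and the result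
  lists those at the vertices of its \<open>i\<close>-th subcell.\<close>

definition hstep :: "3 \<Rightarrow> (3 \<Rightarrow> real) \<Rightarrow> 3 \<Rightarrow> real" where
  "hstep i a j = (if i = j then a i else (a i + a j + (a 0 + a 1 + a 2)) / 5)"

text \<open>The origin of the constant 3/5. The values of w at the midpoints drop out: the values of
  \<open>hstep\<close> are those for which the energy form annihilates every function vanishing at
  the corners.\<close>

lemma edge_prod_hstep:
  assumes "\<And>i. w i i = b i" "\<And>i j. w i j = w j i"
  shows "(\<Sum>i\<in>UNIV. edge_prod (hstep i a) (w i)) = 3/5 * edge_prod a b"
proof -
  have [simp]: "w 0 0 = b 0" "w 1 1 = b 1" "w 2 2 = b 2" "w 1 0 = w 0 1" "w 2 0 = w 0 2" "w 2 1 = w 1 2"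
    using assms by auto
  show ?thesis by (simp add: sum_three edge_prod_def hstep_def field_simps)
qed

text \<open>The deviation of w from the harmonic refinement of b vanishes at the corners, hence is
  orthogonal to that refinement, and the energies add.\<close>

lemma edge_prod_le_refine:
  assumes "\<And>i. w i i = b i" "\<And>i j. w i j = w j i"
  shows "3/5 * edge_prod b b \<le> (\<Sum>i\<in>UNIV. edge_prod (w i) (w i))"
proof -
  define d where "d i j = w i j - hstep i b j" for i j
  have sym: "hstep i b j = hstep j b i" for i j by (simp add: hstep_def)
  have "(\<Sum>i\<in>UNIV. edge_prod (hstep i b) (d i)) = 3/5 * edge_prod b (\<lambda>_. 0)"
    by (rule edge_prod_hstep) (use assms sym in \<open>simp_all add: d_def hstep_def\<close>)
  moreover have "(\<Sum>i\<in>UNIV. edge_prod (hstep i b) (hstep i b)) = 3/5 * edge_prod b b"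
    by (rule edge_prod_hstep) (simp_all add: hstep_def)
  moreover have "edge_prod (w i) (w i) = edge_prod (hstep i b) (hstep i b) + 2 * edge_prod (hstep i b) (d i) + edge_prod (d i) (d i)" for i
    unfolding edge_prod_def d_def by (simp add: algebra_simps)
  ultimately have "(\<Sum>i\<in>UNIV. edge_prod (w i) (w i)) = 3/5 * edge_prod b b + (\<Sum>i\<in>UNIV. edge_prod (d i) (d i))"
    by (simp add: sum.distrib edge_prod_def flip: sum_distrib_left)
  then show ?thesis by (simp add: sum_nonneg edge_prod_self_nonneg)
qed

primrec harmonic :: "(3 \<Rightarrow> real) \<Rightarrow> word \<Rightarrow> 3 \<Rightarrow> real" where
  "harmonic a [] = a"
| "harmonic a (i # s) = harmonic (hstep i a) s"

lemma harmonic_snoc: "harmonic a (s @ [i]) = hstep i (harmonic a s)"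
  by (induction s arbitrary: a) auto

lemma compat_harmonic: "compat (harmonic a)"
  by (auto simp: compat_def harmonic_snoc hstep_def)

text \<open>A discrete Green formula: on every level the pairing with a harmonic family sees only
  the values at the corners.\<close>

lemma sum_edge_prod_harmonic:
  assumes "compat u"
  shows "(\<Sum>s\<in>words m. edge_prod (harmonic a s) (u s)) = (3/5) ^ m * edge_prod a (u [])"
proof (induction m)
  case (Suc m)
  have "(\<Sum>i\<in>UNIV. edge_prod (harmonic a (s @ [i])) (u (s @ [i]))) = 3/5 * edge_prod (harmonic a s) (u s)" for s
    unfolding harmonic_snoc
    by (rule edge_prod_hstep) (use compat_same[OF assms] compat_swap[OF assms] in auto)
  then have "(\<Sum>s\<in>words (Suc m). edge_prod (harmonic a s) (u s)) =
      3/5 * (\<Sum>s\<in>words m. edge_prod (harmonic a s) (u s))"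
    by (simp only: sum_words_Suc_snoc sum_distrib_left)
  then show ?case using Suc by simp
qed simp

section \<open>Energies of vertex families and functions of finite energy\<close>

definition family_energy :: "(word \<Rightarrow> 3 \<Rightarrow> real) \<Rightarrow> nat \<Rightarrow> real" where
  "family_energy u m = (5/3) ^ m * (\<Sum>s\<in>words m. edge_prod (u s) (u s))"

lemma family_energy_nonneg: "0 \<le> family_energy u m"
  by (simp add: family_energy_def sum_nonneg edge_prod_self_nonneg)

lemma family_energy_harmonic: "family_energy (harmonic a) m = edge_prod a a"
  by (simp add: family_energy_def sum_edge_prod_harmonic[OF compat_harmonic] flip: power_mult_distrib mult.assoc)

lemma incseq_family_energy: "incseq (family_energy u)" if "compat u"
proof (rule incseq_SucI)
  fix m
  have "3/5 * edge_prod (u s) (u s) \<le> (\<Sum>i\<in>UNIV. edge_prod (u (s @ [i])) (u (s @ [i])))" for s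
    by (rule edge_prod_le_refine) (use compat_same[OF that] compat_swap[OF that] in auto)
  then have "3/5 * (\<Sum>s\<in>words m. edge_prod (u s) (u s)) \<le> (\<Sum>s\<in>words (Suc m). edge_prod (u s) (u s))"
    unfolding sum_words_Suc_snoc sum_distrib_left by (intro sum_mono)
  from mult_left_mono[OF this, of "(5/3) ^ Suc m"] show "family_energy u m \<le> family_energy u (Suc m)"
    by (simp add: family_energy_def)
qed

abbreviation vertex_family :: "(point \<Rightarrow> real) \<Rightarrow> word \<Rightarrow> 3 \<Rightarrow> real" where
  "vertex_family f \<equiv> \<lambda>s i. f (vtx s i)"

lemma LIMSEQ_ennreal_incseq:
  assumes "incseq a" "\<And>m. 0 \<le> a m"
  shows "(\<lambda>m. ennreal (a m)) \<longlonglongrightarrow> (SUP m. ennreal (a m))"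
  using assms by (intro LIMSEQ_SUP) (auto simp: incseq_def intro!: ennreal_leI)

lemma energy_eq: "energy f = (SUP m. ennreal (family_energy (vertex_family f) m))"
proof -
  have "(5/3) ^ m * (\<Sum>(x, y)\<in>edges m. \<bar>f y - f x\<bar>\<^sup>2) = family_energy (vertex_family f) m" for m
    unfolding family_energy_def sum_edges edge_prod_def by (simp add: oedge_def power2_eq_square)
  then show ?thesis unfolding energy_def
    using LIMSEQ_ennreal_incseq[OF incseq_family_energy[OF compat_vtx] family_energy_nonneg]
    by (simp add: limI)
qed

lemma finite_energyI:
  assumes "continuous_on gasket f" "\<And>x. x \<notin> gasket \<Longrightarrow> f x = 0"
    and "\<And>m. family_energy (vertex_family f) m \<le> M"
  shows "f \<in> finite_energy"
proof -
  have "energy f \<le> ennreal M" unfolding energy_eq by (intro SUP_least ennreal_leI assms)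
  then have "energy f < \<infinity>" using ennreal_less_top[of M] by (simp add: order.strict_trans1)
  then show ?thesis using assms by (simp add: finite_energy_def)
qed

lemma finite_energy_bound:
  assumes "f \<in> finite_energy"
  shows "\<exists>M. \<forall>m. family_energy (vertex_family f) m \<le> M"
proof -
  have "energy f < top" using assms by (simp add: finite_energy_def)
  then obtain M where M: "energy f = ennreal M" "0 \<le> M" by (cases "energy f") auto
  have "ennreal (family_energy (vertex_family f) m) \<le> ennreal M" for m
    unfolding M(1)[symmetric] energy_eq by (intro SUP_upper) simp
  then show ?thesis using M(2) by (auto simp: ennreal_le_iff)
qed

text \<open>A single cell carries at most the whole energy of its level, so the oscillation on a
  cell of level m is at most sqrt M times sqrt(3/5)^m, as \<open>continuous_extension\<close>
  requires.\<close>

lemma finite_energy_extension: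
  assumes "compat u" "\<And>m. family_energy u m \<le> M"
  shows "\<exists>U\<in>finite_energy. \<forall>s i. U (vtx s i) = u s i"
proof -
  have M: "M \<ge> 0" using assms(2)[of 0] family_energy_nonneg[of u 0] by simp
  have "\<bar>u s i - u s j\<bar> \<le> sqrt M * sqrt (3/5) ^ length s" for s i j
  proof -
    have "edge_prod (u s) (u s) \<le> (\<Sum>s\<in>words (length s). edge_prod (u s) (u s))"
      by (rule member_le_sum) (auto simp: words_def edge_prod_self_nonneg finite_words[unfolded words_def])
    also have "\<dots> \<le> M * (3/5) ^ length s"
      using mult_right_mono[OF assms(2)[of "length s"], of "(3/5) ^ length s"]
      by (simp add: family_energy_def mult.commute mult.left_commute flip: power_mult_distrib mult.assoc)
    finally have "(u s i - u s j)\<^sup>2 \<le> M * (3/5) ^ length s" using square_le_edge_prod order_trans by blast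
    then have "sqrt ((u s i - u s j)\<^sup>2) \<le> sqrt (M * (3/5) ^ length s)" by (rule real_sqrt_le_mono)
    then have "\<bar>u s i - u s j\<bar> \<le> sqrt (M * (3/5) ^ length s)" by (simp only: real_sqrt_abs)
    then show ?thesis by (simp add: real_sqrt_mult real_sqrt_power)
  qed
  then obtain U where U: "continuous_on gasket U" "\<And>x. x \<notin> gasket \<Longrightarrow> U x = 0" "\<And>s i. U (vtx s i) = u s i"
    using continuous_extension[OF assms(1), of "sqrt M" "sqrt (3/5)"] by auto
  moreover have "vertex_family U = u" using U(3) by blast
  ultimately have "U \<in> finite_energy" using assms(2) by (intro finite_energyI[of U M]) auto
  with U(3) show ?thesis by blast
qed

lemma harmonic_function: "\<exists>h\<in>finite_energy. \<forall>s i. h (vtx s i) = harmonic a s i"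
  by (rule finite_energy_extension[OF compat_harmonic, of _ "edge_prod a a"]) (simp add: family_energy_harmonic)

lemma finite_energy_scale: "(\<lambda>x. c * f x) \<in> finite_energy" if f: "f \<in> finite_energy"
proof -
  obtain M where M: "\<And>m. family_energy (vertex_family f) m \<le> M" using finite_energy_bound[OF f] by blast
  have "edge_prod (\<lambda>i. c * g i) (\<lambda>i. c * g i) = c\<^sup>2 * edge_prod g g" for g
    by (simp add: edge_prod_def power2_eq_square algebra_simps)
  then have "family_energy (vertex_family (\<lambda>x. c * f x)) m = c\<^sup>2 * family_energy (vertex_family f) m" for m
    by (simp add: family_energy_def flip: sum_distrib_left)
  then have "family_energy (vertex_family (\<lambda>x. c * f x)) m \<le> c\<^sup>2 * M" for m
    using M by (simp add: mult_left_mono)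
  then show ?thesis using f
    by (intro finite_energyI[of _ "c\<^sup>2 * M"]) (auto simp: finite_energy_def intro!: continuous_intros)
qed

lemma const_finite_energy: "(\<lambda>x. c * indicat_real gasket x) \<in> finite_energy"
proof (rule finite_energyI)
  show "continuous_on gasket (\<lambda>x. c * indicat_real gasket x)"
    by (rule continuous_on_eq[of _ "\<lambda>x. c"]) auto
  show "family_energy (vertex_family (\<lambda>x. c * indicat_real gasket x)) m \<le> 0" for m
    by (simp add: family_energy_def edge_prod_def)
qed simp

lemma zero_finite_energy: "(\<lambda>x. 0) \<in> finite_energy"
  using const_finite_energy[of 0] by simp

lemma glue_finite_energy:
  assumes "matching F" "\<And>a. F a \<in> finite_energy"
  shows "glue F \<in> finite_energy"
proof -
  have "\<forall>a. \<exists>M. \<forall>m. family_energy (vertex_family (F a)) m \<le> M"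
    using finite_energy_bound[OF assms(2)] by blast
  then obtain M where M: "\<And>a m. family_energy (vertex_family (F a)) m \<le> M a" by metis
  have "family_energy (vertex_family (glue F)) (Suc m) \<le> 5/3 * (\<Sum>a\<in>UNIV. M a)" for m
  proof -
    have "family_energy (vertex_family (glue F)) (Suc m) = 5/3 * (\<Sum>a\<in>UNIV. family_energy (vertex_family (F a)) m)"
      by (simp add: family_energy_def sum_words_Suc_Cons vtx_Cons glue_contr[OF assms(1)] mult.assoc flip: sum_distrib_left)
    also have "\<dots> \<le> 5/3 * (\<Sum>a\<in>UNIV. M a)" by (intro mult_left_mono sum_mono M) simp
    finally show ?thesis .
  qed
  \<comment> \<open>The estimate covers the levels from 1 on; level 0 follows by
    monotonicity.\<close>
  then have "family_energy (vertex_family (glue F)) m \<le> 5/3 * (\<Sum>a\<in>UNIV. M a)" for m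
    using incseqD[OF incseq_family_energy[OF compat_vtx], of m "Suc m" "glue F"] by (meson le_SucI order.refl order.trans)
  moreover have "continuous_on gasket (glue F)"
    using assms by (intro continuous_on_glue) (auto simp: finite_energy_def)
  moreover have "glue F x = 0" if "x \<notin> gasket" for x using that by (simp add: glue_def)
  ultimately show ?thesis by (intro finite_energyI[of "glue F" "5/3 * (\<Sum>a\<in>UNIV. M a)"])
qed

section \<open>Integrals of forms along edges\<close>

type_synonym cochain = "word \<Rightarrow> 3 \<Rightarrow> 3 \<Rightarrow> real"

definition edge_integral :: "tensor \<Rightarrow> cochain" where
  "edge_integral w s i j = path_integral [oedge s i j] w"

definition side_sum :: "tensor \<Rightarrow> word \<Rightarrow> 3 \<Rightarrow> 3 \<Rightarrow> nat \<Rightarrow> real" where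
  "side_sum w s i j k = (\<Sum>t\<in>side_words k i j. w (vtx (s @ t) j, vtx (s @ t) i))"

lemma side_sum_limit_refine:
  assumes "i \<noteq> j" "side_sum w s i j \<longlonglongrightarrow> L"
  shows "(\<lambda>n. \<Sum>(x, y)\<in>refine n (oedge s i j). w (y, x)) \<longlonglongrightarrow> L"
proof (rule LIMSEQ_offset)
  show "(\<lambda>n. \<Sum>(x, y)\<in>refine (n + length s) (oedge s i j). w (y, x)) \<longlonglongrightarrow> L"
    unfolding add.commute[of _ "length s"] sum_refine[OF assms(1)] side_sum_def[symmetric] by (rule assms(2))
qed

lemma edge_integral_eqI:
  assumes "i \<noteq> j" "side_sum w s i j \<longlonglongrightarrow> L"
  shows "edge_integral w s i j = L"
  using limI[OF side_sum_limit_refine[OF assms]] by (simp add: edge_integral_def path_integral_def)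

text \<open>The edge from a vertex to itself has an empty refinement, the zero vector having no
  positive inner product. The value 0 makes antisymmetry and additivity hold for equal letters as
  well.\<close>

lemma edge_integral_same [simp]: "edge_integral w s i i = 0"
  by (simp add: edge_integral_def path_integral_def refine_def oedge_def)

text \<open>The kernel \<open>D x y\<close> plays the part of \<open>|g x - g y|\<close> for a function \<open>g\<close> of finite energy.\<close>

definition cell_square :: "(point \<Rightarrow> point \<Rightarrow> real) \<Rightarrow> word \<Rightarrow> real" where
  "cell_square D s = (\<Sum>i\<in>UNIV. \<Sum>j\<in>UNIV. (D (vtx s i) (vtx s j))\<^sup>2)"

text \<open>A form is a sum of products and has no single g, whereas kernels may be added and
  rescaled. The squares, summed over level m, decay like the unnormalised energy of a function of
  finite energy.\<close>

definition finite_variation :: "(point \<Rightarrow> point \<Rightarrow> real) \<Rightarrow> bool" where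
  "finite_variation D \<longleftrightarrow> (\<forall>x y. 0 \<le> D x y \<and> D x y = D y x \<and> D x x = 0) \<and>
     (\<exists>M. \<forall>m. (\<Sum>s\<in>words m. cell_square D s) \<le> M * (3/5) ^ m)"

lemma cell_square_nonneg: "0 \<le> cell_square D s"
  by (simp add: cell_square_def sum_nonneg)

lemma square_le_cell_square: "(D (vtx s i) (vtx s j))\<^sup>2 \<le> cell_square D s"
proof -
  have "(D (vtx s i) (vtx s j))\<^sup>2 \<le> (\<Sum>j\<in>UNIV. (D (vtx s i) (vtx s j))\<^sup>2)"
    by (rule member_le_sum[of j UNIV "\<lambda>j. (D (vtx s i) (vtx s j))\<^sup>2"]) auto
  also have "\<dots> \<le> cell_square D s"
    unfolding cell_square_def
    by (rule member_le_sum[of i UNIV "\<lambda>i. \<Sum>j\<in>UNIV. (D (vtx s i) (vtx s j))\<^sup>2"]) (auto simp: sum_nonneg)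
  finally show ?thesis .
qed

lemma mult_le_sum_squares: "(a::real) * b \<le> a\<^sup>2 + b\<^sup>2"
  using sum_squares_bound[of a b] zero_le_power2[of a] zero_le_power2[of b] by linarith

lemma power2_add_le: "(a + b)\<^sup>2 \<le> 2 * a\<^sup>2 + 2 * (b::real)\<^sup>2"
  using sum_squares_bound[of a b] by (simp add: power2_sum)

lemma finite_variation_function:
  assumes "f \<in> finite_energy"
  shows "finite_variation (\<lambda>x y. \<bar>f x - f y\<bar>)"
proof -
  obtain M where M: "\<And>m. family_energy (vertex_family f) m \<le> M" using finite_energy_bound[OF assms] by blast
  have eq: "cell_square (\<lambda>x y. \<bar>f x - f y\<bar>) s = 2 * edge_prod (\<lambda>i. f (vtx s i)) (\<lambda>i. f (vtx s i))" for s
    by (simp add: cell_square_def sum_three edge_prod_def power2_eq_square algebra_simps)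
  have "(\<Sum>s\<in>words m. cell_square (\<lambda>x y. \<bar>f x - f y\<bar>) s) \<le> 2 * M * (3/5) ^ m" for m
    using mult_right_mono[OF M[of m], of "2 * (3/5) ^ m"]
    by (simp add: eq family_energy_def flip: sum_distrib_left power_mult_distrib)
      (simp add: field_simps)
  then show ?thesis unfolding finite_variation_def by auto
qed

lemma finite_variation_add:
  assumes "finite_variation D" "finite_variation E"
  shows "finite_variation (\<lambda>x y. D x y + E x y)"
proof -
  obtain M N where M: "\<And>m. (\<Sum>s\<in>words m. cell_square D s) \<le> M * (3/5) ^ m"
    and N: "\<And>m. (\<Sum>s\<in>words m. cell_square E s) \<le> N * (3/5) ^ m"
    using assms unfolding finite_variation_def by blast
  have "cell_square (\<lambda>x y. D x y + E x y) s \<le> 2 * cell_square D s + 2 * cell_square E s" for s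
    unfolding cell_square_def sum_distrib_left sum.distrib[symmetric] by (intro sum_mono power2_add_le)
  then have "(\<Sum>s\<in>words m. cell_square (\<lambda>x y. D x y + E x y) s) \<le>
      2 * (\<Sum>s\<in>words m. cell_square D s) + 2 * (\<Sum>s\<in>words m. cell_square E s)" for m
    unfolding sum_distrib_left sum.distrib[symmetric] by (intro sum_mono)
  then have "(\<Sum>s\<in>words m. cell_square (\<lambda>x y. D x y + E x y) s) \<le> (2 * M + 2 * N) * (3/5) ^ m" for m
    using M[of m] N[of m] by (smt (verit) distrib_right mult.assoc)
  moreover have "\<forall>x y. 0 \<le> D x y + E x y \<and> D x y + E x y = D y x + E y x \<and> D x x + E x x = 0"
    using assms unfolding finite_variation_def by (metis add_nonneg_nonneg add_0)
  ultimately show ?thesis unfolding finite_variation_def by blast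
qed

lemma finite_variation_scale:
  assumes "finite_variation D" "0 \<le> c"
  shows "finite_variation (\<lambda>x y. c * D x y)"
proof -
  obtain M where M: "\<And>m. (\<Sum>s\<in>words m. cell_square D s) \<le> M * (3/5) ^ m"
    using assms unfolding finite_variation_def by blast
  have "cell_square (\<lambda>x y. c * D x y) s = c\<^sup>2 * cell_square D s" for s
    by (simp add: cell_square_def power_mult_distrib sum_distrib_left)
  then have "(\<Sum>s\<in>words m. cell_square (\<lambda>x y. c * D x y) s) \<le> c\<^sup>2 * M * (3/5) ^ m" for m
    using mult_left_mono[OF M[of m], of "c\<^sup>2"] by (simp add: mult.assoc flip: sum_distrib_left)
  moreover have "\<forall>x y. 0 \<le> c * D x y \<and> c * D x y = c * D y x \<and> c * D x x = 0"
    using assms unfolding finite_variation_def by (metis mult_nonneg_nonneg mult_zero_right)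
  ultimately show ?thesis unfolding finite_variation_def by blast
qed

text \<open>The defect of additivity of \<open>f dg\<close> is \<open>(f z - f y) * (g y - g x)\<close>: it is of second order.\<close>

definition controlled :: "(point \<Rightarrow> point \<Rightarrow> real) \<Rightarrow> tensor \<Rightarrow> bool" where
  "controlled D w \<longleftrightarrow> (\<forall>x\<in>gasket. \<forall>y\<in>gasket. \<bar>w (x, y)\<bar> \<le> D x y) \<and>
     (\<forall>x\<in>gasket. \<forall>y\<in>gasket. \<forall>z\<in>gasket. \<bar>w (z, x) - w (z, y) - w (y, x)\<bar> \<le> D z y * D y x)"

lemma differential_gasket: "x \<in> gasket \<Longrightarrow> y \<in> gasket \<Longrightarrow> differential g (x, y) = g x - g y"
  by (simp add: differential_def tens_def)

lemma finite_energy_bounded: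
  assumes "f \<in> finite_energy"
  obtains B where "1 \<le> B" "\<And>x. \<bar>f x\<bar> \<le> B"
proof -
  have "compact (f ` gasket)"
    using assms by (intro compact_continuous_image compact_gasket) (simp add: finite_energy_def)
  then obtain B where B: "\<And>x. x \<in> gasket \<Longrightarrow> \<bar>f x\<bar> \<le> B"
    using compact_imp_bounded bounded_iff by (metis imageI real_norm_def)
  show thesis
  proof (rule that[of "max 1 B"])
    show "\<bar>f x\<bar> \<le> max 1 B" for x
      using B[of x] assms by (cases "x \<in> gasket") (auto simp: finite_energy_def)
  qed simp
qed

lemma abs_mult_mono: "\<bar>a\<bar> \<le> A \<Longrightarrow> \<bar>b\<bar> \<le> B \<Longrightarrow> \<bar>a * b\<bar> \<le> A * (B::real)"
  unfolding abs_mult by (intro mult_mono) auto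

text \<open>The defect of the product is \<open>f z\<close> times the defect of w plus
  \<open>(f z - f y) * w (y, x)\<close>, again of second order. The bound B of f is taken at least 1
  so that the new kernel dominates D.\<close>

lemma controlled_left:
  assumes D: "finite_variation D" "controlled D w" and f: "f \<in> finite_energy"
  shows "\<exists>E. finite_variation E \<and> controlled E (\<lambda>(x, y). f x * w (x, y))"
proof -
  obtain B where B: "1 \<le> B" "\<And>x. \<bar>f x\<bar> \<le> B" using finite_energy_bounded[OF f] by blast
  define E where "E x y = B * (D x y + \<bar>f x - f y\<bar>)" for x y
  have nonneg: "0 \<le> D x y" for x y using D(1) by (simp add: finite_variation_def)
  have "finite_variation E"
    unfolding E_def using B by (intro finite_variation_scale finite_variation_add D finite_variation_function f) simp
  moreover have "controlled E (\<lambda>(x, y). f x * w (x, y))"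
    unfolding controlled_def
  proof (intro conjI ballI)
    fix x y assume "x \<in> gasket" "y \<in> gasket"
    then have "\<bar>f x * w (x, y)\<bar> \<le> B * D x y" using D(2) B by (intro abs_mult_mono) (auto simp: controlled_def)
    also have "\<dots> \<le> E x y" unfolding E_def using B by (intro mult_left_mono) auto
    finally show "\<bar>case (x, y) of (x, y) \<Rightarrow> f x * w (x, y)\<bar> \<le> E x y" by simp
  next
    fix x y z assume xyz: "x \<in> gasket" "y \<in> gasket" "z \<in> gasket"
    have 1: "\<bar>f z * (w (z, x) - w (z, y) - w (y, x))\<bar> \<le> B * (D z y * D y x)"
      using D(2) B xyz by (intro abs_mult_mono) (auto simp: controlled_def)
    have 2: "\<bar>(f z - f y) * w (y, x)\<bar> \<le> \<bar>f z - f y\<bar> * D y x"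
      using D(2) xyz by (intro abs_mult_mono) (auto simp: controlled_def)
    have "\<bar>f z * w (z, x) - f z * w (z, y) - f y * w (y, x)\<bar> =
        \<bar>f z * (w (z, x) - w (z, y) - w (y, x)) + (f z - f y) * w (y, x)\<bar>" by (simp add: algebra_simps)
    also have "\<dots> \<le> B * (D z y * D y x) + \<bar>f z - f y\<bar> * D y x" using 1 2 by linarith
    also have "\<dots> \<le> B * (D z y * D y x) + B * (\<bar>f z - f y\<bar> * D y x)"
      using B(1) nonneg mult_right_mono[of 1 B "\<bar>f z - f y\<bar> * D y x"] by simp
    also have "\<dots> = E z y * D y x" by (simp add: E_def algebra_simps)
    also have "\<dots> \<le> E z y * E y x"
    proof (rule mult_left_mono)
      have "1 * D y x \<le> B * (D y x + \<bar>f y - f x\<bar>)" using B(1) nonneg by (intro mult_mono) auto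
      then show "D y x \<le> E y x" by (simp add: E_def)
      show "0 \<le> E z y" unfolding E_def using B nonneg by (intro mult_nonneg_nonneg) auto
    qed
    finally show "\<bar>(case (z, x) of (x, y) \<Rightarrow> f x * w (x, y)) - (case (z, y) of (x, y) \<Rightarrow> f x * w (x, y)) -
        (case (y, x) of (x, y) \<Rightarrow> f x * w (x, y))\<bar> \<le> E z y * E y x" by simp
  qed
  ultimately show ?thesis by blast
qed

text \<open>Exchanging the two arguments exchanges x and z in the defect. The action on the right is
  thereby reduced to the one on the left.\<close>

lemma controlled_swap:
  assumes "finite_variation D" "controlled D w"
  shows "controlled D (\<lambda>(x, y). w (y, x))"
proof -
  have sym: "D x y = D y x" for x y using assms(1) by (simp add: finite_variation_def)
  show ?thesis
    unfolding controlled_def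
  proof (intro conjI ballI)
    fix x y assume "x \<in> gasket" "y \<in> gasket"
    then have "\<bar>w (y, x)\<bar> \<le> D y x" using assms(2) by (simp add: controlled_def)
    then show "\<bar>case (x, y) of (x, y) \<Rightarrow> w (y, x)\<bar> \<le> D x y" by (simp only: prod.case sym)
  next
    fix x y z assume "x \<in> gasket" "y \<in> gasket" "z \<in> gasket"
    then have "\<bar>w (x, z) - w (x, y) - w (y, z)\<bar> \<le> D x y * D y z" using assms(2) by (simp add: controlled_def)
    also have "\<dots> = D z y * D y x" using sym[of x y] sym[of y z] by simp
    finally show "\<bar>(case (z, x) of (x, y) \<Rightarrow> w (y, x)) - (case (z, y) of (x, y) \<Rightarrow> w (y, x)) -
        (case (y, x) of (x, y) \<Rightarrow> w (y, x))\<bar> \<le> D z y * D y x" by (simp add: algebra_simps)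
  qed
qed

lemma controlled_right:
  assumes D: "finite_variation D" "controlled D w" and f: "f \<in> finite_energy"
  shows "\<exists>E. finite_variation E \<and> controlled E (\<lambda>(x, y). w (x, y) * f y)"
proof -
  obtain E where E: "finite_variation E" "controlled E (\<lambda>(x, y). f x * (case (x, y) of (x, y) \<Rightarrow> w (y, x)))"
    using controlled_left[OF D(1) controlled_swap[OF D] f] by blast
  from controlled_swap[OF E] have "controlled E (\<lambda>(x, y). w (x, y) * f y)"
    by (simp add: case_prod_unfold mult.commute)
  with E(1) show ?thesis by blast
qed

lemma controlled_differential:
  assumes "g \<in> finite_energy"
  shows "controlled (\<lambda>x y. \<bar>g x - g y\<bar>) (differential g)"
  unfolding controlled_def by (simp add: differential_gasket)

lemma forms_controlled: "w \<in> forms \<Longrightarrow> \<exists>D. finite_variation D \<and> controlled D w"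
proof (induction rule: forms.induct)
  case (gen f g)
  show ?case
    using controlled_left[OF finite_variation_function[OF gen(2)] controlled_differential[OF gen(2)] gen(1)] .
next
  case (add w \<eta>)
  then obtain D E where D: "finite_variation D" "controlled D w" and E: "finite_variation E" "controlled E \<eta>" by blast
  have nonneg: "0 \<le> D x y" "0 \<le> E x y" for x y using D(1) E(1) by (simp_all add: finite_variation_def)
  have "controlled (\<lambda>x y. D x y + E x y) (\<lambda>z. w z + \<eta> z)"
    unfolding controlled_def
  proof (intro conjI ballI)
    fix x y assume "x \<in> gasket" "y \<in> gasket"
    then have "\<bar>w (x, y)\<bar> \<le> D x y" "\<bar>\<eta> (x, y)\<bar> \<le> E x y" using D(2) E(2) by (auto simp: controlled_def)
    then show "\<bar>w (x, y) + \<eta> (x, y)\<bar> \<le> D x y + E x y" by linarith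
  next
    fix x y z assume "x \<in> gasket" "y \<in> gasket" "z \<in> gasket"
    then have 1: "\<bar>w (z, x) - w (z, y) - w (y, x)\<bar> \<le> D z y * D y x"
      "\<bar>\<eta> (z, x) - \<eta> (z, y) - \<eta> (y, x)\<bar> \<le> E z y * E y x" using D(2) E(2) by (auto simp: controlled_def)
    have "0 \<le> D z y * E y x" "0 \<le> E z y * D y x" by (simp_all add: nonneg)
    then have "D z y * D y x + E z y * E y x \<le> (D z y + E z y) * (D y x + E y x)"
      by (simp add: algebra_simps)
    with 1 show "\<bar>w (z, x) + \<eta> (z, x) - (w (z, y) + \<eta> (z, y)) - (w (y, x) + \<eta> (y, x))\<bar> \<le>
        (D z y + E z y) * (D y x + E y x)" by linarith
  qed
  then show ?case using finite_variation_add[OF D(1) E(1)] by blast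
next
  case (left f w)
  then show ?case using controlled_left by blast
next
  case (right w f)
  then show ?case using controlled_right by blast
qed

text \<open>Halving an edge changes its contribution by the additivity defect at its midpoint. The
  product of the two kernel values there is at most the sum of their squares, one from each
  subcell.\<close>

lemma side_sum_step:
  assumes D: "finite_variation D" "controlled D w" and "i \<noteq> j"
  shows "\<bar>side_sum w s i j (Suc k) - side_sum w s i j k\<bar> \<le> (\<Sum>t\<in>words (Suc k). cell_square D (s @ t))"
proof -
  define \<delta> where "\<delta> r = w (vtx (r @ [i]) j, vtx (r @ [i]) i) + w (vtx (r @ [j]) j, vtx (r @ [j]) i) -
    w (vtx r j, vtx r i)" for r
  have "\<bar>\<delta> r\<bar> \<le> cell_square D (r @ [i]) + cell_square D (r @ [j])" for r
  proof -
    let ?x = "vtx r i" and ?y = "vtx (r @ [i]) j" and ?z = "vtx r j"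
    have "\<bar>\<delta> r\<bar> = \<bar>w (?z, ?x) - w (?z, ?y) - w (?y, ?x)\<bar>"
      unfolding \<delta>_def by (simp add: vtx_snoc_same vtx_snoc_swap[of r j i])
    also have "\<dots> \<le> D ?z ?y * D ?y ?x" using D(2) by (simp add: controlled_def)
    also have "\<dots> \<le> (D ?y ?x)\<^sup>2 + (D ?z ?y)\<^sup>2" using mult_le_sum_squares[of "D ?z ?y" "D ?y ?x"] by simp
    also have "\<dots> \<le> cell_square D (r @ [i]) + cell_square D (r @ [j])"
      using square_le_cell_square[of D "r @ [i]" j i] square_le_cell_square[of D "r @ [j]" j i]
      by (simp add: vtx_snoc_same vtx_snoc_swap[of r j i])
    finally show ?thesis .
  qed
  then have "\<bar>\<Sum>t\<in>side_words k i j. \<delta> (s @ t)\<bar> \<le>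
      (\<Sum>t\<in>side_words k i j. cell_square D (s @ t @ [i]) + cell_square D (s @ t @ [j]))"
    by (intro sum_abs[THEN order_trans] sum_mono) (metis append.assoc)
  also have "\<dots> = (\<Sum>t\<in>side_words (Suc k) i j. cell_square D (s @ t))"
    by (simp add: sum_side_words_Suc_snoc[OF assms(3)])
  also have "\<dots> \<le> (\<Sum>t\<in>words (Suc k). cell_square D (s @ t))"
    by (intro sum_mono2 side_words_subset cell_square_nonneg) simp
  also have "(\<Sum>t\<in>side_words k i j. \<delta> (s @ t)) = side_sum w s i j (Suc k) - side_sum w s i j k"
    by (simp add: side_sum_def sum_side_words_Suc_snoc[OF assms(3)] \<delta>_def sum_subtractf)
  finally show ?thesis .
qed

text \<open>It dominates the total effect of refining the sides of C_s indefinitely, and its sum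
  over a level still decays at the rate 3/5.\<close>

definition cell_remainder :: "(point \<Rightarrow> point \<Rightarrow> real) \<Rightarrow> word \<Rightarrow> real" where
  "cell_remainder D s = (\<Sum>k. \<Sum>t\<in>words k. cell_square D (s @ t))"

lemma cell_remainder:
  assumes "finite_variation D"
  shows "summable (\<lambda>k. \<Sum>t\<in>words k. cell_square D (s @ t))"
    and "cell_square D s \<le> cell_remainder D s"
    and "\<exists>C\<ge>0. \<forall>m. (\<Sum>s\<in>words m. cell_remainder D s) \<le> C * (3/5) ^ m"
proof -
  define T where "T k s = (\<Sum>t\<in>words k. cell_square D (s @ t))" for k s
  obtain M where M: "\<And>m. (\<Sum>s\<in>words m. cell_square D s) \<le> M * (3/5) ^ m"
    using assms unfolding finite_variation_def by blast
  have T_nonneg: "0 \<le> T k s" for k s by (simp add: T_def sum_nonneg cell_square_nonneg)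
  have T_sum: "(\<Sum>s\<in>words m. T k s) \<le> M * (3/5) ^ m * (3/5) ^ k" for m k
    using M[of "m + k"] by (simp add: T_def sum_words_add power_add mult.assoc)
  have "T k s \<le> M * (3/5) ^ length s * (3/5) ^ k" for k s
    by (rule order_trans[OF member_le_sum T_sum]) (auto simp: T_nonneg words_def finite_words[unfolded words_def])
  moreover have geom: "summable (\<lambda>k. c * (3/5) ^ k)" for c :: real by (intro summable_mult summable_geometric) simp
  ultimately have T_summable: "summable (\<lambda>k. T k s)" for s
    by (intro summable_comparison_test'[OF geom[of "M * (3/5) ^ length s"], of 0]) (simp add: T_nonneg)
  then show "summable (\<lambda>k. \<Sum>t\<in>words k. cell_square D (s @ t))" by (simp add: T_def)
  have "sum (\<lambda>k. T k s) {0} \<le> (\<Sum>k. T k s)" by (intro sum_le_suminf T_summable T_nonneg) simp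
  then show "cell_square D s \<le> cell_remainder D s" by (simp add: cell_remainder_def T_def)
  have M0: "0 \<le> M" using M[of 0] cell_square_nonneg[of D "[]"] by simp
  \<comment> \<open>5/2 is the sum of the geometric series of ratio 3/5.\<close>
  have "(\<Sum>s\<in>words m. cell_remainder D s) \<le> (5/2 * M) * (3/5) ^ m" for m
  proof -
    have "(\<Sum>s\<in>words m. cell_remainder D s) = (\<Sum>k. \<Sum>s\<in>words m. T k s)"
      unfolding cell_remainder_def T_def[symmetric] by (rule suminf_sum[symmetric]) (rule T_summable)
    also have "\<dots> \<le> (\<Sum>k. M * (3/5) ^ m * (3/5) ^ k)"
      by (intro suminf_le T_sum summable_sum T_summable geom)
    also have "\<dots> = M * (3/5) ^ m * (1 / (1 - 3/5))"
      by (subst suminf_mult) (auto simp: suminf_geometric intro!: summable_geometric)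
    finally show ?thesis by simp
  qed
  then show "\<exists>C\<ge>0. \<forall>m. (\<Sum>s\<in>words m. cell_remainder D s) \<le> C * (3/5) ^ m"
    using M0 by (intro exI[of _ "5/2 * M"]) auto
qed

lemma side_sum_converges:
  assumes D: "finite_variation D" "controlled D w" and "i \<noteq> j"
  shows "side_sum w s i j \<longlonglongrightarrow> edge_integral w s i j"
    and "\<bar>edge_integral w s i j - w (vtx s j, vtx s i)\<bar> \<le> cell_remainder D s"
proof -
  define d where "d k = side_sum w s i j (Suc k) - side_sum w s i j k" for k
  define T where "T k = (\<Sum>t\<in>words k. cell_square D (s @ t))" for k
  have T: "summable T" using cell_remainder(1)[OF D(1)] by (simp add: T_def[abs_def])
  then have T': "summable (\<lambda>k. T (Suc k))" by (simp only: summable_Suc_iff)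
  have dT: "\<bar>d k\<bar> \<le> T (Suc k)" for k unfolding d_def T_def by (rule side_sum_step[OF assms])
  have abs_d: "summable (\<lambda>k. \<bar>d k\<bar>)" by (rule summable_comparison_test'[OF T', of 0]) (simp add: dT)
  then have sd: "summable d" by (rule summable_rabs_cancel)
  have eq: "side_sum w s i j n = w (vtx s j, vtx s i) + (\<Sum>k<n. d k)" for n
    unfolding d_def sum_lessThan_telescope by (simp add: side_sum_def)
  have lim: "side_sum w s i j \<longlonglongrightarrow> w (vtx s j, vtx s i) + (\<Sum>k. d k)"
    unfolding eq[abs_def] by (intro tendsto_add tendsto_const summable_LIMSEQ sd)
  have J: "edge_integral w s i j = w (vtx s j, vtx s i) + (\<Sum>k. d k)"
    by (rule edge_integral_eqI[OF assms(3) lim])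
  show "side_sum w s i j \<longlonglongrightarrow> edge_integral w s i j" using lim J by simp
  have "\<bar>\<Sum>k. d k\<bar> \<le> (\<Sum>k. \<bar>d k\<bar>)" by (rule summable_rabs[OF abs_d])
  also have "\<dots> \<le> (\<Sum>k. T (Suc k))" by (intro suminf_le dT abs_d T')
  also have "\<dots> = (\<Sum>k. T k) - T 0" by (rule suminf_split_head[OF T])
  also have "\<dots> \<le> cell_remainder D s"
    by (simp add: cell_remainder_def T_def cell_square_nonneg)
  finally show "\<bar>edge_integral w s i j - w (vtx s j, vtx s i)\<bar> \<le> cell_remainder D s" using J by simp
qed

section \<open>Edge integrals as additive cochains\<close>

definition additive_cochain :: "cochain \<Rightarrow> bool" where
  "additive_cochain J \<longleftrightarrow> (\<forall>s i j. J s i j = - J s j i \<and> J s i j = J (s @ [i]) i j + J (s @ [j]) i j)"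

definition circulation :: "cochain \<Rightarrow> word \<Rightarrow> real" where
  "circulation J s = J s 0 1 + J s 1 2 + J s 2 0"

definition edge_squares :: "cochain \<Rightarrow> word \<Rightarrow> real" where
  "edge_squares J s = (J s 0 1)\<^sup>2 + (J s 1 2)\<^sup>2 + (J s 2 0)\<^sup>2"

lemma side_sum_Cons: "side_sum w s i j (Suc k) = side_sum w (s @ [i]) i j k + side_sum w (s @ [j]) i j k" if "i \<noteq> j"
  by (simp add: side_sum_def sum_side_words_Suc_Cons[OF that])

lemma form_side_sum: "w \<in> forms \<Longrightarrow> i \<noteq> j \<Longrightarrow> side_sum w s i j \<longlonglongrightarrow> edge_integral w s i j"
  using forms_controlled side_sum_converges(1) by blast

text \<open>Additivity under halving is a regrouping of the refinements. Antisymmetry can fail for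
  the form itself: \<open>w (z, y) + w (y, z)\<close> is, up to sign, the defect of a triple with
  equal ends, and its sum over the refined edge is bounded by the general term of a convergent
  series.\<close>

lemma additive_edge_integral:
  assumes "w \<in> forms"
  shows "additive_cochain (edge_integral w)"
  unfolding additive_cochain_def
proof (intro allI conjI)
  fix s i j
  obtain D where D: "finite_variation D" "controlled D w" using forms_controlled[OF assms] by blast
  note lim = form_side_sum[OF assms]
  show "edge_integral w s i j = edge_integral w (s @ [i]) i j + edge_integral w (s @ [j]) i j"
  proof (cases "i = j")
    case False
    have "(\<lambda>k. side_sum w s i j (Suc k)) \<longlonglongrightarrow> edge_integral w (s @ [i]) i j + edge_integral w (s @ [j]) i j"
      unfolding side_sum_Cons[OF False] by (intro tendsto_add lim False)
    moreover have "(\<lambda>k. side_sum w s i j (Suc k)) \<longlonglongrightarrow> edge_integral w s i j"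
      by (rule LIMSEQ_Suc[OF lim[OF False]])
    ultimately show ?thesis by (rule LIMSEQ_unique[symmetric])
  qed simp
  show "edge_integral w s i j = - edge_integral w s j i"
  proof (cases "i = j")
    case False
    define T where "T k = (\<Sum>t\<in>words k. cell_square D (s @ t))" for k
    have small: "\<bar>w (vtx r j, vtx r i) + w (vtx r i, vtx r j)\<bar> \<le> cell_square D r" for r
    proof -
      have "\<bar>w (vtx r j, vtx r j)\<bar> \<le> D (vtx r j) (vtx r j)" using D(2) by (simp add: controlled_def)
      also have "\<dots> = 0" using D(1) by (simp add: finite_variation_def)
      finally have 0: "w (vtx r j, vtx r j) = 0" by simp
      have "\<bar>w (vtx r j, vtx r j) - w (vtx r j, vtx r i) - w (vtx r i, vtx r j)\<bar> \<le>
          D (vtx r j) (vtx r i) * D (vtx r i) (vtx r j)" using D(2) by (simp add: controlled_def)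
      also have "\<dots> = (D (vtx r j) (vtx r i))\<^sup>2" using D(1) by (simp add: finite_variation_def power2_eq_square)
      also have "\<dots> \<le> cell_square D r" by (rule square_le_cell_square)
      finally show ?thesis unfolding 0 by linarith
    qed
    have bound: "norm (side_sum w s i j k + side_sum w s j i k) \<le> T k" for k
    proof -
      have "side_sum w s i j k + side_sum w s j i k = (\<Sum>t\<in>side_words k i j.
          w (vtx (s @ t) j, vtx (s @ t) i) + w (vtx (s @ t) i, vtx (s @ t) j))"
        unfolding side_sum_def side_words_swap[of k j i] by (simp add: sum.distrib)
      also have "\<bar>\<dots>\<bar> \<le> (\<Sum>t\<in>side_words k i j. cell_square D (s @ t))"
        by (intro sum_abs[THEN order_trans] sum_mono small)
      also have "\<dots> \<le> T k" unfolding T_def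
        by (intro sum_mono2 side_words_subset cell_square_nonneg) simp
      finally show ?thesis by simp
    qed
    have "T \<longlonglongrightarrow> 0"
      using summable_LIMSEQ_zero[OF cell_remainder(1)[OF D(1)]] by (simp add: T_def[abs_def])
    then have "(\<lambda>k. side_sum w s i j k + side_sum w s j i k) \<longlonglongrightarrow> 0"
      by (rule Lim_null_comparison[OF always_eventually[OF allI[OF bound]]])
    moreover have "(\<lambda>k. side_sum w s i j k + side_sum w s j i k) \<longlonglongrightarrow> edge_integral w s i j + edge_integral w s j i"
      using False by (intro tendsto_add lim) auto
    ultimately have "edge_integral w s i j + edge_integral w s j i = 0" by (rule LIMSEQ_unique[symmetric])
    then show ?thesis by simp
  qed simp
qed

text \<open>This bounds \<open>Q_level\<close> of a form over all levels. The integral is compared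
  with the value of the form on the same edge, the error being at most
  \<open>cell_remainder\<close>.\<close>

lemma edge_squares_edge_integral:
  assumes "\<omega> \<in> forms"
  shows "\<exists>C. \<forall>m. (\<Sum>s\<in>words m. edge_squares (edge_integral \<omega>) s) \<le> C * (3/5) ^ m"
proof -
  obtain D where D: "finite_variation D" "controlled D \<omega>" using forms_controlled[OF assms] by blast
  define R where "R = cell_remainder D"
  obtain C where C: "0 \<le> C" "\<And>m. (\<Sum>s\<in>words m. R s) \<le> C * (3/5) ^ m"
    using cell_remainder(3)[OF D(1)] unfolding R_def by blast
  have R: "cell_square D s \<le> R s" for s unfolding R_def by (rule cell_remainder(2)[OF D(1)])
  then have R0: "0 \<le> R s" for s using cell_square_nonneg order_trans by blast
  have sq: "(edge_integral \<omega> s i j)\<^sup>2 \<le> 2 * (R s)\<^sup>2 + 2 * R s" if "i \<noteq> j" for s i j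
  proof -
    let ?w = "\<omega> (vtx s j, vtx s i)" and ?J = "edge_integral \<omega> s i j"
    have "?J\<^sup>2 = ((?J - ?w) + ?w)\<^sup>2" by simp
    also have "\<dots> \<le> 2 * (?J - ?w)\<^sup>2 + 2 * ?w\<^sup>2"
      by (rule power2_add_le)
    also have "(?J - ?w)\<^sup>2 \<le> (R s)\<^sup>2"
      using side_sum_converges(2)[OF D that, of s] unfolding R_def by (intro power2_le_iff_abs_le[THEN iffD2]) (use R0 R_def in auto)
    also have "?w\<^sup>2 \<le> (D (vtx s j) (vtx s i))\<^sup>2"
    proof (rule power2_le_iff_abs_le[THEN iffD2])
      show "0 \<le> D (vtx s j) (vtx s i)" using D(1) by (simp add: finite_variation_def)
      show "\<bar>?w\<bar> \<le> D (vtx s j) (vtx s i)" using D(2) by (simp add: controlled_def)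
    qed
    also have "\<dots> \<le> R s" using square_le_cell_square R order_trans by blast
    finally show ?thesis by simp
  qed
  have "(\<Sum>s\<in>words m. edge_squares (edge_integral \<omega>) s) \<le> (6 * C\<^sup>2 + 6 * C) * (3/5) ^ m" for m
  proof -
    have "(\<Sum>s\<in>words m. edge_squares (edge_integral \<omega>) s) \<le> (\<Sum>s\<in>words m. 6 * (R s)\<^sup>2 + 6 * R s)"
    proof (rule sum_mono)
      fix s show "edge_squares (edge_integral \<omega>) s \<le> 6 * (R s)\<^sup>2 + 6 * R s"
        using sq[of 0 1 s] sq[of 1 2 s] sq[of 2 0 s] unfolding edge_squares_def by simp
    qed
    also have "\<dots> = 6 * (\<Sum>s\<in>words m. (R s)\<^sup>2) + 6 * (\<Sum>s\<in>words m. R s)"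
      by (simp add: sum.distrib sum_distrib_left)
    \<comment> \<open>One factor is replaced by the sum over the whole level, so the squares of the
      remainders decay at least as fast.\<close>
    also have "(\<Sum>s\<in>words m. (R s)\<^sup>2) \<le> (\<Sum>s\<in>words m. R s * (C * (3/5) ^ m))"
    proof (rule sum_mono)
      fix s assume "s \<in> words m"
      then have "R s \<le> (\<Sum>s\<in>words m. R s)" by (rule member_le_sum) (auto simp: R0)
      then show "(R s)\<^sup>2 \<le> R s * (C * (3/5) ^ m)"
        unfolding power2_eq_square using C(2)[of m] R0 by (intro mult_left_mono) auto
    qed
    also have "\<dots> \<le> C * (3/5) ^ m * (C * (3/5) ^ m)"
      unfolding sum_distrib_right[symmetric] using C by (intro mult_right_mono) auto
    also have "\<dots> \<le> C * (3/5) ^ m * (C * 1)"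
      using C(1) by (intro mult_left_mono power_le_one) auto
    also have "(\<Sum>s\<in>words m. R s) \<le> C * (3/5) ^ m" by (rule C)
    finally show ?thesis by (simp add: power2_eq_square algebra_simps)
  qed
  then show ?thesis by blast
qed

text \<open>Of the six remainders, three come from replacing the integrals along the sides by values
  of the form, two from the defect at vertex 1 and one from reversing the last side.\<close>

lemma circulation_edge_integral:
  assumes "w \<in> forms"
  shows "\<exists>C. \<forall>m. (\<Sum>s\<in>words m. \<bar>circulation (edge_integral w) s\<bar>) \<le> C * (3/5) ^ m"
proof -
  obtain D where D: "finite_variation D" "controlled D w" using forms_controlled[OF assms] by blast
  define R where "R = cell_remainder D"
  obtain C where C: "0 \<le> C" "\<And>m. (\<Sum>s\<in>words m. R s) \<le> C * (3/5) ^ m"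
    using cell_remainder(3)[OF D(1)] unfolding R_def by blast
  have R: "cell_square D s \<le> R s" for s unfolding R_def by (rule cell_remainder(2)[OF D(1)])
  have "\<bar>circulation (edge_integral w) s\<bar> \<le> 6 * R s" for s
  proof -
    let ?v = "vtx s"
    have "\<bar>edge_integral w s i j - w (?v j, ?v i)\<bar> \<le> R s" if "i \<noteq> j" for i j
      using side_sum_converges(2)[OF D that] by (simp add: R_def)
    from this[of 0 1] this[of 1 2] this[of 2 0]
    have 1: "\<bar>circulation (edge_integral w) s - (w (?v 1, ?v 0) + w (?v 2, ?v 1) + w (?v 0, ?v 2))\<bar> \<le> 3 * R s"
      unfolding circulation_def by simp
    have 2: "\<bar>w (?v c, ?v a) - w (?v c, ?v b) - w (?v b, ?v a)\<bar> \<le> R s + R s" for a b c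
    proof -
      have "\<bar>w (?v c, ?v a) - w (?v c, ?v b) - w (?v b, ?v a)\<bar> \<le> D (?v c) (?v b) * D (?v b) (?v a)"
        using D(2) by (simp add: controlled_def)
      also have "\<dots> \<le> (D (?v c) (?v b))\<^sup>2 + (D (?v b) (?v a))\<^sup>2" by (rule mult_le_sum_squares)
      also have "\<dots> \<le> R s + R s" by (intro add_mono order_trans[OF square_le_cell_square R])
      finally show ?thesis .
    qed
    have 3: "w (?v 0, ?v 0) = 0"
    proof -
      have "\<bar>w (?v 0, ?v 0)\<bar> \<le> D (?v 0) (?v 0)" using D(2) by (simp add: controlled_def)
      then show ?thesis using D(1) by (simp add: finite_variation_def)
    qed
    have 4: "\<bar>w (?v 0, ?v 0) - w (?v 0, ?v 2) - w (?v 2, ?v 0)\<bar> \<le> R s"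
    proof -
      have "\<bar>w (?v 0, ?v 0) - w (?v 0, ?v 2) - w (?v 2, ?v 0)\<bar> \<le> D (?v 0) (?v 2) * D (?v 2) (?v 0)"
        using D(2) by (simp add: controlled_def)
      also have "\<dots> = (D (?v 0) (?v 2))\<^sup>2" using D(1) by (simp add: finite_variation_def power2_eq_square)
      finally show ?thesis using square_le_cell_square[of D s 0 2] R[of s] by simp
    qed
    show ?thesis using 1 2[of 2 0 1] 3 4 by (simp add: abs_le_iff)
  qed
  then have "(\<Sum>s\<in>words m. \<bar>circulation (edge_integral w) s\<bar>) \<le> (\<Sum>s\<in>words m. 6 * R s)" for m
    by (intro sum_mono)
  then have "(\<Sum>s\<in>words m. \<bar>circulation (edge_integral w) s\<bar>) \<le> (6 * C) * (3/5) ^ m" for m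
    unfolding sum_distrib_left[symmetric] mult.assoc
    by (rule order_trans) (intro mult_left_mono C(2), simp)
  then show ?thesis by blast
qed

text \<open>For increments of a compatible family halving changes nothing, since the values at the
  midpoint cancel.\<close>

lemma side_sum_exact:
  assumes "compat u" "i \<noteq> j" "\<And>t. w (vtx (s @ t) j, vtx (s @ t) i) = u t j - u t i"
  shows "edge_integral w s i j = u [] j - u [] i"
proof -
  have "side_sum w s i j k = u [] j - u [] i" for k
  proof (induction k)
    case 0
    show ?case using assms(3)[of "[]"] by (simp add: side_sum_def)
  next
    case (Suc k)
    have "u (t @ [i]) j - u (t @ [i]) i + (u (t @ [j]) j - u (t @ [j]) i) = u t j - u t i" for t
      using compat_same[OF assms(1)] compat_swap[OF assms(1), of t i j] by simp
    then show ?case using Suc by (simp add: side_sum_def sum_side_words_Suc_snoc[OF assms(2)] assms(3))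
  qed
  then have "side_sum w s i j = (\<lambda>_. u [] j - u [] i)" by (rule ext)
  then show ?thesis by (intro edge_integral_eqI assms) simp
qed

lemma edge_integral_differential: "edge_integral (differential g) s i j = g (vtx s j) - g (vtx s i)"
proof (cases "i = j")
  case False
  have "edge_integral (differential g) s i j = g (vtx (s @ []) j) - g (vtx (s @ []) i)"
    by (rule side_sum_exact[OF compat_append[OF compat_vtx, of g s] False]) (simp add: differential_gasket)
  then show ?thesis by simp
qed simp

lemma edge_integral_lincomb:
  assumes "\<And>s. s \<in> S \<Longrightarrow> w s \<in> forms"
  shows "edge_integral (\<lambda>z. \<Sum>s\<in>S. c s * w s z) \<sigma> i j = (\<Sum>s\<in>S. c s * edge_integral (w s) \<sigma> i j)"
proof (cases "i = j")
  case False
  have "side_sum (\<lambda>z. \<Sum>s\<in>S. c s * w s z) \<sigma> i j k = (\<Sum>s\<in>S. c s * side_sum (w s) \<sigma> i j k)" for k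
    unfolding side_sum_def sum_distrib_left by (rule sum.swap)
  then have eq: "side_sum (\<lambda>z. \<Sum>s\<in>S. c s * w s z) \<sigma> i j = (\<lambda>k. \<Sum>s\<in>S. c s * side_sum (w s) \<sigma> i j k)"
    by (rule ext)
  have "side_sum (\<lambda>z. \<Sum>s\<in>S. c s * w s z) \<sigma> i j \<longlonglongrightarrow> (\<Sum>s\<in>S. c s * edge_integral (w s) \<sigma> i j)"
    unfolding eq by (intro tendsto_sum tendsto_mult tendsto_const form_side_sum assms False)
  then show ?thesis by (rule edge_integral_eqI[OF False])
qed simp

lemma edge_integral_add:
  assumes "w \<in> forms" "\<eta> \<in> forms"
  shows "edge_integral (\<lambda>z. w z + \<eta> z) s i j = edge_integral w s i j + edge_integral \<eta> s i j"
  using edge_integral_lincomb[of UNIV "\<lambda>b. if b then w else \<eta>" "\<lambda>_. 1" s i j] assms by (simp add: UNIV_bool add.commute)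

lemma edge_integral_diff:
  assumes "w \<in> forms" "\<eta> \<in> forms"
  shows "edge_integral (\<lambda>z. w z - \<eta> z) s i j = edge_integral w s i j - edge_integral \<eta> s i j"
  using edge_integral_lincomb[of UNIV "\<lambda>b. if b then w else \<eta>" "\<lambda>b. if b then 1 else -1" s i j] assms
  by (simp add: UNIV_bool)

section \<open>Classes of forms\<close>

lemma zero_form: "(\<lambda>z. 0) \<in> forms"
  using forms.gen[OF zero_finite_energy zero_finite_energy] by (simp add: case_prod_unfold)

lemma forms_vanish: "w \<in> forms \<Longrightarrow> x \<notin> gasket \<or> y \<notin> gasket \<Longrightarrow> w (x, y) = 0"
  by (induction rule: forms.induct) (auto simp: finite_energy_def differential_def tens_def)

text \<open>The rules for \<open>forms\<close> contain no scalars: c acts as the constant function c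
  on K. Forms vanish off K \<times> K, so the extension of that constant by 0 does no harm.\<close>

lemma forms_scale: "(\<lambda>z. c * w z) \<in> forms" if "w \<in> forms"
proof -
  have "(\<lambda>(x, y). c * indicat_real gasket x * w (x, y)) \<in> forms"
    using forms.left[OF const_finite_energy that] .
  moreover have "(\<lambda>(x, y). c * indicat_real gasket x * w (x, y)) = (\<lambda>z. c * w z)"
    using forms_vanish[OF that] by (auto simp: fun_eq_iff indicator_def)
  ultimately show ?thesis by simp
qed

lemma forms_lincomb:
  assumes "finite S" "\<And>s. s \<in> S \<Longrightarrow> w s \<in> forms"
  shows "(\<lambda>z. \<Sum>s\<in>S. c s * w s z) \<in> forms"
  using assms by (induction S) (auto intro!: zero_form forms.add forms_scale)

lemma forms_diff: "(\<lambda>z. w z - \<eta> z) \<in> forms" if "w \<in> forms" "\<eta> \<in> forms"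
  using forms.add[OF that(1) forms_scale[OF that(2), of "-1"]] by simp

lemma differential_form: "differential g \<in> forms" if "g \<in> finite_energy"
proof -
  have "(\<lambda>(x, y). 1 * indicat_real gasket x * differential g (x, y)) \<in> forms"
    using forms.gen[OF const_finite_energy that] .
  moreover have "(\<lambda>(x, y). 1 * indicat_real gasket x * differential g (x, y)) = differential g"
    using that by (auto simp: fun_eq_iff indicator_def differential_def tens_def finite_energy_def)
  ultimately show ?thesis by simp
qed

lemma path_integral_list:
  assumes "w \<in> forms" "set \<gamma> \<subseteq> all_oedges"
  shows "path_integral \<gamma> w = (\<Sum>e\<leftarrow>\<gamma>. path_integral [e] w)"
proof -
  have "(\<lambda>n. \<Sum>e\<leftarrow>\<gamma>. \<Sum>(x, y)\<in>refine n e. w (y, x)) \<longlonglongrightarrow> (\<Sum>e\<leftarrow>\<gamma>. path_integral [e] w)"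
    using assms(2)
  proof (induction \<gamma>)
    case (Cons e \<gamma>)
    then obtain s i j where e: "e = oedge s i j" "i \<noteq> j" by (auto simp: all_oedges_eq)
    have "(\<lambda>n. \<Sum>(x, y)\<in>refine n e. w (y, x)) \<longlonglongrightarrow> path_integral [e] w"
      using side_sum_limit_refine[OF e(2) form_side_sum[OF assms(1) e(2)]] by (simp add: e edge_integral_def)
    then show ?case using Cons by (auto intro!: tendsto_add)
  qed simp
  then show ?thesis unfolding path_integral_def by (simp add: limI)
qed

text \<open>A class thus amounts to a cochain of edge integrals, and identities between classes can
  be checked with \<open>edge_integral\<close>.\<close>

lemma form_rel_iff: "(w, \<eta>) \<in> form_rel \<longleftrightarrow> w \<in> forms \<and> \<eta> \<in> forms \<and> edge_integral w = edge_integral \<eta>"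
proof (cases "w \<in> forms \<and> \<eta> \<in> forms")
  case True
  have "(\<forall>e\<in>all_oedges. path_integral [e] (\<lambda>z. w z - \<eta> z) = 0) \<longleftrightarrow>
      (\<forall>s i j. i \<noteq> j \<longrightarrow> edge_integral (\<lambda>z. w z - \<eta> z) s i j = 0)"
    unfolding all_oedges_eq edge_integral_def by blast
  also have "\<dots> \<longleftrightarrow> (\<forall>s i j. i \<noteq> j \<longrightarrow> edge_integral w s i j = edge_integral \<eta> s i j)"
    using edge_integral_diff True by simp
  also have "\<dots> \<longleftrightarrow> edge_integral w = edge_integral \<eta>"
    unfolding fun_eq_iff by (metis edge_integral_same)
  finally show ?thesis using True by (simp add: form_rel_def)
qed (auto simp: form_rel_def)

lemma form_class_eq: "form_class w = {\<eta>. \<eta> \<in> forms \<and> edge_integral \<eta> = edge_integral w}" if "w \<in> forms"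
  using that by (auto simp: form_class_def form_rel_iff)

lemma form_class_smooth: "form_class w \<in> smooth_forms" if "w \<in> forms"
  using that by (simp add: form_class_def smooth_forms_def quotientI)

lemma smooth_formsE:
  assumes "W \<in> smooth_forms"
  obtains w where "w \<in> forms" "W = form_class w"
  using assms unfolding smooth_forms_def form_class_def by (auto elim: quotientE)

lemma form_class_eq_iff:
  assumes "w \<in> forms" "\<eta> \<in> forms"
  shows "form_class w = form_class \<eta> \<longleftrightarrow> edge_integral w = edge_integral \<eta>"
  using assms by (auto simp: form_class_eq)

lemma form_integral_class:
  assumes "w \<in> forms" "set \<gamma> \<subseteq> all_oedges"
  shows "form_integral \<gamma> (form_class w) = (\<Sum>e\<leftarrow>\<gamma>. path_integral [e] w)"
proof -
  have "path_integral \<gamma> \<eta> = (\<Sum>e\<leftarrow>\<gamma>. path_integral [e] w)" if "\<eta> \<in> form_class w" for \<eta>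
  proof -
    have \<eta>: "\<eta> \<in> forms" "edge_integral \<eta> = edge_integral w" using that assms by (auto simp: form_class_eq)
    have "path_integral [e] \<eta> = path_integral [e] w" if e: "e \<in> set \<gamma>" for e
    proof -
      obtain s i j where "e = oedge s i j" using e assms(2) by (auto simp: all_oedges_eq)
      then show ?thesis using fun_cong[OF fun_cong[OF fun_cong[OF \<eta>(2)]]] by (simp add: edge_integral_def)
    qed
    then have "(\<Sum>e\<leftarrow>\<gamma>. path_integral [e] \<eta>) = (\<Sum>e\<leftarrow>\<gamma>. path_integral [e] w)" by (intro arg_cong[of _ _ sum_list]) simp
    then show ?thesis using path_integral_list[OF \<eta>(1) assms(2)] by simp
  qed
  moreover have "w \<in> form_class w" using assms by (simp add: form_class_eq)
  ultimately have "path_integral \<gamma> ` form_class w = {\<Sum>e\<leftarrow>\<gamma>. path_integral [e] w}" by force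
  then show ?thesis by (simp add: form_integral_def)
qed

lemma oedge_all_oedges: "i \<noteq> j \<Longrightarrow> oedge s i j \<in> all_oedges"
  by (auto simp: all_oedges_eq)

lemma form_integral_edge:
  assumes "w \<in> forms" "i \<noteq> j"
  shows "form_integral [oedge s i j] (form_class w) = edge_integral w s i j"
  using form_integral_class[OF assms(1), of "[oedge s i j]"] oedge_all_oedges[OF assms(2)] by (simp add: edge_integral_def)

text \<open>Run clockwise, the lacuna passes each subcell k along its side from k + 2 to k + 1, that
  is, against the direction in which \<open>circulation\<close> runs around that subcell.\<close>

definition lacuna_period :: "cochain \<Rightarrow> word \<Rightarrow> real" where
  "lacuna_period J s = J (s @ [1]) 0 2 + J (s @ [2]) 1 0 + J (s @ [0]) 2 1"

lemma lacuna_eq: "lacuna s = [oedge (s @ [1]) 0 2, oedge (s @ [2]) 1 0, oedge (s @ [0]) 2 1]"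
proof -
  have "midpoint (corner i) (corner j) = contr i (corner j)" for i j
    by (simp add: midpoint_def contr_eq scaleR_add_right)
  moreover have "midpoint (corner i) (corner j) = contr j (corner i)" for i j
    by (simp add: midpoint_def contr_eq scaleR_add_right add.commute)
  ultimately have m: "midpoint (corner i) (corner j) = vtx [i] j \<and> vtx [i] j = vtx [j] i" for i j
    by (simp add: vtx_Cons)
  show ?thesis
    unfolding lacuna_def lacuna0_def Let_def
    by (simp add: m map_edge_def oedge_def contr_corner_swap[of 0 1] contr_corner_swap[of 1 2] contr_corner_swap[of 2 0] vtx_append vtx_Cons)
qed

lemma form_integral_lacuna:
  assumes "w \<in> forms"
  shows "form_integral (lacuna s) (form_class w) = lacuna_period (edge_integral w) s"
proof -
  have "set (lacuna s) \<subseteq> all_oedges" by (auto simp: lacuna_eq intro!: oedge_all_oedges)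
  from form_integral_class[OF assms this] show ?thesis
    by (simp add: lacuna_eq lacuna_period_def edge_integral_def)
qed

text \<open>The operations on classes collect all combinations of representatives; it suffices to
  name one of them and to see that all have equal edge integrals.\<close>

lemma Image_form_rel_eq:
  assumes "\<zeta> \<in> A" "\<And>\<alpha>. \<alpha> \<in> A \<Longrightarrow> \<alpha> \<in> forms \<and> edge_integral \<alpha> = edge_integral \<zeta>"
  shows "form_rel `` A = form_class \<zeta>"
proof (intro equalityI subsetI)
  fix \<eta> assume "\<eta> \<in> form_rel `` A"
  then obtain \<alpha> where "\<alpha> \<in> A" "(\<alpha>, \<eta>) \<in> form_rel" by blast
  then show "\<eta> \<in> form_class \<zeta>"
    using assms(2)[of \<alpha>] assms(2)[OF assms(1)] by (simp add: form_class_def form_rel_iff)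
next
  fix \<eta> assume "\<eta> \<in> form_class \<zeta>"
  then show "\<eta> \<in> form_rel `` A" using assms(1) unfolding form_class_def by blast
qed

lemma form_add_class:
  assumes "w \<in> forms" "\<eta> \<in> forms"
  shows "form_add (form_class w) (form_class \<eta>) = form_class (\<lambda>z. w z + \<eta> z)"
  unfolding form_add_def
proof (rule Image_form_rel_eq)
  show "(\<lambda>z. w z + \<eta> z) \<in> {\<lambda>z. w' z + \<eta>' z |w' \<eta>'. w' \<in> form_class w \<and> \<eta>' \<in> form_class \<eta>}"
    using assms by (auto simp: form_class_eq)
  fix \<alpha> assume "\<alpha> \<in> {\<lambda>z. w' z + \<eta>' z |w' \<eta>'. w' \<in> form_class w \<and> \<eta>' \<in> form_class \<eta>}"
  then obtain w' \<eta>' where \<alpha>: "\<alpha> = (\<lambda>z. w' z + \<eta>' z)" and *: "w' \<in> forms" "\<eta>' \<in> forms"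
      "edge_integral w' = edge_integral w" "edge_integral \<eta>' = edge_integral \<eta>"
    using assms by (auto simp: form_class_eq)
  show "\<alpha> \<in> forms \<and> edge_integral \<alpha> = edge_integral (\<lambda>z. w z + \<eta> z)"
  proof (intro conjI ext)
    show "\<alpha> \<in> forms" unfolding \<alpha> by (intro forms.add *)
    show "edge_integral \<alpha> s i j = edge_integral (\<lambda>z. w z + \<eta> z) s i j" for s i j
      unfolding \<alpha> by (simp add: edge_integral_add assms *)
  qed
qed

lemma form_diff_class:
  assumes "w \<in> forms" "\<eta> \<in> forms"
  shows "form_diff (form_class w) (form_class \<eta>) = form_class (\<lambda>z. w z - \<eta> z)"
  unfolding form_diff_def
proof (rule Image_form_rel_eq)
  show "(\<lambda>z. w z - \<eta> z) \<in> {\<lambda>z. w' z - \<eta>' z |w' \<eta>'. w' \<in> form_class w \<and> \<eta>' \<in> form_class \<eta>}"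
    using assms by (auto simp: form_class_eq)
  fix \<alpha> assume "\<alpha> \<in> {\<lambda>z. w' z - \<eta>' z |w' \<eta>'. w' \<in> form_class w \<and> \<eta>' \<in> form_class \<eta>}"
  then obtain w' \<eta>' where \<alpha>: "\<alpha> = (\<lambda>z. w' z - \<eta>' z)" and *: "w' \<in> forms" "\<eta>' \<in> forms"
      "edge_integral w' = edge_integral w" "edge_integral \<eta>' = edge_integral \<eta>"
    using assms by (auto simp: form_class_eq)
  show "\<alpha> \<in> forms \<and> edge_integral \<alpha> = edge_integral (\<lambda>z. w z - \<eta> z)"
  proof (intro conjI ext)
    show "\<alpha> \<in> forms" unfolding \<alpha> by (intro forms_diff *)
    show "edge_integral \<alpha> s i j = edge_integral (\<lambda>z. w z - \<eta> z) s i j" for s i j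
      unfolding \<alpha> by (simp add: edge_integral_diff assms *)
  qed
qed

lemma form_lincomb_class:
  assumes "finite S" "\<And>s. w s \<in> forms"
  shows "form_lincomb S c (\<lambda>s. form_class (w s)) = form_class (\<lambda>z. \<Sum>s\<in>S. c s * w s z)"
  unfolding form_lincomb_def
proof (rule Image_form_rel_eq)
  show "(\<lambda>z. \<Sum>s\<in>S. c s * w s z) \<in> {\<lambda>z. \<Sum>\<sigma>\<in>S. c \<sigma> * \<eta> \<sigma> z |\<eta>. \<forall>\<sigma>\<in>S. \<eta> \<sigma> \<in> form_class (w \<sigma>)}"
    using assms by (auto simp: form_class_eq)
  fix \<alpha> assume "\<alpha> \<in> {\<lambda>z. \<Sum>\<sigma>\<in>S. c \<sigma> * \<eta> \<sigma> z |\<eta>. \<forall>\<sigma>\<in>S. \<eta> \<sigma> \<in> form_class (w \<sigma>)}"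
  then obtain \<eta> where \<alpha>: "\<alpha> = (\<lambda>z. \<Sum>\<sigma>\<in>S. c \<sigma> * \<eta> \<sigma> z)"
    and \<eta>: "\<And>\<sigma>. \<sigma> \<in> S \<Longrightarrow> \<eta> \<sigma> \<in> forms" "\<And>\<sigma>. \<sigma> \<in> S \<Longrightarrow> edge_integral (\<eta> \<sigma>) = edge_integral (w \<sigma>)"
    using assms by (auto simp: form_class_eq)
  have "edge_integral \<alpha> \<sigma> i j = edge_integral (\<lambda>z. \<Sum>s\<in>S. c s * w s z) \<sigma> i j" for \<sigma> i j
    unfolding \<alpha> using \<eta> assms(2) by (simp add: edge_integral_lincomb)
  then show "\<alpha> \<in> forms \<and> edge_integral \<alpha> = edge_integral (\<lambda>z. \<Sum>s\<in>S. c s * w s z)"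
    unfolding fun_eq_iff \<alpha> using \<eta> assms(1) by (auto intro!: forms_lincomb)
qed

definition level_energy :: "cochain \<Rightarrow> nat \<Rightarrow> real" where
  "level_energy J m = (5/3) ^ m * (\<Sum>s\<in>words m. edge_squares J s)"

lemma edge_squares_nonneg: "0 \<le> edge_squares J s"
  by (simp add: edge_squares_def)

lemma level_energy_nonneg: "0 \<le> level_energy J m"
  by (simp add: level_energy_def sum_nonneg edge_squares_nonneg)

lemma Q_level_class: "Q_level m (form_class w) = level_energy (edge_integral w) m" if "w \<in> forms"
  unfolding Q_level_def level_energy_def sum_edges edge_squares_def by (simp add: form_integral_edge[OF that])

lemma level_energy_bounded:
  assumes "w \<in> forms"
  obtains C where "\<And>m. level_energy (edge_integral w) m \<le> C"
proof -
  obtain C where C: "\<And>m. (\<Sum>s\<in>words m. edge_squares (edge_integral w) s) \<le> C * (3/5) ^ m"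
    using edge_squares_edge_integral[OF assms] by blast
  have "level_energy (edge_integral w) m \<le> C" for m
    using mult_left_mono[OF C[of m], of "(5/3) ^ m"]
    by (simp add: level_energy_def mult.left_commute flip: power_mult_distrib)
  then show thesis by (rule that)
qed


section \<open>Locally exact forms\<close>

text \<open>One-edge paths already reveal the potential; its values at the vertices of C_t are
  listed as a compatible family relative to t.\<close>

lemma n_exactD:
  assumes "n_exact n (form_class w)" "w \<in> forms" "length t = n"
  obtains u where "compat u" "\<And>r i j. edge_integral w (t @ r) i j = u r j - u r i"
proof -
  obtain f where f: "\<And>\<gamma>. elementary_path \<gamma> \<Longrightarrow> path_support \<gamma> \<subseteq> cell t \<Longrightarrow>
      form_integral \<gamma> (form_class w) = f (path_end \<gamma>) - f (path_start \<gamma>)"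
    using assms unfolding n_exact_def by blast
  show thesis
  proof (rule that)
    show "compat (\<lambda>r. vertex_family f (t @ r))" by (rule compat_append[OF compat_vtx])
    show "edge_integral w (t @ r) i j = f (vtx (t @ r) j) - f (vtx (t @ r) i)" for r i j
    proof (cases "i = j")
      case False
      have "elementary_path [oedge (t @ r) i j]" "path_support [oedge (t @ r) i j] \<subseteq> cell t"
        using False segment_subset_cell[OF False, of "t @ r" t]
        by (simp_all add: elementary_path_def path_support_def oedge_all_oedges)
      from f[OF this] show ?thesis
        unfolding form_integral_edge[OF assms(2) False] by (simp add: path_end_def path_start_def oedge_def)
    qed simp
  qed
qed

lemma finite_edges: "finite (edges m)"
  unfolding edges_eq by simp

lemma sum_edges_cell:
  fixes \<phi> :: "edge \<Rightarrow> real"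
  shows "(\<Sum>e\<in>{e \<in> edges (length t + k). segment e \<subseteq> cell t}. \<phi> e) =
    (\<Sum>r\<in>words k. \<phi> (oedge (t @ r) 0 1) + \<phi> (oedge (t @ r) 1 2) + \<phi> (oedge (t @ r) 2 0))"
proof -
  let ?\<Phi> = "\<lambda>r. \<phi> (oedge r 0 1) + \<phi> (oedge r 1 2) + \<phi> (oedge r 2 0)"
  have "(\<Sum>e\<in>{e \<in> edges (length t + k). segment e \<subseteq> cell t}. \<phi> e) =
      (\<Sum>e\<in>edges (length t + k). if segment e \<subseteq> cell t then \<phi> e else 0)"
    by (rule sum.inter_filter[OF finite_edges])
  also have "\<dots> = (\<Sum>r\<in>words (length t + k). if prefix t r then ?\<Phi> r else 0)"
    unfolding sum_edges by (simp add: segment_subset_cell cong: if_cong) (intro sum.cong; simp)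
  also have "\<dots> = (\<Sum>s\<in>words (length t). if s = t then \<Sum>r\<in>words k. ?\<Phi> (t @ r) else 0)"
    unfolding sum_words_add
  proof (rule sum.cong[OF refl])
    fix s assume "s \<in> words (length t)"
    then have "prefix t (s @ r) \<longleftrightarrow> s = t" for r
      by (auto simp: words_def prefix_def)
    then show "(\<Sum>r\<in>words k. if prefix t (s @ r) then ?\<Phi> (s @ r) else 0) =
        (if s = t then \<Sum>r\<in>words k. ?\<Phi> (t @ r) else 0)" by simp
  qed
  also have "\<dots> = (\<Sum>r\<in>words k. ?\<Phi> (t @ r))" by (simp add: words_def finite_words[unfolded words_def])
  finally show ?thesis .
qed

lemma energy_on_cell_finite:
  assumes "g \<in> finite_energy" "\<And>r i. f (vtx (t @ r) i) = g (vtx r i)"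
  shows "energy_on (cell t) f < \<infinity>"
proof -
  obtain M where M: "\<And>m. family_energy (vertex_family g) m \<le> M" using finite_energy_bound[OF assms(1)] by blast
  \<comment> \<open>Relative to C_t the level is shifted by |t|, which contributes the factor
    (5/3)^|t|.\<close>
  define a where "a k = (5/3) ^ length t * family_energy (vertex_family g) k" for k
  have "incseq a"
    using incseq_family_energy[OF compat_vtx, of g] by (auto simp: a_def incseq_def)
  moreover have "0 \<le> a k" for k by (simp add: a_def family_energy_nonneg)
  ultimately have lim: "(\<lambda>k. ennreal (a k)) \<longlonglongrightarrow> (SUP k. ennreal (a k))" by (rule LIMSEQ_ennreal_incseq)
  define e where "e m = ennreal ((5/3)^m * (\<Sum>(x, y)\<in>{e \<in> edges m. segment e \<subseteq> cell t}. \<bar>f y - f x\<bar>\<^sup>2))" for m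
  have "e (k + length t) = ennreal (a k)" for k
    unfolding e_def a_def add.commute[of k] sum_edges_cell
    by (simp add: oedge_def assms(2) family_energy_def edge_prod_def power2_eq_square power_add mult.assoc)
  then have "(\<lambda>k. e (k + length t)) \<longlonglongrightarrow> (SUP k. ennreal (a k))" using lim by simp
  then have "e \<longlonglongrightarrow> (SUP k. ennreal (a k))" by (rule LIMSEQ_offset)
  then have "energy_on (cell t) f = (SUP k. ennreal (a k))"
    unfolding energy_on_def e_def[abs_def] by (rule limI)
  also have "\<dots> \<le> ennreal ((5/3) ^ length t * M)"
    unfolding a_def by (intro SUP_least ennreal_leI mult_left_mono M) simp
  also have "\<dots> < \<infinity>" by simp
  finally show ?thesis .
qed

lemma sum_list_telescope:
  fixes f :: "point \<Rightarrow> real"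
  assumes "\<gamma> \<noteq> []" "successively (\<lambda>e e'. snd e = fst e') \<gamma>"
  shows "(\<Sum>e\<leftarrow>\<gamma>. f (snd e) - f (fst e)) = f (path_end \<gamma>) - f (path_start \<gamma>)"
  using assms
proof (induction \<gamma> rule: list_nonempty_induct)
  case (single e)
  then show ?case by (simp add: path_end_def path_start_def)
next
  case (cons e \<gamma>)
  then show ?case by (cases \<gamma>) (auto simp: path_end_def path_start_def)
qed

lemma n_exactI:
  assumes "w \<in> forms"
    and "\<And>t. length t = n \<Longrightarrow> \<exists>g\<in>finite_energy. \<forall>r i j. edge_integral w (t @ r) i j = g (vtx r j) - g (vtx r i)"
  shows "n_exact n (form_class w)"
  unfolding n_exact_def
proof (intro conjI allI impI form_class_smooth assms(1))
  fix t :: word assume "length t = n"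
  then obtain g where g: "g \<in> finite_energy" "\<And>r i j. edge_integral w (t @ r) i j = g (vtx r j) - g (vtx r i)"
    using assms(2) by blast
  \<comment> \<open>The transport of g to C_t: its argument is the inverse of
    \<open>contr_word t\<close>.\<close>
  define f where "f x = g (2 ^ length t *\<^sub>R (x - contr_word t 0))" for x
  have f_contr: "f (contr_word t x) = g x" for x
    unfolding f_def by (subst contr_word_affine) (simp add: power_one_over)
  then have f_vtx: "f (vtx (t @ r) i) = g (vtx r i)" for r i by (simp add: vtx_append)
  have "continuous_on (cell t) f"
    unfolding f_def[abs_def]
  proof (rule continuous_on_compose2[of gasket g])
    show "continuous_on gasket g" using g(1) by (simp add: finite_energy_def)
    show "(\<lambda>x. 2 ^ length t *\<^sub>R (x - contr_word t 0)) ` cell t \<subseteq> gasket"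
    proof -
      have "2 ^ length t *\<^sub>R (contr_word t x - contr_word t 0) = x" for x
        by (simp add: contr_word_diff power_one_over)
      then show ?thesis by (auto simp: cell_def)
    qed
  qed (intro continuous_intros)
  moreover have "energy_on (cell t) f < \<infinity>" using energy_on_cell_finite[OF g(1) f_vtx] .
  moreover have "form_integral \<gamma> (form_class w) = f (path_end \<gamma>) - f (path_start \<gamma>)"
    if \<gamma>: "elementary_path \<gamma> \<and> path_support \<gamma> \<subseteq> cell t" for \<gamma>
  proof -
    have sub: "set \<gamma> \<subseteq> all_oedges" using \<gamma> by (simp add: elementary_path_def)
    have "path_integral [e] w = f (snd e) - f (fst e)" if e_in: "e \<in> set \<gamma>" for e
    proof -
      obtain s i j where e: "e = oedge s i j" "i \<noteq> j" using e_in sub by (auto simp: all_oedges_eq)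
      have "segment e \<subseteq> cell t" using \<gamma> e_in by (auto simp: path_support_def)
      then obtain r where "s = t @ r" unfolding e segment_subset_cell[OF e(2)] by (auto simp: prefix_def)
      then show ?thesis using g(2)[of r i j] f_vtx by (simp add: e edge_integral_def oedge_def)
    qed
    then have "(\<Sum>e\<leftarrow>\<gamma>. path_integral [e] w) = (\<Sum>e\<leftarrow>\<gamma>. f (snd e) - f (fst e))"
      by (intro arg_cong[of _ _ sum_list]) simp
    then show ?thesis
      unfolding form_integral_class[OF assms(1) sub] using \<gamma> sum_list_telescope by (simp add: elementary_path_def)
  qed
  ultimately show "\<exists>f. continuous_on (cell t) f \<and> energy_on (cell t) f < \<infinity> \<and>
      (\<forall>\<gamma>. elementary_path \<gamma> \<and> path_support \<gamma> \<subseteq> cell t \<longrightarrow>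
        form_integral \<gamma> (form_class w) = f (path_end \<gamma>) - f (path_start \<gamma>))" by blast
qed

section \<open>Localisation of forms to a cell\<close>

definition simple_form :: "(point \<Rightarrow> real) \<Rightarrow> (point \<Rightarrow> real) \<Rightarrow> tensor" where
  "simple_form f g = (\<lambda>(x, y). f x * differential g (x, y))"

lemma simple_form: "simple_form f g \<in> forms" if "f \<in> finite_energy" "g \<in> finite_energy"
  unfolding simple_form_def using that by (rule forms.gen)

lemma simple_form_gasket: "x \<in> gasket \<Longrightarrow> y \<in> gasket \<Longrightarrow> simple_form f g (x, y) = f x * (g x - g y)"
  by (simp add: simple_form_def differential_gasket)

text \<open>\<open>f\<close> and \<open>g\<close> are transported to the subcell \<open>a\<close>. In a neighbouring subcell \<open>b\<close>, the extension of
  \<open>g\<close> is constant near the common vertex and that of \<open>f\<close> vanishes elsewhere, so that \<open>f dg\<close> is zero.\<close>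

lemma localise_letter:
  assumes f: "f \<in> finite_energy" and g: "g \<in> finite_energy"
  shows "\<exists>f'\<in>finite_energy. \<exists>g'\<in>finite_energy. \<forall>s i j.
    edge_integral (simple_form f' g') (a # s) i j = edge_integral (simple_form f g) s i j \<and>
    (\<forall>b. b \<noteq> a \<longrightarrow> edge_integral (simple_form f' g') (b # s) i j = 0)"
proof -
  obtain \<psi> where \<psi>: "\<psi> \<in> finite_energy" "\<And>s i. \<psi> (vtx s i) = harmonic (\<lambda>i. if i = a then 1 else 0) s i"
    using harmonic_function by blast
  have \<psi>_corner: "\<psi> (corner i) = (if i = a then 1 else 0)" for i using \<psi>(2)[of "[]" i] by simp
  \<comment> \<open>Glued, X is a bump supported in subcell a, and Y equals 1 on that subcell. Both
    are 1 at \<open>corner a\<close> and 0 at the other corners, so their multiples agree with f and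
    g at the midpoints next to subcell a, and with each other at the opposite one.\<close>
  define X where "X b = (if b = a then \<psi> else (\<lambda>x. 0))" for b
  define Y where "Y b = (if b = a then (\<lambda>x. 1 * indicat_real gasket x) else \<psi>)" for b
  have X: "matching X" "X b \<in> finite_energy" and Y: "matching Y" "Y b \<in> finite_energy" for b
    using \<psi>(1) const_finite_energy[of 1] zero_finite_energy by (auto simp: matching_def X_def Y_def \<psi>_corner)
  have X_corner: "glue X (corner i) = (if i = a then 1 else 0)" for i
    using glue_contr[OF X(1) corner_gasket, of i i] by (simp add: contr_corner X_def \<psi>_corner)
  have Y_corner: "glue Y (corner i) = (if i = a then 1 else 0)" for i
    using glue_contr[OF Y(1) corner_gasket, of i i] by (simp add: contr_corner Y_def \<psi>_corner)
  define F where "F b = (if b = a then f else (\<lambda>x. f (corner b) * glue X x))" for b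
  define G where "G b = (if b = a then g else (\<lambda>x. g (corner b) * glue Y x))" for b
  have F: "matching F" "F b \<in> finite_energy" and G: "matching G" "G b \<in> finite_energy" for b
    using f g glue_finite_energy[OF X] glue_finite_energy[OF Y]
    by (auto simp: matching_def F_def G_def X_corner Y_corner finite_energy_scale)
  let ?w = "simple_form (glue F) (glue G)"
  have form: "?w \<in> forms" by (intro simple_form glue_finite_energy F G)
  have a: "edge_integral ?w (a # s) i j = edge_integral (simple_form f g) s i j" for s i j
  proof (cases "i = j")
    case False
    have "side_sum ?w (a # s) i j = side_sum (simple_form f g) s i j"
      by (rule ext) (simp add: side_sum_def vtx_Cons simple_form_gasket contr_gasket
          glue_contr[OF F(1)] glue_contr[OF G(1)] F_def G_def)
    then show ?thesis
      using form_side_sum[OF simple_form[OF f g] False, of s] by (intro edge_integral_eqI False) simp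
  qed simp
  \<comment> \<open>Inside subcell b, the factor F vanishes on the part c for c \<noteq> a, and G is
    constant on the part c = a. The sides of subcell b itself are then composed of two such
    edges.\<close>
  have deep: "edge_integral ?w (b # c # s) i j = 0" if "b \<noteq> a" for b c s i j
  proof (cases "i = j")
    case False
    have zero: "?w (contr b (contr c x), contr b (contr c y)) = 0" if "x \<in> gasket" "y \<in> gasket" for x y
      using that \<open>b \<noteq> a\<close> by (simp add: simple_form_gasket contr_gasket glue_contr[OF F(1)] glue_contr[OF G(1)]
          F_def G_def glue_contr[OF X(1)] glue_contr[OF Y(1)] X_def Y_def)
    have "edge_integral ?w (b # c # s) i j = (\<lambda>_ _. 0) [] j - (\<lambda>_ _. 0) ([] :: word) i"
      by (rule side_sum_exact) (use False in \<open>simp_all add: compat_def vtx_Cons zero\<close>)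
    then show ?thesis by simp
  qed simp
  have b: "edge_integral ?w (b # s) i j = 0" if "b \<noteq> a" for b s i j
  proof (cases s)
    case Nil
    have "edge_integral ?w [b] i j = edge_integral ?w ([b] @ [i]) i j + edge_integral ?w ([b] @ [j]) i j"
      using additive_edge_integral[OF form] unfolding additive_cochain_def by blast
    then show ?thesis using deep[OF that] Nil by simp
  qed (simp add: deep[OF that])
  show ?thesis using a b glue_finite_energy[OF F] glue_finite_energy[OF G] by blast
qed

lemma localise:
  assumes "f \<in> finite_energy" "g \<in> finite_energy"
  shows "\<exists>f'\<in>finite_energy. \<exists>g'\<in>finite_energy. \<forall>r i j.
    edge_integral (simple_form f' g') (s @ r) i j = edge_integral (simple_form f g) r i j \<and>
    (\<forall>t. length t = length s \<longrightarrow> t \<noteq> s \<longrightarrow> edge_integral (simple_form f' g') (t @ r) i j = 0)"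
proof (induction s)
  case Nil
  show ?case using assms by auto
next
  case (Cons a s)
  then obtain f1 g1 where 1: "f1 \<in> finite_energy" "g1 \<in> finite_energy"
    "\<And>r i j. edge_integral (simple_form f1 g1) (s @ r) i j = edge_integral (simple_form f g) r i j"
    "\<And>t r i j. length t = length s \<Longrightarrow> t \<noteq> s \<Longrightarrow> edge_integral (simple_form f1 g1) (t @ r) i j = 0"
    by blast
  obtain f2 g2 where 2: "f2 \<in> finite_energy" "g2 \<in> finite_energy"
    "\<And>r i j. edge_integral (simple_form f2 g2) (a # r) i j = edge_integral (simple_form f1 g1) r i j"
    "\<And>b r i j. b \<noteq> a \<Longrightarrow> edge_integral (simple_form f2 g2) (b # r) i j = 0"
    using localise_letter[OF 1(1,2), of a] by blast
  have "edge_integral (simple_form f2 g2) (t @ r) i j = 0" if "length t = length (a # s)" "t \<noteq> a # s" for t r i j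
  proof -
    obtain b t' where "t = b # t'" "length t' = length s" using \<open>length t = length (a # s)\<close> by (cases t) auto
    then show ?thesis using 1(4)[of t' r i j] 2(3,4) \<open>t \<noteq> a # s\<close> by (cases "b = a") auto
  qed
  then show ?case using 1(3) 2 by (intro bexI[of _ f2] bexI[of _ g2] allI conjI impI) auto
qed


section \<open>The forms \<open>dz\<^sub>\<sigma>\<close>\<close>

text \<open>Corner values on subcell k: the increment from k + 2 to k + 1, along the clockwise side
  of the lacuna, is 1/3.\<close>

definition lacuna_potential :: "3 \<Rightarrow> 3 \<Rightarrow> real" where
  "lacuna_potential k j = (if j = k then 0 else if j = k + 1 then 1/6 else - 1/6)"

text \<open>The integrals of \<open>dz s\<close>, prescribed strictly inside C_s and on the other
  cells of its level; all others follow by additivity.\<close>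

definition dz_cochain :: "word \<Rightarrow> cochain \<Rightarrow> bool" where
  "dz_cochain s J \<longleftrightarrow> additive_cochain J \<and>
     (\<forall>k r i j. J (s @ k # r) i j = harmonic (lacuna_potential k) r j - harmonic (lacuna_potential k) r i) \<and>
     (\<forall>t r i j. length t = length s \<longrightarrow> t \<noteq> s \<longrightarrow> J (t @ r) i j = 0)"

lemma additive_cochain_split: "additive_cochain J \<Longrightarrow> J s i j = J (s @ [i]) i j + J (s @ [j]) i j"
  unfolding additive_cochain_def by blast

lemma additive_cochain_anti: "additive_cochain J \<Longrightarrow> J s j i = - J s i j"
  unfolding additive_cochain_def by blast

text \<open>Each subcell k of s receives the localised differential of the harmonic function with
  corner values \<open>lacuna_potential k\<close>. Localisation yields vanishing on the other cells
  one level below s; halving carries it to the cells of the level of s.\<close>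

lemma ex_dz_form: "\<exists>w\<in>forms. dz_cochain s (edge_integral w)"
proof -
  have "\<exists>w\<in>forms. \<forall>r i j. edge_integral w ((s @ [k]) @ r) i j =
        harmonic (lacuna_potential k) r j - harmonic (lacuna_potential k) r i \<and>
      (\<forall>t. length t = length (s @ [k]) \<longrightarrow> t \<noteq> s @ [k] \<longrightarrow> edge_integral w (t @ r) i j = 0)" for k
  proof -
    obtain h where h: "h \<in> finite_energy" "\<And>r i. h (vtx r i) = harmonic (lacuna_potential k) r i"
      using harmonic_function by blast
    let ?e = "\<lambda>x. 1 * indicat_real gasket x"
    have eq: "simple_form ?e h = differential h"
      using h(1) by (auto simp: simple_form_def fun_eq_iff indicator_def differential_def tens_def finite_energy_def)
    obtain f' g' where fg: "f' \<in> finite_energy" "g' \<in> finite_energy" and *: "\<forall>r i j.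
        edge_integral (simple_form f' g') ((s @ [k]) @ r) i j = edge_integral (simple_form ?e h) r i j \<and>
        (\<forall>t. length t = length (s @ [k]) \<longrightarrow> t \<noteq> s @ [k] \<longrightarrow> edge_integral (simple_form f' g') (t @ r) i j = 0)"
      using localise[OF const_finite_energy[of 1] h(1), of "s @ [k]"] by (elim bexE)
    show ?thesis
      using * unfolding eq edge_integral_differential h(2) by (intro bexI[of _ "simple_form f' g'"] simple_form fg)
  qed
  then have "\<exists>\<eta>. \<forall>k. \<eta> k \<in> forms \<and> (\<forall>r i j. edge_integral (\<eta> k) ((s @ [k]) @ r) i j =
        harmonic (lacuna_potential k) r j - harmonic (lacuna_potential k) r i \<and>
      (\<forall>t. length t = length (s @ [k]) \<longrightarrow> t \<noteq> s @ [k] \<longrightarrow> edge_integral (\<eta> k) (t @ r) i j = 0))"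
    by (intro choice) blast
  then obtain \<eta> where \<eta>: "\<And>k. \<eta> k \<in> forms"
    "\<And>k r i j. edge_integral (\<eta> k) ((s @ [k]) @ r) i j = harmonic (lacuna_potential k) r j - harmonic (lacuna_potential k) r i"
    "\<And>k t r i j. length t = length (s @ [k]) \<Longrightarrow> t \<noteq> s @ [k] \<Longrightarrow> edge_integral (\<eta> k) (t @ r) i j = 0"
    by blast
  define w where "w = (\<lambda>z. \<Sum>k\<in>UNIV. 1 * \<eta> k z)"
  have form: "w \<in> forms" unfolding w_def by (intro forms_lincomb \<eta>) simp
  have J: "edge_integral w r i j = (\<Sum>k\<in>UNIV. edge_integral (\<eta> k) r i j)" for r i j
    unfolding w_def by (subst edge_integral_lincomb) (simp_all add: \<eta>)
  have "edge_integral w (s @ k # r) i j = harmonic (lacuna_potential k) r j - harmonic (lacuna_potential k) r i" for k r i j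
  proof -
    have "edge_integral (\<eta> l) (s @ k # r) i j =
        (if l = k then harmonic (lacuna_potential k) r j - harmonic (lacuna_potential k) r i else 0)" for l
      using \<eta>(2)[of k r i j] \<eta>(3)[of "s @ [k]" l r i j] by simp
    then show ?thesis by (simp add: J)
  qed
  moreover have off: "edge_integral w (t @ c # r) i j = 0" if "length t = length s" "t \<noteq> s" for t c r i j
    unfolding J using \<eta>(3)[of "t @ [c]" _ r i j] that by (intro sum.neutral) auto
  moreover have "edge_integral w (t @ r) i j = 0" if "length t = length s" "t \<noteq> s" for t r i j
  proof (cases r)
    case Nil
    show ?thesis
      unfolding Nil append_Nil2
      by (subst additive_cochain_split[OF additive_edge_integral[OF form]]) (simp add: off[OF that])
  qed (simp add: off[OF that])
  ultimately show ?thesis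
    using form additive_edge_integral[OF form] unfolding dz_cochain_def by blast
qed

section \<open>Locally exact cochains and uniqueness of the minimizer\<close>

definition locally_exact :: "nat \<Rightarrow> cochain \<Rightarrow> bool" where
  "locally_exact n J \<longleftrightarrow> (\<forall>t. length t = n \<longrightarrow> (\<exists>u. compat u \<and> (\<forall>r i j. J (t @ r) i j = u r j - u r i)))"

lemma locally_exactE:
  assumes "locally_exact n J"
  obtains u where "\<And>t. length t = n \<Longrightarrow> compat (u t)"
    "\<And>t r i j. length t = n \<Longrightarrow> J (t @ r) i j = u t r j - u t r i"
  using assms unfolding locally_exact_def by metis

lemma n_exact_locally_exact: "locally_exact n (edge_integral w)" if "w \<in> forms" "n_exact n (form_class w)"
  unfolding locally_exact_def using n_exactD[OF that(2,1)] by metis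

lemma locally_exact_diff:
  assumes "locally_exact n J" "locally_exact n J'"
  shows "locally_exact n (\<lambda>s i j. J s i j - J' s i j)"
  unfolding locally_exact_def
proof (intro allI impI)
  fix t :: word assume t: "length t = n"
  obtain u where u: "compat u" "\<And>r i j. J (t @ r) i j = u r j - u r i"
    using assms(1) t unfolding locally_exact_def by blast
  obtain v where v: "compat v" "\<And>r i j. J' (t @ r) i j = v r j - v r i"
    using assms(2) t unfolding locally_exact_def by blast
  show "\<exists>u. compat u \<and> (\<forall>r i j. J (t @ r) i j - J' (t @ r) i j = u r j - u r i)"
    using u v by (intro exI[of _ "\<lambda>r i. u r i - v r i"]) (simp add: compat_diff)
qed

lemma edge_squares_exact:
  assumes "\<And>i j. J s i j = a j - a i"
  shows "edge_squares J s = edge_prod a a"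
  by (simp add: edge_squares_def edge_prod_def assms power2_eq_square)

text \<open>From level n on the energy is a sum of energies of potentials, each of which increases
  under refinement.\<close>

lemma incseq_level_energy:
  assumes "locally_exact n J"
  shows "incseq (\<lambda>k. level_energy J (n + k))"
proof -
  obtain u where u: "\<And>t. length t = n \<Longrightarrow> compat (u t)"
    "\<And>t r i j. length t = n \<Longrightarrow> J (t @ r) i j = u t r j - u t r i"
    using locally_exactE[OF assms] by metis
  have "level_energy J (n + k) = (5/3) ^ n * (\<Sum>t\<in>words n. family_energy (u t) k)" for k
  proof -
    have "(\<Sum>s\<in>words (n + k). edge_squares J s) = (\<Sum>t\<in>words n. \<Sum>r\<in>words k. edge_prod (u t r) (u t r))"
      unfolding sum_words_add
      by (intro sum.cong refl edge_squares_exact) (simp add: u(2) words_def)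
    then show ?thesis
      by (simp add: level_energy_def family_energy_def power_add mult.assoc flip: sum_distrib_left)
  qed
  moreover have "incseq (\<lambda>k. (5/3) ^ n * (\<Sum>t\<in>words n. family_energy (u t) k))"
    by (intro monoI mult_left_mono sum_mono incseqD[OF incseq_family_energy[OF u(1)]]) (auto simp: words_def)
  ultimately show ?thesis by simp
qed

lemma dz_cochain_locally_exact:
  assumes "dz_cochain s J"
  shows "locally_exact (Suc (length s)) J"
  unfolding locally_exact_def
proof (intro allI impI)
  fix t :: word assume "length t = Suc (length s)"
  then obtain t' c where t: "t = t' @ [c]" "length t' = length s" by (cases t rule: rev_cases) auto
  show "\<exists>u. compat u \<and> (\<forall>r i j. J (t @ r) i j = u r j - u r i)"
  proof (cases "t' = s")
    case True
    then show ?thesis using assms t(1) compat_harmonic[of "lacuna_potential c"]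
      unfolding dz_cochain_def by (intro exI[of _ "harmonic (lacuna_potential c)"]) simp
  next
    case False
    then show ?thesis using assms t unfolding dz_cochain_def by (intro exI[of _ "\<lambda>_ _. 0"]) (simp add: compat_def)
  qed
qed

lemma dz_cochain_period: "lacuna_period J s = 1" if "dz_cochain s J"
proof -
  have "J (s @ [k]) i j = lacuna_potential k j - lacuna_potential k i" for k i j
    using that unfolding dz_cochain_def by (metis harmonic.simps(1))
  then show ?thesis by (simp add: lacuna_period_def lacuna_potential_def)
qed

text \<open>The reason for the choice of corner values: pairing with b gives half the increment of b
  along the clockwise side of the lacuna, so the three pairings add up to half a period.\<close>

lemma edge_prod_lacuna_potential:
  "edge_prod (lacuna_potential 0) b = (b 1 - b 2) / 2"
  "edge_prod (lacuna_potential 1) b = (b 2 - b 0) / 2"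
  "edge_prod (lacuna_potential 2) b = (b 0 - b 1) / 2"
  by (simp_all add: edge_prod_def lacuna_potential_def field_simps)

text \<open>\<Phi> is left general to serve both for the squares and for the products with another
  cochain.\<close>

lemma dz_cochain_sum:
  fixes \<Phi> :: "real \<Rightarrow> real \<Rightarrow> real \<Rightarrow> word \<Rightarrow> real"
  assumes "dz_cochain s z" "\<And>r. \<Phi> 0 0 0 r = 0"
  shows "(\<Sum>r\<in>words (Suc (length s) + k). \<Phi> (z r 0 1) (z r 1 2) (z r 2 0) r) =
    (\<Sum>c\<in>UNIV. \<Sum>r\<in>words k. \<Phi> (z (s @ c # r) 0 1) (z (s @ c # r) 1 2) (z (s @ c # r) 2 0) (s @ c # r))"
proof -
  let ?\<Psi> = "\<lambda>r. \<Phi> (z r 0 1) (z r 1 2) (z r 2 0) r"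
  have "(\<Sum>r\<in>words (Suc (length s) + k). ?\<Psi> r) = (\<Sum>t\<in>words (length s). \<Sum>r\<in>words (Suc k). ?\<Psi> (t @ r))"
    using sum_words_add[of ?\<Psi> "length s" "Suc k"] by simp
  also have "\<dots> = (\<Sum>t\<in>words (length s). if t = s then \<Sum>r\<in>words (Suc k). ?\<Psi> (s @ r) else 0)"
  proof (rule sum.cong[OF refl])
    fix t assume "t \<in> words (length s)"
    then have "t \<noteq> s \<Longrightarrow> z (t @ r) i j = 0" for r i j
      using assms(1) by (simp add: dz_cochain_def words_def)
    then show "(\<Sum>r\<in>words (Suc k). ?\<Psi> (t @ r)) = (if t = s then \<Sum>r\<in>words (Suc k). ?\<Psi> (s @ r) else 0)"
      using assms(2) by simp
  qed
  also have "\<dots> = (\<Sum>r\<in>words (Suc k). ?\<Psi> (s @ r))" by (simp add: words_def finite_words[unfolded words_def])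
  finally show ?thesis by (simp add: sum_words_Suc_Cons)
qed

text \<open>The corner values of one subcell have edge energy 1/36 + 1/36 + 1/9 = 1/6, hence 1/2 for
  all three, and after renormalisation harmonicity preserves this on every finer level.\<close>

lemma dz_cochain_energy:
  assumes "dz_cochain s z"
  shows "level_energy z (Suc (length s) + k) = (5/3) ^ Suc (length s) / 2"
proof -
  have "(\<Sum>r\<in>words (Suc (length s) + k). edge_squares z r) = (\<Sum>c\<in>UNIV. \<Sum>r\<in>words k. edge_squares z (s @ c # r))"
    unfolding edge_squares_def using dz_cochain_sum[OF assms, of "\<lambda>a b c _. a\<^sup>2 + b\<^sup>2 + c\<^sup>2" k] by simp
  also have "\<dots> = (\<Sum>c\<in>UNIV. \<Sum>r\<in>words k. edge_prod (harmonic (lacuna_potential c) r) (harmonic (lacuna_potential c) r))"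
    using assms by (intro sum.cong refl edge_squares_exact) (simp add: dz_cochain_def)
  also have "\<dots> = (3/5) ^ k / 2"
    by (simp add: sum_edge_prod_harmonic[OF compat_harmonic] sum_three edge_prod_lacuna_potential)
      (simp add: lacuna_potential_def)
  finally have "level_energy z (Suc (length s) + k) = (5/3) ^ Suc (length s) * ((5/3) ^ k * (3/5) ^ k) / 2"
    by (simp add: level_energy_def power_add)
  also have "(5/3 :: real) ^ k * (3/5) ^ k = 1" by (simp flip: power_mult_distrib)
  finally show ?thesis by simp
qed

text \<open>The mixed term is a multiple of the period of v: \<open>sum_edge_prod_harmonic\<close>
  moves it to the corners of the three subcells, where \<open>edge_prod_lacuna_potential\<close>
  evaluates it.\<close>

lemma dz_cochain_orthogonal:
  assumes z: "dz_cochain s z" and v: "locally_exact (Suc (length s)) v" and "lacuna_period v s = 0"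
  shows "level_energy (\<lambda>r i j. z r i j + v r i j) (Suc (length s) + k) =
    level_energy z (Suc (length s) + k) + level_energy v (Suc (length s) + k)"
proof -
  define m where "m = Suc (length s) + k"
  define X where "X r = z r 0 1 * v r 0 1 + z r 1 2 * v r 1 2 + z r 2 0 * v r 2 0" for r
  obtain u where u: "\<And>t. length t = Suc (length s) \<Longrightarrow> compat (u t)"
    "\<And>t r i j. length t = Suc (length s) \<Longrightarrow> v (t @ r) i j = u t r j - u t r i"
    using locally_exactE[OF v] by metis
  have "(\<Sum>r\<in>words m. X r) = (\<Sum>c\<in>UNIV. \<Sum>r\<in>words k. X (s @ c # r))"
    unfolding X_def m_def
    using dz_cochain_sum[OF z, of "\<lambda>a b c r. a * v r 0 1 + b * v r 1 2 + c * v r 2 0" k] by simp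
  also have "\<dots> = (\<Sum>c\<in>UNIV. (3/5) ^ k * edge_prod (lacuna_potential c) (u (s @ [c]) []))"
  proof (rule sum.cong[OF refl])
    fix c
    have "v (s @ c # r) i j = u (s @ [c]) r j - u (s @ [c]) r i" for r i j
      using u(2)[of "s @ [c]" r i j] by simp
    then have "X (s @ c # r) = edge_prod (harmonic (lacuna_potential c) r) (u (s @ [c]) r)" for r
      using z by (simp add: X_def edge_prod_def dz_cochain_def)
    then show "(\<Sum>r\<in>words k. X (s @ c # r)) = (3/5) ^ k * edge_prod (lacuna_potential c) (u (s @ [c]) [])"
      using sum_edge_prod_harmonic[OF u(1)[of "s @ [c]"]] by simp
  qed
  also have "\<dots> = (3/5) ^ k * (\<Sum>c\<in>UNIV. edge_prod (lacuna_potential c) (u (s @ [c]) []))"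
    by (rule sum_distrib_left[symmetric])
  also have "(\<Sum>c\<in>UNIV. edge_prod (lacuna_potential c) (u (s @ [c]) [])) = lacuna_period v s / 2"
  proof -
    have "v (s @ [c]) i j = u (s @ [c]) [] j - u (s @ [c]) [] i" for c i j
      using u(2)[of "s @ [c]" "[]" i j] by simp
    then show ?thesis
      unfolding lacuna_period_def sum_three edge_prod_lacuna_potential by (simp add: diff_divide_distrib)
  qed
  finally have "(\<Sum>r\<in>words m. X r) = 0" using assms(3) by simp
  moreover have "edge_squares (\<lambda>r i j. z r i j + v r i j) r = edge_squares z r + edge_squares v r + 2 * X r" for r
    by (simp add: edge_squares_def X_def power2_sum algebra_simps)
  ultimately show ?thesis
    unfolding m_def[symmetric] level_energy_def
    by (simp add: sum.distrib distrib_left flip: sum_distrib_left)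
qed

lemma additive_cochain_zero:
  assumes "additive_cochain J" "\<And>r i j. N \<le> length r \<Longrightarrow> J r i j = 0"
  shows "J r i j = 0"
proof (induction "N - length r" arbitrary: r)
  case 0
  then show ?case using assms(2) by simp
next
  case (Suc d)
  then have "J (r @ [l]) i j = 0" for l by simp
  then show ?case by (subst additive_cochain_split[OF assms(1)]) simp
qed

lemma additive_cochain_diff: "additive_cochain (\<lambda>s i j. J s i j - J' s i j)" if "additive_cochain J" "additive_cochain J'"
  unfolding additive_cochain_def
proof (intro allI conjI)
  fix s i j
  show "J s i j - J' s i j = - (J s j i - J' s j i)"
    using additive_cochain_anti[OF that(1), of s i j] additive_cochain_anti[OF that(2), of s i j] by linarith
  show "J s i j - J' s i j = J (s @ [i]) i j - J' (s @ [i]) i j + (J (s @ [j]) i j - J' (s @ [j]) i j)"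
    using additive_cochain_split[OF that(1), of s i j] additive_cochain_split[OF that(2), of s i j] by linarith
qed

lemma edge_squares_zeroD:
  assumes "edge_squares J r = 0" "additive_cochain J"
  shows "J r i j = 0"
proof -
  have *: "J r 0 1 = 0" "J r 1 2 = 0" "J r 2 0 = 0"
    using assms(1) unfolding edge_squares_def by (simp_all add: add_nonneg_eq_0_iff)
  show ?thesis
  proof (cases "i = j")
    case True
    then show ?thesis using additive_cochain_anti[OF assms(2), of r i i] by simp
  next
    case False
    have "J r 1 0 = 0" "J r 2 1 = 0" "J r 0 2 = 0"
      using * additive_cochain_anti[OF assms(2), of r 1 0] additive_cochain_anti[OF assms(2), of r 2 1]
        additive_cochain_anti[OF assms(2), of r 0 2] by simp_all
    with neq_three[OF False] * show ?thesis by auto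
  qed
qed

lemma Q_form_limit:
  assumes "w \<in> forms" "locally_exact n (edge_integral w)"
  shows "(\<lambda>k. level_energy (edge_integral w) (n + k)) \<longlonglongrightarrow> Q_form (form_class w)"
proof -
  obtain C where C: "\<And>m. level_energy (edge_integral w) m \<le> C" using level_energy_bounded[OF assms(1)] by blast
  obtain L where L: "(\<lambda>k. level_energy (edge_integral w) (n + k)) \<longlonglongrightarrow> L"
    using incseq_convergent[OF incseq_level_energy[OF assms(2)], of C] C by blast
  then have "(\<lambda>k. level_energy (edge_integral w) (k + n)) \<longlonglongrightarrow> L" by (simp add: add.commute)
  then have "level_energy (edge_integral w) \<longlonglongrightarrow> L" by (rule LIMSEQ_offset)
  then have "Q_form (form_class w) = L"
    unfolding Q_form_def Q_level_class[OF assms(1)] by (rule limI)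
  with L show ?thesis by simp
qed

lemma dz_cochain_n_exact:
  assumes "w \<in> forms" "dz_cochain s (edge_integral w)"
  shows "n_exact (length s + 1) (form_class w)"
proof (rule n_exactI[OF assms(1)])
  fix t :: word assume "length t = length s + 1"
  then obtain t' c where t: "t = t' @ [c]" "length t' = length s" by (cases t rule: rev_cases) auto
  show "\<exists>g\<in>finite_energy. \<forall>r i j. edge_integral w (t @ r) i j = g (vtx r j) - g (vtx r i)"
  proof (cases "t' = s")
    case True
    obtain h where "h \<in> finite_energy" "\<And>r i. h (vtx r i) = harmonic (lacuna_potential c) r i"
      using harmonic_function by blast
    then show ?thesis using assms(2) t(1) True unfolding dz_cochain_def by (intro bexI[of _ h]) simp_all
  next
    case False
    then show ?thesis using assms(2) t zero_finite_energy unfolding dz_cochain_def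
      by (intro bexI[of _ "\<lambda>_. 0"]) simp_all
  qed
qed

text \<open>A competitor differs from the candidate by some v of period 0, and by orthogonality its
  Q exceeds that of the candidate by the limit of the energies of v. These increase, so limit 0
  forces v to vanish from level n on, and additivity extends this to all edges.\<close>

lemma dz_class:
  assumes form: "\<omega> \<in> forms" and dz_c: "dz_cochain s (edge_integral \<omega>)"
  shows "dz s = form_class \<omega>"
proof -
  define n where "n = Suc (length s)"
  define P where "P W \<longleftrightarrow> n_exact (length s + 1) W \<and> form_integral (lacuna s) W = 1" for W
  let ?z = "edge_integral \<omega>"
  have z: "locally_exact n ?z" unfolding n_def by (rule dz_cochain_locally_exact[OF dz_c])
  have P\<omega>: "P (form_class \<omega>)"
    unfolding P_def using dz_cochain_n_exact[OF form dz_c] form_integral_lacuna[OF form] dz_cochain_period[OF dz_c] by simp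
  have key: "Q_form (form_class \<omega>) \<le> Q_form (form_class \<eta>) \<and>
      (Q_form (form_class \<eta>) \<le> Q_form (form_class \<omega>) \<longrightarrow> form_class \<eta> = form_class \<omega>)"
    if \<eta>: "\<eta> \<in> forms" "P (form_class \<eta>)" for \<eta>
  proof -
    let ?w = "edge_integral \<eta>"
    define v where "v = (\<lambda>r i j. ?w r i j - ?z r i j)"
    have w: "locally_exact n ?w" using n_exact_locally_exact[OF \<eta>(1)] \<eta>(2) by (simp add: P_def n_def)
    have v: "locally_exact n v" unfolding v_def by (rule locally_exact_diff[OF w z])
    have add_v: "additive_cochain v"
      unfolding v_def by (intro additive_cochain_diff additive_edge_integral form \<eta>)
    have "lacuna_period v s = 0"
      using \<eta>(2) dz_cochain_period[OF dz_c] form_integral_lacuna[OF \<eta>(1), of s]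
      by (simp add: P_def lacuna_period_def v_def)
    then have eq: "level_energy ?w (n + k) = level_energy ?z (n + k) + level_energy v (n + k)" for k
      using dz_cochain_orthogonal[OF dz_c v[unfolded n_def], of k] by (simp add: v_def n_def)
    have lim: "(\<lambda>k. level_energy v (n + k)) \<longlonglongrightarrow> Q_form (form_class \<eta>) - Q_form (form_class \<omega>)"
      using tendsto_diff[OF Q_form_limit[OF \<eta>(1) w] Q_form_limit[OF form z]] by (simp add: eq)
    have le: "level_energy v (n + k) \<le> Q_form (form_class \<eta>) - Q_form (form_class \<omega>)" for k
      by (rule incseq_le[OF incseq_level_energy[OF v] lim])
    have "form_class \<eta> = form_class \<omega>" if "Q_form (form_class \<eta>) \<le> Q_form (form_class \<omega>)"
    proof -
      have "v r i j = 0" if "n \<le> length r" for r i j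
      proof -
        have "level_energy v (length r) = 0"
          using le[of "length r - n"] \<open>Q_form (form_class \<eta>) \<le> Q_form (form_class \<omega>)\<close> \<open>n \<le> length r\<close>
            level_energy_nonneg[of v "length r"] by simp
        then have "(\<Sum>s\<in>words (length r). edge_squares v s) = 0" by (simp add: level_energy_def)
        then have "edge_squares v r = 0"
          by (subst (asm) sum_nonneg_eq_0_iff) (auto simp: edge_squares_nonneg words_def finite_words[unfolded words_def])
        then show ?thesis by (rule edge_squares_zeroD[OF _ add_v])
      qed
      then have "v r i j = 0" for r i j by (rule additive_cochain_zero[OF add_v])
      then have "?w = ?z" by (simp add: v_def fun_eq_iff)
      then show ?thesis using form_class_eq_iff[OF \<eta>(1) form] by simp
    qed
    moreover have "0 \<le> Q_form (form_class \<eta>) - Q_form (form_class \<omega>)"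
      using le[of 0] level_energy_nonneg[of v "n + 0"] by linarith
    ultimately show ?thesis by simp
  qed
  have smooth: "\<exists>\<eta>\<in>forms. W = form_class \<eta>" if "P W" for W
    using that smooth_formsE[of W] unfolding P_def n_exact_def by metis
  show ?thesis
    unfolding dz_def P_def[symmetric]
  proof (rule the_equality)
    show "is_arg_min (\<lambda>W. sqrt (Q_form W)) P (form_class \<omega>)"
      unfolding is_arg_min_def using P\<omega> smooth key by (metis not_le real_sqrt_less_iff)
    show "W = form_class \<omega>" if "is_arg_min (\<lambda>W. sqrt (Q_form W)) P W" for W
      using that P\<omega> smooth[of W] key unfolding is_arg_min_def by (metis not_le real_sqrt_less_iff)
  qed
qed

section \<open>Integrals of \<open>dz\<close> along coarse edges\<close>

definition dz_form :: "word \<Rightarrow> tensor" where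
  "dz_form s = (SOME w. w \<in> forms \<and> dz_cochain s (edge_integral w))"

definition dz_integral :: "word \<Rightarrow> cochain" where
  "dz_integral s = edge_integral (dz_form s)"

lemma dz_form: "dz_form s \<in> forms" "dz_cochain s (dz_integral s)"
proof -
  have "dz_form s \<in> forms \<and> dz_cochain s (edge_integral (dz_form s))"
    using someI_ex[of "\<lambda>w. w \<in> forms \<and> dz_cochain s (edge_integral w)"] ex_dz_form[of s]
    unfolding dz_form_def by blast
  then show "dz_form s \<in> forms" "dz_cochain s (dz_integral s)" by (simp_all add: dz_integral_def)
qed

lemma dz_eq: "dz s = form_class (dz_form s)"
  by (rule dz_class) (use dz_form in \<open>simp_all add: dz_integral_def\<close>)

text \<open>The side of \<open>C\<^sub>r\<close> from its vertex \<open>i\<close> to its vertex \<open>j\<close> contains a side of \<open>C\<^sub>s\<close>.\<close>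

definition along :: "word \<Rightarrow> word \<Rightarrow> 3 \<Rightarrow> 3 \<Rightarrow> bool" where
  "along r s i j \<longleftrightarrow> (\<exists>t. s = r @ t \<and> set t \<subseteq> {i, j})"

text \<open>The sign is positive for sides run in the clockwise order 0, 1, 2.\<close>

definition side_sign :: "3 \<Rightarrow> 3 \<Rightarrow> real" where
  "side_sign i j = (if i = j then 0 else if j = i + 1 then 1 else -1)"

lemma side_sign_eq: "lacuna_potential i j - lacuna_potential j i = side_sign i j / 3"
  using three_cases[of i] three_cases[of j] by (auto simp: lacuna_potential_def side_sign_def)

lemma along_self: "length r = length s \<Longrightarrow> along r s i j \<longleftrightarrow> r = s"
  by (auto simp: along_def)

lemma along_split:
  assumes "length r < length s"
  shows "along r s i j \<longleftrightarrow> along (r @ [i]) s i j \<or> along (r @ [j]) s i j"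
proof
  assume "along r s i j"
  then obtain t where t: "s = r @ t" "set t \<subseteq> {i, j}" by (auto simp: along_def)
  with assms obtain c t' where "t = c # t'" by (cases t) auto
  with t show "along (r @ [i]) s i j \<or> along (r @ [j]) s i j" by (auto simp: along_def)
qed (auto simp: along_def)

text \<open>Induction from the level of s towards coarser cells. A side of C_s has one half in
  subcell i and one in subcell j, whose potentials vanish at their own corners; on coarser cells C_s
  can lie along at most one half of a side.\<close>

lemma dz_cochain_short:
  assumes "dz_cochain s J"
  shows "length r \<le> length s \<Longrightarrow> J r i j = (if along r s i j then side_sign i j / 3 else 0)"
proof (induction "length s - length r" arbitrary: r)
  case 0
  then have len: "length r = length s" by simp
  have add: "additive_cochain J" using assms by (simp add: dz_cochain_def)
  show ?case
  proof (cases "r = s")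
    case True
    have J: "J (s @ [k]) i j = lacuna_potential k j - lacuna_potential k i" for k
      using assms unfolding dz_cochain_def by (metis harmonic.simps(1))
    have "J s i j = lacuna_potential i j - lacuna_potential j i"
      unfolding additive_cochain_split[OF add, of s] J by (simp add: lacuna_potential_def)
    then show ?thesis using True by (simp add: along_self side_sign_eq)
  next
    case False
    have "J (r @ []) i j = 0" using assms len False unfolding dz_cochain_def by blast
    then show ?thesis using along_self[OF len] False by simp
  qed
next
  case (Suc d)
  then have less: "length r < length s" by simp
  have add: "additive_cochain J" using assms by (simp add: dz_cochain_def)
  have IH: "J (r @ [k]) i j = (if along (r @ [k]) s i j then side_sign i j / 3 else 0)" for k
    using Suc.hyps(2) less by (intro Suc.hyps(1)) auto
  have "\<not> (along (r @ [i]) s i j \<and> along (r @ [j]) s i j)" if "i \<noteq> j"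
    using that by (auto simp: along_def)
  then show ?case
    unfolding additive_cochain_split[OF add, of r] IH along_split[OF less]
    by (cases "i = j") (auto simp: side_sign_def)
qed

lemma locally_exact_closed:
  assumes "locally_exact n J" "n \<le> length r"
  shows "lacuna_period J r = 0" "circulation J r = 0"
proof -
  define t r' where "t = take n r" and "r' = drop n r"
  have r: "r = t @ r'" "length t = n" using assms(2) by (auto simp: t_def r'_def)
  obtain u where u: "compat u" "\<And>r i j. J (t @ r) i j = u r j - u r i"
    using assms(1) r(2) unfolding locally_exact_def by blast
  show "circulation J r = 0" by (simp add: circulation_def r(1) u(2))
  show "lacuna_period J r = 0"
    using compat_swap[OF u(1), of r' 0 1] compat_swap[OF u(1), of r' 1 2] compat_swap[OF u(1), of r' 2 0]
    by (simp add: lacuna_period_def r(1) u(2))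
qed

lemma along_prefix: "along r s i j \<Longrightarrow> prefix r s"
  by (auto simp: along_def prefix_def)

lemma abs_side_sign_le: "\<bar>side_sign i j\<bar> \<le> 1"
  by (simp add: side_sign_def)

lemma dz_integral_bound:
  assumes "length r \<le> length s"
  shows "\<bar>dz_integral s r i j\<bar> \<le> (if prefix r s then 1/3 else 0)"
  using dz_cochain_short[OF dz_form(2) assms, of i j] along_prefix[of r s i j] abs_side_sign_le[of i j] by auto

text \<open>Each level contains at most one prefix of s.\<close>

lemma sum_prefix_words_le:
  assumes "\<And>r. f r \<le> (if prefix r s then c else 0)" "0 \<le> c"
  shows "(\<Sum>r\<in>words m. f r) \<le> (c::real)"
proof -
  have "(\<Sum>r\<in>words m. f r) \<le> (\<Sum>r\<in>words m. if r = take m s then c else 0)"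
  proof (rule sum_mono)
    fix r assume "r \<in> words m"
    then have "prefix r s \<Longrightarrow> r = take m s" by (auto simp: words_def prefix_def)
    then show "f r \<le> (if r = take m s then c else 0)" using assms(1)[of r] assms(2) by (auto split: if_splits)
  qed
  also have "\<dots> \<le> c" using assms(2) by simp
  finally show ?thesis .
qed

text \<open>Up to the level of s only one cell contributes, with three squares of at most 1/9; on
  finer levels the energy is known exactly.\<close>

lemma level_energy_dz: "level_energy (dz_integral s) m \<le> (5/3) ^ Suc (length s)"
proof (cases "m \<le> length s")
  case True
  have "edge_squares (dz_integral s) r \<le> (if prefix r s then 1/3 else 0)" if "r \<in> words m" for r
  proof -
    have b: "\<bar>dz_integral s r i j\<bar> \<le> (if prefix r s then 1/3 else 0)" for i j
      using that True by (intro dz_integral_bound) (simp add: words_def)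
    have "(dz_integral s r i j)\<^sup>2 \<le> (if prefix r s then 1/9 else 0)" for i j
      using power_mono[OF b[of i j], of 2] by (auto simp: power2_eq_square split: if_splits)
    from this[of 0 1] this[of 1 2] this[of 2 0] show ?thesis
      unfolding edge_squares_def by (auto split: if_splits)
  qed
  then have "(\<Sum>r\<in>words m. edge_squares (dz_integral s) r) \<le> (\<Sum>r\<in>words m. if prefix r s then 1/3 else 0)"
    by (rule sum_mono)
  also have "\<dots> \<le> 1/3" by (rule sum_prefix_words_le[of _ s]) auto
  finally have "level_energy (dz_integral s) m \<le> (5/3) ^ m * (1/3)"
    unfolding level_energy_def by (intro mult_left_mono) auto
  also have "\<dots> \<le> (5/3) ^ Suc (length s) * 1"
    using True by (intro mult_mono power_increasing) auto
  finally show ?thesis by simp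
next
  case False
  then obtain k where "m = Suc (length s) + k" using le_Suc_ex[of "Suc (length s)" m] by auto
  then have "level_energy (dz_integral s) m = (5/3) ^ Suc (length s) / 2"
    using dz_cochain_energy[OF dz_form(2), of s k] by simp
  moreover have "0 \<le> (5/3 :: real) ^ Suc (length s)" by (intro zero_le_power) simp
  ultimately show ?thesis by linarith
qed

lemma sum_circulation_dz:
  "(\<Sum>r\<in>words m. \<bar>circulation (dz_integral s) r\<bar>) \<le> (if m \<le> length s then 1 else 0)"
proof (cases "m \<le> length s")
  case True
  have "\<bar>circulation (dz_integral s) r\<bar> \<le> (if prefix r s then 1 else 0)" if "r \<in> words m" for r
  proof -
    have "\<bar>dz_integral s r i j\<bar> \<le> (if prefix r s then 1/3 else 0)" for i j
      using that True by (intro dz_integral_bound) (simp add: words_def)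
    from this[of 0 1] this[of 1 2] this[of 2 0] show ?thesis
      unfolding circulation_def by (auto split: if_splits)
  qed
  then have "(\<Sum>r\<in>words m. \<bar>circulation (dz_integral s) r\<bar>) \<le> (\<Sum>r\<in>words m. if prefix r s then 1 else 0)"
    by (rule sum_mono)
  also have "\<dots> \<le> 1" by (rule sum_prefix_words_le[of _ s]) auto
  finally show ?thesis using True by simp
next
  case False
  then have "(\<Sum>r\<in>words m. \<bar>circulation (dz_integral s) r\<bar>) = 0"
    using locally_exact_closed(2)[OF dz_cochain_locally_exact[OF dz_form(2)]]
    by (intro sum.neutral) (simp add: words_def)
  then show ?thesis using False by simp
qed


section \<open>The period matrix\<close>

definition last_letter :: "3 \<Rightarrow> word \<Rightarrow> word \<Rightarrow> bool" where
  "last_letter c t r \<longleftrightarrow> (\<exists>t'. r = t @ c # t' \<and> c \<notin> set t')"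

lemma last_letter_unique:
  assumes "last_letter c t r" "last_letter c v r"
  shows "t = v"
proof -
  have *: "takeWhile (\<lambda>x. x \<noteq> c) (rev r) = rev t'" if "r = t @ c # t'" "c \<notin> set t'" for t t'
    using that by (simp add: takeWhile_append)
  obtain t' where t': "r = t @ c # t'" "c \<notin> set t'" using assms(1) unfolding last_letter_def by blast
  obtain v' where v': "r = v @ c # v'" "c \<notin> set v'" using assms(2) unfolding last_letter_def by blast
  have "rev t' = rev v'" using *[OF t'] *[OF v'] by simp
  then show ?thesis using t'(1) v'(1) by simp
qed

text \<open>The side that the lacuna of t has in the subcell c joins the two letters other than c,
  so C_r lies along it exactly when c does not occur again.\<close>

lemma along_last_letter:
  assumes "\<And>k. k = i \<or> k = j \<or> k = c" "i \<noteq> c" "j \<noteq> c"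
  shows "along (t @ [c]) r i j \<longleftrightarrow> last_letter c t r"
proof -
  have "set t' \<subseteq> {i, j} \<longleftrightarrow> c \<notin> set t'" for t'
    using assms by blast
  then show ?thesis by (simp add: along_def last_letter_def)
qed

text \<open>The lacuna runs against the order of the letters, whence the minus sign. Only the letter
  that follows t in r can contribute; the sum over all letters is there to be exchanged with the sum
  over prefixes in \<open>period_matrix_row_sum\<close>.\<close>

lemma period_matrix_eq:
  "period_matrix r t = (if r = t then 1 else - (\<Sum>c\<in>UNIV. of_bool (last_letter c t r)) / 3)"
proof -
  have P: "period_matrix r t = lacuna_period (dz_integral r) t"
    unfolding period_matrix_def dz_eq form_integral_lacuna[OF dz_form(1)] dz_integral_def ..
  consider "r = t" | "length t < length r" | "length t = length r" "r \<noteq> t" | "length r < length t"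
    by linarith
  then show ?thesis
  proof cases
    case 1
    then show ?thesis unfolding P using dz_cochain_period[OF dz_form(2)] by simp
  next
    case 2
    have L: "dz_integral r (t @ [c]) i j = - of_bool (last_letter c t r) / 3"
      if "\<And>k. k = i \<or> k = j \<or> k = c" "i \<noteq> c" "j \<noteq> c" "side_sign i j = -1" for c i j
      using dz_cochain_short[OF dz_form(2), of "t @ [c]" r i j] 2 along_last_letter[OF that(1-3)] that(4) by simp
    have "dz_integral r (t @ [1]) 0 2 = - of_bool (last_letter 1 t r) / 3"
      using three_cases by (intro L) (auto simp: side_sign_def)
    moreover have "dz_integral r (t @ [2]) 1 0 = - of_bool (last_letter 2 t r) / 3"
      using three_cases by (intro L) (auto simp: side_sign_def)
    moreover have "dz_integral r (t @ [0]) 2 1 = - of_bool (last_letter 0 t r) / 3"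
      using three_cases by (intro L) (auto simp: side_sign_def)
    ultimately show ?thesis unfolding P lacuna_period_def sum_three using 2 by auto
  next
    case 3
    then have "dz_integral r (t @ [c]) i j = 0" for c i j
      using dz_form(2)[of r] unfolding dz_cochain_def by blast
    moreover have "\<not> last_letter c t r" for c using 3 by (auto simp: last_letter_def)
    ultimately show ?thesis unfolding P lacuna_period_def using 3 by simp
  next
    case 4
    then have "lacuna_period (dz_integral r) t = 0"
      by (intro locally_exact_closed(1)[OF dz_cochain_locally_exact[OF dz_form(2)]]) simp
    moreover have "\<not> last_letter c t r" for c using 4 by (auto simp: last_letter_def)
    ultimately show ?thesis unfolding P using 4 by auto
  qed
qed

lemma unitriangular_period_matrix: "unitriangular period_matrix"
proof -
  have "last_letter c t r \<Longrightarrow> prefix t r" for c t r by (auto simp: last_letter_def)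
  then show ?thesis unfolding unitriangular_def period_matrix_eq by (auto intro!: sum.neutral)
qed

lemma finite_prefixes: "finite {v. prefix v (r::'a list)}"
proof -
  have "{v. prefix v r} = set (prefixes r)" by auto
  then show ?thesis by simp
qed

lemma finite_strict_prefixes: "finite {v. strict_prefix v (r::'a list)}"
  by (rule finite_subset[OF _ finite_prefixes]) (auto simp: strict_prefix_def)

text \<open>For each letter there is at most one prefix after which it occurs for the last time: at
  most three contributions of 1/3.\<close>

lemma period_matrix_row_sum: "(\<Sum>v | strict_prefix v r. \<bar>period_matrix r v\<bar>) \<le> 1"
proof -
  let ?S = "{v. strict_prefix v r}"
  have "(\<Sum>v\<in>?S. \<bar>period_matrix r v\<bar>) = (\<Sum>v\<in>?S. \<Sum>c\<in>UNIV. of_bool (last_letter c v r) / 3)"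
    by (intro sum.cong refl) (auto simp: period_matrix_eq sum_three add_divide_distrib)
  also have "\<dots> = (\<Sum>c\<in>UNIV. (\<Sum>v\<in>?S. of_bool (last_letter c v r)) / 3)"
    by (subst sum.swap) (simp add: sum_divide_distrib)
  also have "\<dots> \<le> (\<Sum>c\<in>(UNIV :: 3 set). 1 / 3)"
  proof (intro sum_mono divide_right_mono)
    fix c
    have "(\<Sum>v\<in>?S. of_bool (last_letter c v r)) = real (card (?S \<inter> {v. last_letter c v r}))"
      by (subst sum_of_bool_eq) (simp_all add: finite_strict_prefixes)
    also have "card (?S \<inter> {v. last_letter c v r}) \<le> 1"
      using last_letter_unique by (intro card_le_Suc0_iff_eq[THEN iffD2, unfolded One_nat_def[symmetric]]) (auto simp: finite_strict_prefixes)
    finally show "(\<Sum>v\<in>?S. of_bool (last_letter c v r)) \<le> (1::real)" by simp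
  qed simp
  finally show ?thesis by simp
qed

lemma abs_period_matrix_le: "\<bar>period_matrix r t\<bar> \<le> 1"
  by (simp add: period_matrix_eq sum_three)

text \<open>Forward substitution: row r of M N = 1 is solved for the entry of N in terms of the rows
  of proper prefixes.\<close>

function right_inverse :: "matrix \<Rightarrow> matrix" where
  "right_inverse M r t = (if r = t then 1 else if prefix t r
     then - (\<Sum>v | strict_prefix v r. M r v * right_inverse M v t) else 0)"
  by pat_completeness auto
termination
  by (relation "Wellfounded.measure (\<lambda>(M, r, t). length r)") (auto dest: prefix_length_less)

declare right_inverse.simps [simp del]

lemma unitriangular_right_inverse: "unitriangular (right_inverse M)"
  unfolding unitriangular_def by (auto simp: right_inverse.simps)

lemma matrix_mul_right_inverse:
  assumes "unitriangular M"
  shows "matrix_mul M (right_inverse M) = identity_matrix"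
proof (intro ext)
  fix r t :: word
  let ?N = "right_inverse M"
  have split: "{v. prefix v r} = insert r {v. strict_prefix v r}" by (auto simp: strict_prefix_def)
  have "matrix_mul M ?N r t = M r r * ?N r t + (\<Sum>v | strict_prefix v r. M r v * ?N v t)"
    unfolding matrix_mul_def split by (subst sum.insert) (auto simp: finite_strict_prefixes)
  also have "\<dots> = identity_matrix r t"
  proof (cases "strict_prefix t r")
    case True
    then show ?thesis using assms
      by (subst right_inverse.simps) (auto simp: unitriangular_def identity_matrix_def strict_prefix_def)
  next
    case False
    have "?N v t = 0" if "strict_prefix v r" for v
    proof -
      have "\<not> prefix t v" using that False prefix_order.le_less_trans by blast
      then show ?thesis using unitriangular_right_inverse[of M] by (simp add: unitriangular_def)
    qed
    then show ?thesis using False assms unitriangular_right_inverse[of M]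
      by (auto simp: unitriangular_def identity_matrix_def strict_prefix_def)
  qed
  finally show "matrix_mul M ?N r t = identity_matrix r t" .
qed

text \<open>The inner sum over the prefixes of \<kappa> may run over all prefixes of r, since N
  vanishes elsewhere; then two finite sums are exchanged.\<close>

lemma matrix_mul_assoc:
  assumes "unitriangular N"
  shows "matrix_mul (matrix_mul M N) P = matrix_mul M (matrix_mul N P)"
proof (intro ext)
  fix r t :: word
  let ?S = "{v. prefix v r}"
  have "matrix_mul N P \<kappa> t = (\<Sum>v\<in>?S. N \<kappa> v * P v t)" if "\<kappa> \<in> ?S" for \<kappa>
    unfolding matrix_mul_def
    using that assms prefix_order.trans finite_prefixes[of r]
    by (intro sum.mono_neutral_left) (auto simp: unitriangular_def)
  then have "matrix_mul M (matrix_mul N P) r t = (\<Sum>\<kappa>\<in>?S. M r \<kappa> * (\<Sum>v\<in>?S. N \<kappa> v * P v t))"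
    unfolding matrix_mul_def[of M] by (intro sum.cong) auto
  also have "\<dots> = (\<Sum>v\<in>?S. \<Sum>\<kappa>\<in>?S. M r \<kappa> * N \<kappa> v * P v t)"
    unfolding sum_distrib_left by (subst sum.swap) (simp add: mult.assoc)
  also have "\<dots> = matrix_mul (matrix_mul M N) P r t"
    by (simp add: matrix_mul_def sum_distrib_right)
  finally show "matrix_mul (matrix_mul M N) P r t = matrix_mul M (matrix_mul N P) r t" by simp
qed

lemma matrix_mul_identity_left: "matrix_mul identity_matrix M = M"
proof (intro ext)
  fix r t :: word
  have "matrix_mul identity_matrix M r t = (\<Sum>v | prefix v r. if v = r then M v t else 0)"
    unfolding matrix_mul_def by (intro sum.cong) (auto simp: identity_matrix_def)
  then show "matrix_mul identity_matrix M r t = M r t" by (simp add: finite_prefixes)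
qed

lemma matrix_mul_identity_right: "matrix_mul M identity_matrix = M" if "unitriangular M"
proof (intro ext)
  fix r t :: word
  have "matrix_mul M identity_matrix r t = (\<Sum>v | prefix v r. if v = t then M r v else 0)"
    unfolding matrix_mul_def by (intro sum.cong) (auto simp: identity_matrix_def)
  then show "matrix_mul M identity_matrix r t = M r t"
    using that by (simp add: finite_prefixes unitriangular_def)
qed

text \<open>The right inverse N has itself a right inverse P, and M = M (N P) = (M N) P = P.\<close>

lemma matrix_mul_left_inverse:
  assumes "unitriangular M"
  shows "matrix_mul (right_inverse M) M = identity_matrix"
proof -
  let ?N = "right_inverse M"
  let ?P = "right_inverse ?N"
  have N: "unitriangular ?N" by (rule unitriangular_right_inverse)
  have "M = matrix_mul M (matrix_mul ?N ?P)"
    by (simp add: matrix_mul_right_inverse[OF N] matrix_mul_identity_right[OF assms])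
  also have "\<dots> = ?P"
    by (simp add: matrix_mul_right_inverse[OF assms] matrix_mul_identity_left flip: matrix_mul_assoc[OF N])
  finally show ?thesis using matrix_mul_right_inverse[OF N] by simp
qed

lemma inverse_period_matrix_eq: "inverse_period_matrix = right_inverse period_matrix"
  unfolding inverse_period_matrix_def
proof (rule the_equality)
  note U = unitriangular_period_matrix
  show "unitriangular (right_inverse period_matrix) \<and>
      matrix_mul (right_inverse period_matrix) period_matrix = identity_matrix \<and>
      matrix_mul period_matrix (right_inverse period_matrix) = identity_matrix"
    using unitriangular_right_inverse matrix_mul_left_inverse[OF U] matrix_mul_right_inverse[OF U] by simp
  fix A assume A: "unitriangular A \<and> matrix_mul A period_matrix = identity_matrix \<and>
      matrix_mul period_matrix A = identity_matrix"
  have "A = matrix_mul A (matrix_mul period_matrix (right_inverse period_matrix))"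
    using A by (simp add: matrix_mul_right_inverse[OF U] matrix_mul_identity_right)
  also have "\<dots> = right_inverse period_matrix"
    using A by (simp add: matrix_mul_identity_left flip: matrix_mul_assoc[OF U])
  finally show "A = right_inverse period_matrix" .
qed

lemma inverse_period_matrix:
  "unitriangular inverse_period_matrix" "matrix_mul inverse_period_matrix period_matrix = identity_matrix"
  unfolding inverse_period_matrix_eq
  by (rule unitriangular_right_inverse matrix_mul_left_inverse unitriangular_period_matrix)+

text \<open>Off the diagonal, row r of the inverse is minus a combination of the rows of its proper
  prefixes, with coefficients of absolute sum at most 1.\<close>

lemma abs_inverse_period_matrix_le: "\<bar>inverse_period_matrix r t\<bar> \<le> 1"
  unfolding inverse_period_matrix_eq
proof (induction r rule: measure_induct_rule[of length])
  case (less r)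
  let ?A = "right_inverse period_matrix"
  have "\<bar>\<Sum>v | strict_prefix v r. period_matrix r v * ?A v t\<bar> \<le> (\<Sum>v | strict_prefix v r. \<bar>period_matrix r v\<bar> * 1)"
  proof (intro sum_abs[THEN order_trans] sum_mono)
    fix v assume "v \<in> {v. strict_prefix v r}"
    then have "\<bar>?A v t\<bar> \<le> 1" by (intro less prefix_length_less) simp
    then show "\<bar>period_matrix r v * ?A v t\<bar> \<le> \<bar>period_matrix r v\<bar> * 1"
      unfolding abs_mult by (rule mult_left_mono) simp
  qed
  also have "\<dots> \<le> 1" using period_matrix_row_sum by simp
  finally show ?case by (subst right_inverse.simps) simp
qed

section \<open>Summation over words\<close>

definition weight :: "word \<Rightarrow> real" where
  "weight s = sqrt (5/3) ^ length s"

text \<open>The lower bound lets the weights of the prefixes sum to a multiple of the last one; the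
  upper bound gives 3/5 * sqrt(5/3) < 1.\<close>

lemma sqrt_five_thirds: "5/4 \<le> sqrt (5/3)" "sqrt (5/3) \<le> 3/2"
  by (rule real_le_rsqrt, simp add: power2_eq_square) (rule real_le_lsqrt, simp_all add: power2_eq_square)

lemma weight_ge_1: "1 \<le> weight s"
  using sqrt_five_thirds(1) by (simp add: weight_def)

lemma weight_nonneg: "0 \<le> weight s"
  using weight_ge_1[of s] by linarith

text \<open>For a ratio q \<ge> 5/4 a geometric sum is at most q / (q - 1) \<le> 5 times its last
  term.\<close>

lemma sum_weight_prefixes: "(\<Sum>t | prefix t s. weight t) \<le> 5 * weight s"
proof (induction s rule: rev_induct)
  case Nil
  have "{t. prefix t ([] :: word)} = {[]}" by auto
  then show ?case by (simp add: weight_def)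
next
  case (snoc x s)
  have "{t. prefix t (s @ [x])} = insert (s @ [x]) {t. prefix t s}" by auto
  moreover have "\<not> prefix (s @ [x]) s" by (auto simp: prefix_def)
  ultimately have "(\<Sum>t | prefix t (s @ [x]). weight t) = weight (s @ [x]) + (\<Sum>t | prefix t s. weight t)"
    by (simp add: finite_prefixes)
  also have "\<dots> \<le> sqrt (5/3) * weight s + 5 * weight s" using snoc by (simp add: weight_def)
  also have "\<dots> \<le> 5 * (sqrt (5/3) * weight s)"
    using mult_right_mono[OF sqrt_five_thirds(1) weight_nonneg[of s]] by linarith
  also have "sqrt (5/3) * weight s = weight (s @ [x])" by (simp add: weight_def)
  finally show ?case .
qed

lemma summable_on_words:
  fixes f :: "word \<Rightarrow> real"
  assumes "\<And>s. 0 \<le> f s" "\<And>m. (\<Sum>s\<in>words m. f s) \<le> g m" "summable g"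
  shows "f summable_on UNIV"
proof (rule nonneg_bdd_above_summable_on)
  show "bdd_above (sum f ` {F. F \<subseteq> UNIV \<and> finite F})"
  proof (rule bdd_aboveI2)
    fix F :: "word set" assume "F \<in> {F. F \<subseteq> UNIV \<and> finite F}"
    then have F: "finite F" by simp
    define N where "N = Suc (Max (length ` F))"
    have "F \<subseteq> (\<Union>m<N. words m)"
      using F by (auto simp: N_def words_def less_Suc_eq_le)
    then have "sum f F \<le> sum f (\<Union>m<N. words m)"
      by (intro sum_mono2) (auto simp: assms(1))
    also have "\<dots> = (\<Sum>m<N. \<Sum>s\<in>words m. f s)"
      by (intro sum.UNION_disjoint) (auto simp: words_def finite_words[unfolded words_def])
    also have "\<dots> \<le> (\<Sum>m<N. g m)" by (intro sum_mono assms)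
    also have "\<dots> \<le> (\<Sum>m. g m)"
      using assms(1,2) by (intro sum_le_suminf assms(3)) (auto intro: order_trans[OF sum_nonneg])
    finally show "sum f F \<le> (\<Sum>m. g m)" .
  qed
qed (simp add: assms(1))

definition decaying :: "(word \<Rightarrow> real) \<Rightarrow> bool" where
  "decaying c \<longleftrightarrow> (\<exists>C. \<forall>m. (\<Sum>s\<in>words m. \<bar>c s\<bar>) \<le> C * (3/5) ^ m)"

text \<open>The weights grow by sqrt(5/3) per level, more slowly than the bound on the sums of |c|
  decreases.\<close>

lemma decaying_summable:
  assumes "decaying c"
  shows "(\<lambda>s. \<bar>c s\<bar> * weight s) summable_on UNIV"
proof -
  obtain C where C: "\<And>m. (\<Sum>s\<in>words m. \<bar>c s\<bar>) \<le> C * (3/5) ^ m" using assms unfolding decaying_def by blast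
  define q where "q = sqrt (5/3)"
  have q: "0 \<le> q" "3/5 * q < 1" using sqrt_five_thirds by (simp_all add: q_def)
  show ?thesis
  proof (rule summable_on_words)
    show "(\<Sum>s\<in>words m. \<bar>c s\<bar> * weight s) \<le> C * (3/5 * q) ^ m" for m
    proof -
      have "(\<Sum>s\<in>words m. \<bar>c s\<bar> * weight s) = (\<Sum>s\<in>words m. \<bar>c s\<bar>) * q ^ m"
        unfolding sum_distrib_right by (intro sum.cong) (auto simp: weight_def words_def q_def)
      also have "\<dots> \<le> C * (3/5) ^ m * q ^ m" using C q by (intro mult_right_mono) auto
      also have "\<dots> = C * (3/5 * q) ^ m" by (simp only: power_mult_distrib mult.assoc)
      finally show ?thesis .
    qed
    show "summable (\<lambda>m. C * (3/5 * q) ^ m)" using q by (intro summable_mult summable_geometric) auto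
  qed (simp add: weight_nonneg)
qed

lemma summable_on_dominated:
  fixes f :: "'a \<Rightarrow> real"
  assumes "g summable_on A" "\<And>x. x \<in> A \<Longrightarrow> \<bar>f x\<bar> \<le> g x"
  shows "f summable_on A"
  by (rule Infinite_Sum.abs_summable_summable, rule Infinite_Sum.abs_summable_on_comparison_test'[OF assms(1)])
    (simp add: assms(2))

lemma weighted_summable:
  fixes y :: "word \<Rightarrow> real"
  assumes "(\<lambda>s. \<bar>c s\<bar> * weight s) summable_on UNIV" "\<And>s. \<bar>y s\<bar> \<le> Y * weight s"
  shows "(\<lambda>s. c s * y s) summable_on UNIV"
proof (rule summable_on_dominated[OF summable_on_cmult_right[OF assms(1), of Y]])
  fix s
  have "\<bar>c s * y s\<bar> \<le> \<bar>c s\<bar> * (Y * weight s)"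
    unfolding abs_mult by (intro mult_left_mono assms) simp
  then show "\<bar>c s * y s\<bar> \<le> Y * (\<bar>c s\<bar> * weight s)" by (simp only: mult.left_commute)
qed

definition adjoint_coeff :: "(word \<Rightarrow> real) \<Rightarrow> word \<Rightarrow> real" where
  "adjoint_coeff c t = (\<Sum>\<^sub>\<infinity>s. inverse_period_matrix s t * c s)"

lemma inverse_period_matrix_eq_0: "\<not> prefix t s \<Longrightarrow> inverse_period_matrix s t = 0"
  using inverse_period_matrix(1) by (simp add: unitriangular_def)

lemma is_adjoint_image_coeff:
  assumes "decaying c"
  shows "is_adjoint_image inverse_period_matrix c (adjoint_coeff c)"
  unfolding is_adjoint_image_def
proof
  fix t
  have "\<bar>inverse_period_matrix s t\<bar> \<le> 1 * weight s" for s
    using abs_inverse_period_matrix_le[of s t] weight_ge_1[of s] by linarith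
  from weighted_summable[OF decaying_summable[OF assms] this]
  have "(\<lambda>s. inverse_period_matrix s t * c s) summable_on UNIV" by (simp add: mult.commute)
  then have "((\<lambda>s. inverse_period_matrix s t * c s) has_sum adjoint_coeff c t) UNIV"
    unfolding adjoint_coeff_def by (rule has_sum_infsum)
  also have "?this \<longleftrightarrow> ((\<lambda>s. inverse_period_matrix s t * c s) has_sum adjoint_coeff c t) {s. prefix t s}"
    by (rule has_sum_cong_neutral) (auto simp: inverse_period_matrix_eq_0)
  finally show "((\<lambda>s. inverse_period_matrix s t * c s) has_sum adjoint_coeff c t) {s. prefix t s}" .
qed

text \<open>Absolute summability of the double family for every y growing like the weight. With y =
  \<open>weight\<close> it gives the summability of k, and with a column of the period matrix the
  exchange of sums in \<open>adjoint_coeff_period\<close>. The inner sum runs over prefixes, which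
  costs the factor 5.\<close>

lemma kernel_summable:
  fixes y :: "word \<Rightarrow> real"
  assumes c: "decaying c" and y: "\<And>t. \<bar>y t\<bar> \<le> Y * weight t"
  shows "(\<lambda>(s, t). inverse_period_matrix s t * c s * y t) summable_on UNIV \<times> UNIV"
proof (rule Infinite_Sum.abs_summable_summable, subst Infinite_Sum.abs_summable_on_Sigma_iff, intro conjI ballI)
  let ?G = "\<lambda>s t. \<bar>inverse_period_matrix s t * c s * y t\<bar>"
  have hs: "(?G s has_sum (\<Sum>t | prefix t s. ?G s t)) UNIV" for s
    by (rule has_sum_finite_neutralI[of "{t. prefix t s}"]) (auto simp: finite_prefixes inverse_period_matrix_eq_0)
  then show "(\<lambda>t. norm (case (s, t) of (s, t) \<Rightarrow> inverse_period_matrix s t * c s * y t)) summable_on UNIV" for s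
    using has_sum_imp_summable[OF hs[of s]] by simp
  have Y: "0 \<le> Y" using y[of "[]"] weight_ge_1[of "[]"] by (simp add: weight_def)
  have le: "(\<Sum>t | prefix t s. ?G s t) \<le> 5 * Y * (\<bar>c s\<bar> * weight s)" for s
  proof -
    have "(\<Sum>t | prefix t s. ?G s t) \<le> (\<Sum>t | prefix t s. 1 * \<bar>c s\<bar> * (Y * weight t))"
      unfolding abs_mult by (intro sum_mono mult_mono abs_inverse_period_matrix_le y) auto
    also have "\<dots> = \<bar>c s\<bar> * Y * (\<Sum>t | prefix t s. weight t)"
      by (simp add: sum_distrib_left mult.assoc)
    also have "\<dots> \<le> \<bar>c s\<bar> * Y * (5 * weight s)"
      using Y by (intro mult_left_mono sum_weight_prefixes) simp
    finally show ?thesis by (simp add: mult_ac)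
  qed
  have "(\<lambda>s. \<bar>\<Sum>t | prefix t s. ?G s t\<bar>) summable_on UNIV"
  proof (rule summable_on_dominated[OF summable_on_cmult_right[OF decaying_summable[OF c], of "5 * Y"]])
    show "\<bar>\<bar>\<Sum>t | prefix t s. ?G s t\<bar>\<bar> \<le> 5 * Y * (\<bar>c s\<bar> * weight s)" for s
      using le[of s] sum_nonneg[of "{t. prefix t s}" "?G s"] by simp
  qed
  then show "(\<lambda>s. norm (infsum (\<lambda>t. norm (case (s, t) of (s, t) \<Rightarrow> inverse_period_matrix s t * c s * y t)) UNIV)) summable_on UNIV"
    using infsumI[OF hs] by simp
qed

lemma adjoint_coeff_mult: "(\<Sum>\<^sub>\<infinity>s. inverse_period_matrix s t * c s * y) = adjoint_coeff c t * y"
  unfolding adjoint_coeff_def by (rule infsum_cmult_left')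

lemma adjoint_coeff_summable:
  assumes "decaying c"
  shows "(\<lambda>t. \<bar>adjoint_coeff c t\<bar> * weight t) summable_on UNIV"
proof -
  have "\<bar>weight t\<bar> \<le> 1 * weight t" for t by (simp add: weight_nonneg)
  from kernel_summable[OF assms this]
  have "(\<lambda>(t, s). inverse_period_matrix s t * c s * weight t) summable_on UNIV \<times> UNIV"
    by (subst (asm) summable_on_swap) simp
  from summable_on_Sigma_banach[OF this] have "(\<lambda>t. adjoint_coeff c t * weight t) summable_on UNIV"
    by (simp add: adjoint_coeff_mult)
  from summable_on_iff_abs_summable_on_real[THEN iffD1, OF this] show ?thesis
    by (simp add: abs_mult weight_nonneg)
qed

text \<open>\<open>B\<^sup>* A\<^sup>* c = (A B)\<^sup>* c = c\<close>.\<close>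

lemma adjoint_coeff_period:
  assumes "decaying c"
  shows "(\<Sum>\<^sub>\<infinity>t. adjoint_coeff c t * period_matrix t v) = c v"
proof -
  let ?A = inverse_period_matrix and ?B = period_matrix
  have y: "\<bar>?B t v\<bar> \<le> 1 * weight t" for t
    using abs_period_matrix_le[of t v] weight_ge_1[of t] by linarith
  have "(\<Sum>\<^sub>\<infinity>t. adjoint_coeff c t * ?B t v) = (\<Sum>\<^sub>\<infinity>t. \<Sum>\<^sub>\<infinity>s. ?A s t * c s * ?B t v)"
    by (simp add: adjoint_coeff_mult)
  also have "\<dots> = (\<Sum>\<^sub>\<infinity>s. \<Sum>\<^sub>\<infinity>t. ?A s t * c s * ?B t v)"
    by (rule infsum_swap_banach[symmetric]) (rule kernel_summable[OF assms y])
  also have "\<dots> = (\<Sum>\<^sub>\<infinity>s. if s = v then c s else 0)"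
  proof (rule infsum_cong)
    fix s
    have "((\<lambda>t. ?A s t * c s * ?B t v) has_sum (\<Sum>t | prefix t s. ?A s t * c s * ?B t v)) UNIV"
      by (rule has_sum_finite_neutralI[of "{t. prefix t s}"]) (auto simp: finite_prefixes inverse_period_matrix_eq_0)
    then have "(\<Sum>\<^sub>\<infinity>t. ?A s t * c s * ?B t v) = (\<Sum>t | prefix t s. ?A s t * c s * ?B t v)"
      by (rule infsumI)
    also have "\<dots> = c s * matrix_mul ?A ?B s v"
      by (simp add: matrix_mul_def sum_distrib_left mult_ac)
    also have "\<dots> = (if s = v then c s else 0)"
      unfolding inverse_period_matrix(2) identity_matrix_def by simp
    finally show "(\<Sum>\<^sub>\<infinity>t. ?A s t * c s * ?B t v) = (if s = v then c s else 0)" .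
  qed
  also have "\<dots> = c v"
    by (rule infsumI, rule has_sum_finite_neutralI[of "{v}"]) auto
  finally show ?thesis .
qed


section \<open>The series \<open>\<Sum>\<^sub>\<sigma> k\<^sub>\<sigma> dz\<^sub>\<sigma>\<close>\<close>

definition dz_sum :: "(word \<Rightarrow> real) \<Rightarrow> word set \<Rightarrow> cochain" where
  "dz_sum k T r i j = (\<Sum>s\<in>T. k s * dz_integral s r i j)"

text \<open>An edgewise sum, so far without a form behind it.\<close>

definition dz_series :: "(word \<Rightarrow> real) \<Rightarrow> cochain" where
  "dz_series k r i j = (\<Sum>\<^sub>\<infinity>s. k s * dz_integral s r i j)"

lemma additive_dz_integral: "additive_cochain (dz_integral s)"
  using dz_form(2) by (simp add: dz_cochain_def)

lemma square_le_edge_squares: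
  assumes "additive_cochain J"
  shows "(J r i j)\<^sup>2 \<le> edge_squares J r"
proof -
  have "J r 1 0 = - J r 0 1" "J r 2 1 = - J r 1 2" "J r 0 2 = - J r 2 0"
    by (rule additive_cochain_anti[OF assms])+
  moreover have "J r i i = 0" using additive_cochain_anti[OF assms, of r i i] by simp
  ultimately show ?thesis
    using neq_three[of i j] by (cases "i = j") (auto simp: edge_squares_def)
qed

text \<open>A single integral is controlled by the energy of its level. The factor 2 absorbs
  sqrt(5/3).\<close>

lemma abs_dz_integral_le: "\<bar>dz_integral s r i j\<bar> \<le> 2 * weight s"
proof -
  have "(dz_integral s r i j)\<^sup>2 \<le> edge_squares (dz_integral s) r"
    by (rule square_le_edge_squares[OF additive_dz_integral])
  also have "\<dots> \<le> (\<Sum>r\<in>words (length r). edge_squares (dz_integral s) r)"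
    by (rule member_le_sum) (auto simp: words_def finite_words[unfolded words_def] edge_squares_nonneg)
  also have "\<dots> \<le> level_energy (dz_integral s) (length r)"
    using mult_right_mono[of 1 "(5/3 :: real) ^ length r" "\<Sum>r\<in>words (length r). edge_squares (dz_integral s) r"]
    by (simp add: level_energy_def sum_nonneg edge_squares_nonneg)
  also have "\<dots> \<le> (5/3) ^ Suc (length s)" by (rule level_energy_dz)
  also have "\<dots> \<le> 4 * (weight s)\<^sup>2"
  proof -
    have "(weight s)\<^sup>2 = (sqrt (5/3))\<^sup>2 ^ length s"
      unfolding weight_def power_mult[symmetric] by (simp only: mult.commute)
    then show ?thesis by simp
  qed
  also have "\<dots> = (2 * weight s)\<^sup>2" by (simp add: power_mult_distrib)
  finally show ?thesis
    using weight_nonneg[of s] by (intro power2_le_iff_abs_le[THEN iffD1]) auto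
qed

lemma dz_series_has_sum:
  assumes "(\<lambda>s. \<bar>k s\<bar> * weight s) summable_on UNIV"
  shows "((\<lambda>s. k s * dz_integral s r i j) has_sum dz_series k r i j) UNIV"
  unfolding dz_series_def by (intro has_sum_infsum weighted_summable[OF assms abs_dz_integral_le])

lemma dz_sum_tendsto:
  assumes "(\<lambda>s. \<bar>k s\<bar> * weight s) summable_on UNIV"
  shows "((\<lambda>T. dz_sum k T r i j) \<longlongrightarrow> dz_series k r i j) (finite_subsets_at_top UNIV)"
  using dz_series_has_sum[OF assms] unfolding has_sum_def dz_sum_def .

lemma additive_dz_series:
  assumes "(\<lambda>s. \<bar>k s\<bar> * weight s) summable_on UNIV"
  shows "additive_cochain (dz_series k)"
  unfolding additive_cochain_def
proof (intro allI conjI)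
  fix r i j
  show "dz_series k r i j = - dz_series k r j i"
    unfolding dz_series_def infsum_uminus[symmetric]
    by (intro infsum_cong) (simp add: additive_cochain_anti[OF additive_dz_integral, of _ r i j])
  have "((\<lambda>s. k s * dz_integral s (r @ [i]) i j + k s * dz_integral s (r @ [j]) i j) has_sum
      (dz_series k (r @ [i]) i j + dz_series k (r @ [j]) i j)) UNIV"
    by (intro has_sum_add dz_series_has_sum assms)
  moreover have "k s * dz_integral s (r @ [i]) i j + k s * dz_integral s (r @ [j]) i j = k s * dz_integral s r i j" for s
    by (simp add: additive_cochain_split[OF additive_dz_integral, of s r i j] distrib_left)
  ultimately show "dz_series k r i j = dz_series k (r @ [i]) i j + dz_series k (r @ [j]) i j"
    using has_sum_unique[OF dz_series_has_sum[OF assms]] by simp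
qed

lemma lacuna_period_dz_series:
  assumes "(\<lambda>s. \<bar>k s\<bar> * weight s) summable_on UNIV"
  shows "lacuna_period (dz_series k) v = (\<Sum>\<^sub>\<infinity>s. k s * period_matrix s v)"
proof -
  have P: "period_matrix s v = lacuna_period (dz_integral s) v" for s
    unfolding period_matrix_def dz_eq form_integral_lacuna[OF dz_form(1)] dz_integral_def ..
  have "((\<lambda>s. k s * dz_integral s (v @ [1]) 0 2 + k s * dz_integral s (v @ [2]) 1 0 +
      k s * dz_integral s (v @ [0]) 2 1) has_sum lacuna_period (dz_series k) v) UNIV"
    unfolding lacuna_period_def by (intro has_sum_add dz_series_has_sum assms)
  then have "((\<lambda>s. k s * period_matrix s v) has_sum lacuna_period (dz_series k) v) UNIV"
    by (simp add: P lacuna_period_def distrib_left)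
  then show ?thesis by (rule infsumI[symmetric])
qed

text \<open>Only words of length at least m contribute to level m, each with at most 1. For these, 1
  \<le> sqrt(3/5)^m * \<open>weight s\<close>, so the decay is paid for with the weight.\<close>

lemma sum_circulation_dz_series:
  assumes k: "(\<lambda>s. \<bar>k s\<bar> * weight s) summable_on UNIV"
  shows "(\<Sum>\<rho>\<in>words m. \<bar>circulation (dz_series k) \<rho>\<bar>) \<le> (1 / sqrt (5/3)) ^ m * (\<Sum>\<^sub>\<infinity>s. \<bar>k s\<bar> * weight s)"
proof (rule tendsto_upperbound)
  let ?r = "1 / sqrt (5/3)"
  show "((\<lambda>T. \<Sum>\<rho>\<in>words m. \<bar>circulation (dz_sum k T) \<rho>\<bar>) \<longlongrightarrow> (\<Sum>\<rho>\<in>words m. \<bar>circulation (dz_series k) \<rho>\<bar>))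
      (finite_subsets_at_top UNIV)"
    unfolding circulation_def by (intro tendsto_sum tendsto_rabs tendsto_add dz_sum_tendsto k)
  show "\<forall>\<^sub>F T in finite_subsets_at_top UNIV. (\<Sum>\<rho>\<in>words m. \<bar>circulation (dz_sum k T) \<rho>\<bar>) \<le>
      ?r ^ m * (\<Sum>\<^sub>\<infinity>s. \<bar>k s\<bar> * weight s)"
  proof (rule eventually_finite_subsets_at_top_weakI)
    fix T :: "word set" assume T: "finite T"
    have "circulation (dz_sum k T) \<rho> = (\<Sum>s\<in>T. k s * circulation (dz_integral s) \<rho>)" for \<rho>
      by (simp add: circulation_def dz_sum_def sum.distrib distrib_left)
    then have "(\<Sum>\<rho>\<in>words m. \<bar>circulation (dz_sum k T) \<rho>\<bar>) \<le>
        (\<Sum>\<rho>\<in>words m. \<Sum>s\<in>T. \<bar>k s\<bar> * \<bar>circulation (dz_integral s) \<rho>\<bar>)"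
      by (auto simp flip: abs_mult intro!: sum_mono sum_abs)
    also have "\<dots> = (\<Sum>s\<in>T. \<bar>k s\<bar> * (\<Sum>\<rho>\<in>words m. \<bar>circulation (dz_integral s) \<rho>\<bar>))"
      by (subst sum.swap) (simp add: sum_distrib_left)
    also have "\<dots> \<le> (\<Sum>s\<in>T. \<bar>k s\<bar> * (?r ^ m * weight s))"
    proof (intro sum_mono mult_left_mono)
      fix s
      have "(if m \<le> length s then 1 else 0) \<le> ?r ^ m * weight s"
      proof (cases "m \<le> length s")
        case True
        then have "sqrt (5/3) ^ m \<le> weight s"
          unfolding weight_def using sqrt_five_thirds(1) by (intro power_increasing) auto
        then show ?thesis using True by (simp add: power_divide field_simps)
      qed (simp add: weight_nonneg)
      then show "(\<Sum>\<rho>\<in>words m. \<bar>circulation (dz_integral s) \<rho>\<bar>) \<le> ?r ^ m * weight s"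
        using sum_circulation_dz[of s m] by linarith
    qed simp
    also have "\<dots> = ?r ^ m * (\<Sum>s\<in>T. \<bar>k s\<bar> * weight s)" unfolding sum_distrib_left by (intro sum.cong refl) (simp only: mult_ac)
    also have "\<dots> \<le> ?r ^ m * (\<Sum>\<^sub>\<infinity>s. \<bar>k s\<bar> * weight s)"
      using T k by (intro mult_left_mono finite_sum_le_infsum) (auto simp: weight_nonneg)
    finally show "(\<Sum>\<rho>\<in>words m. \<bar>circulation (dz_sum k T) \<rho>\<bar>) \<le> ?r ^ m * (\<Sum>\<^sub>\<infinity>s. \<bar>k s\<bar> * weight s)" .
  qed
qed simp

section \<open>Estimates uniform in the level\<close>

definition level_norm :: "cochain \<Rightarrow> nat \<Rightarrow> real" where
  "level_norm J m = sqrt (level_energy J m)"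

text \<open>As a scaled Euclidean norm it inherits the triangle inequality. The pairs i, i + 1 run
  through the three sides.\<close>

lemma level_norm_eq: "level_norm J m = sqrt ((5/3) ^ m) * L2_set (\<lambda>(s, i). J s i (i + 1)) (words m \<times> UNIV)"
proof -
  have "(2::3) + 1 = 0" by simp
  then have "edge_squares J s = (\<Sum>i\<in>UNIV. (J s i (i + 1))\<^sup>2)" for s
    unfolding edge_squares_def sum_three by (simp only: three_add add_0)
  then show ?thesis
    by (simp add: level_norm_def level_energy_def L2_set_def real_sqrt_mult sum.cartesian_product case_prod_unfold)
qed

lemma level_norm_add: "level_norm (\<lambda>s i j. J s i j + J' s i j) m \<le> level_norm J m + level_norm J' m"
proof -
  have "L2_set (\<lambda>(s, i). J s i (i + 1) + J' s i (i + 1)) (words m \<times> UNIV) \<le>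
      L2_set (\<lambda>(s, i). J s i (i + 1)) (words m \<times> UNIV) + L2_set (\<lambda>(s, i). J' s i (i + 1)) (words m \<times> UNIV)"
    using L2_set_triangle_ineq[of "\<lambda>(s, i). J s i (i + 1)" "\<lambda>(s, i). J' s i (i + 1)" "words m \<times> UNIV"]
    by (simp add: case_prod_unfold)
  then show ?thesis unfolding level_norm_eq distrib_left[symmetric] by (intro mult_left_mono) auto
qed

lemma level_norm_scale: "level_norm (\<lambda>s i j. c * J s i j) m = \<bar>c\<bar> * level_norm J m"
proof -
  have "level_energy (\<lambda>s i j. c * J s i j) m = c\<^sup>2 * level_energy J m"
    by (simp add: level_energy_def edge_squares_def power_mult_distrib sum_distrib_left algebra_simps)
  then show ?thesis by (simp add: level_norm_def real_sqrt_mult)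
qed

lemma level_norm_dz: "level_norm (dz_integral s) m \<le> sqrt (5/3) * weight s"
proof -
  have "level_norm (dz_integral s) m \<le> sqrt ((5/3) ^ Suc (length s))"
    unfolding level_norm_def by (intro real_sqrt_le_mono level_energy_dz)
  also have "\<dots> = sqrt (5/3) * weight s" by (simp only: weight_def power_Suc real_sqrt_mult real_sqrt_power)
  finally show ?thesis .
qed

lemma level_norm_dz_sum: "finite T \<Longrightarrow> level_norm (dz_sum k T) m \<le> sqrt (5/3) * (\<Sum>s\<in>T. \<bar>k s\<bar> * weight s)"
proof (induction T rule: finite_induct)
  case empty
  show ?case by (simp add: level_norm_def level_energy_def edge_squares_def dz_sum_def)
next
  case (insert s T)
  have "dz_sum k (insert s T) = (\<lambda>r i j. k s * dz_integral s r i j + dz_sum k T r i j)"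
    using insert by (simp add: dz_sum_def fun_eq_iff)
  then have "level_norm (dz_sum k (insert s T)) m \<le> \<bar>k s\<bar> * level_norm (dz_integral s) m + level_norm (dz_sum k T) m"
    using level_norm_add[of "\<lambda>r i j. k s * dz_integral s r i j" "dz_sum k T" m] by (simp add: level_norm_scale)
  also have "\<dots> \<le> \<bar>k s\<bar> * (sqrt (5/3) * weight s) + sqrt (5/3) * (\<Sum>s\<in>T. \<bar>k s\<bar> * weight s)"
    by (intro add_mono mult_left_mono level_norm_dz insert) simp
  also have "\<dots> = sqrt (5/3) * (\<Sum>s\<in>insert s T. \<bar>k s\<bar> * weight s)"
    using insert by (simp add: distrib_left mult_ac)
  finally show ?case .
qed

text \<open>The tail of the weighted series does not involve m, which makes the convergence uniform
  over all levels, as \<open>form_norm\<close> demands. The bound is proved for finite T containing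
  S and passed to the limit.\<close>

lemma level_norm_dz_series:
  assumes k: "(\<lambda>s. \<bar>k s\<bar> * weight s) summable_on UNIV" and S: "finite S"
  shows "level_norm (\<lambda>r i j. dz_series k r i j - dz_sum k S r i j) m \<le>
    sqrt (5/3) * ((\<Sum>\<^sub>\<infinity>s. \<bar>k s\<bar> * weight s) - (\<Sum>s\<in>S. \<bar>k s\<bar> * weight s))" (is "_ \<le> ?R")
proof (rule tendsto_upperbound)
  show "((\<lambda>T. level_norm (\<lambda>r i j. dz_sum k T r i j - dz_sum k S r i j) m) \<longlongrightarrow>
      level_norm (\<lambda>r i j. dz_series k r i j - dz_sum k S r i j) m) (finite_subsets_at_top UNIV)"
    unfolding level_norm_def level_energy_def edge_squares_def
    by (intro tendsto_intros dz_sum_tendsto k)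
  show "\<forall>\<^sub>F T in finite_subsets_at_top UNIV. level_norm (\<lambda>r i j. dz_sum k T r i j - dz_sum k S r i j) m \<le> ?R"
    unfolding eventually_finite_subsets_at_top
  proof (intro exI[of _ S] conjI allI impI S)
    fix T :: "word set" assume T: "finite T \<and> S \<subseteq> T \<and> T \<subseteq> UNIV"
    have "(\<lambda>r i j. dz_sum k T r i j - dz_sum k S r i j) = dz_sum k (T - S)"
      using T by (simp add: dz_sum_def fun_eq_iff sum_diff)
    then have "level_norm (\<lambda>r i j. dz_sum k T r i j - dz_sum k S r i j) m \<le>
        sqrt (5/3) * (\<Sum>s\<in>T - S. \<bar>k s\<bar> * weight s)"
      using level_norm_dz_sum[of "T - S" k m] T by simp
    also have "(\<Sum>s\<in>T - S. \<bar>k s\<bar> * weight s) = (\<Sum>s\<in>T. \<bar>k s\<bar> * weight s) - (\<Sum>s\<in>S. \<bar>k s\<bar> * weight s)"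
      using T by (simp add: sum_diff)
    also have "(\<Sum>s\<in>T. \<bar>k s\<bar> * weight s) \<le> (\<Sum>\<^sub>\<infinity>s. \<bar>k s\<bar> * weight s)"
      using T k by (intro finite_sum_le_infsum) (auto simp: weight_nonneg)
    finally show "level_norm (\<lambda>r i j. dz_sum k T r i j - dz_sum k S r i j) m \<le> ?R" by simp
  qed simp
qed simp


section \<open>Potentials\<close>

text \<open>Subcell i shares its vertex i with the larger cell; the values at its other vertices add
  the integrals along its own sides from there.\<close>

primrec potential :: "cochain \<Rightarrow> (3 \<Rightarrow> real) \<Rightarrow> word \<Rightarrow> 3 \<Rightarrow> real" where
  "potential J a [] = a"
| "potential J a (i # s) = potential (\<lambda>r. J (i # r)) (\<lambda>j. a i + J [i] i j) s"

lemma potential_snoc: "potential J a (s @ [i]) j = potential J a s i + J (s @ [i]) i j"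
  by (induction s arbitrary: J a) auto

lemma circulation_zeroD:
  assumes "additive_cochain J" "circulation J s = 0"
  shows "J s i j = J s l j - J s l i"
proof -
  have anti: "J s 1 0 = - J s 0 1" "J s 2 1 = - J s 1 2" "J s 0 2 = - J s 2 0"
    by (rule additive_cochain_anti[OF assms(1)])+
  have diag: "J s i i = 0" for i using additive_cochain_anti[OF assms(1), of s i i] by simp
  show ?thesis
    using three_cases[of i] three_cases[of j] three_cases[of l] assms(2)
    by (elim disjE) (simp_all add: circulation_def diag anti)
qed

lemma potential_diff:
  assumes "additive_cochain J" "\<And>s. circulation J s = 0" "\<And>i j. J [] i j = a j - a i"
  shows "potential J a s j - potential J a s i = J s i j"
proof (cases s rule: rev_cases)
  case Nil
  then show ?thesis using assms(3) by simp
next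
  case (snoc t l)
  then show ?thesis using circulation_zeroD[OF assms(1,2), of s i j l] by (simp add: potential_snoc)
qed

text \<open>The midpoint of a side is reached from both ends; additivity over the two halves makes
  the values agree.\<close>

lemma compat_potential:
  assumes "additive_cochain J" "\<And>s. circulation J s = 0" "\<And>i j. J [] i j = a j - a i"
  shows "compat (potential J a)"
  unfolding compat_def potential_snoc
proof (intro allI conjI)
  fix s i j
  show "potential J a s i + J (s @ [i]) i i = potential J a s i"
    using additive_cochain_anti[OF assms(1), of "s @ [i]" i i] by simp
  show "potential J a s i + J (s @ [i]) i j = potential J a s j + J (s @ [j]) j i"
    using potential_diff[OF assms, of s j i] additive_cochain_split[OF assms(1), of s i j]
      additive_cochain_anti[OF assms(1), of "s @ [j]" j i] by linarith
qed

lemma ex_potential: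
  assumes J: "additive_cochain J" "\<And>s. circulation J s = 0" and "\<And>m. level_energy J m \<le> M"
  shows "\<exists>U\<in>finite_energy. \<forall>s i j. U (vtx s j) - U (vtx s i) = J s i j"
proof -
  \<comment> \<open>This normalises the potential to be 0 at \<open>corner 0\<close>.\<close>
  define a where "a = J [] 0"
  have a: "J [] i j = a j - a i" for i j unfolding a_def by (rule circulation_zeroD[OF J])
  define u where "u = potential J a"
  have u: "u s j - u s i = J s i j" for s i j unfolding u_def by (rule potential_diff[OF J a])
  have "family_energy u m = level_energy J m" for m
    unfolding family_energy_def level_energy_def by (simp add: edge_squares_exact[OF u[symmetric]])
  then obtain U where "U \<in> finite_energy" "\<And>s i. U (vtx s i) = u s i"
    using finite_energy_extension[of u M] assms(3) compat_potential[OF J a] unfolding u_def by auto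
  then show ?thesis using u by (intro bexI[of _ U]) simp_all
qed

text \<open>The sides of the subcells are the halves of the outer sides together with the sides of
  the lacuna, the latter run backwards.\<close>

lemma circulation_split:
  assumes "additive_cochain J"
  shows "circulation J s = (\<Sum>i\<in>UNIV. circulation J (s @ [i])) + lacuna_period J s"
proof -
  note split = additive_cochain_split[OF assms, of s]
  have "J (s @ [0]) 2 1 = - J (s @ [0]) 1 2" "J (s @ [1]) 0 2 = - J (s @ [1]) 2 0"
    "J (s @ [2]) 1 0 = - J (s @ [2]) 0 1"
    by (rule additive_cochain_anti[OF assms])+
  then show ?thesis
    unfolding circulation_def lacuna_period_def sum_three split[of 0 1] split[of 1 2] split[of 2 0] by simp
qed

lemma circulation_vanishes:
  assumes J: "additive_cochain J" "\<And>s. lacuna_period J s = 0"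
    and b: "\<And>m. (\<Sum>s\<in>words m. \<bar>circulation J s\<bar>) \<le> b m" "b \<longlonglongrightarrow> 0"
  shows "circulation J s = 0"
proof -
  have eq: "circulation J s = (\<Sum>t\<in>words m. circulation J (s @ t))" for m
  proof (induction m)
    case (Suc m)
    also have "(\<Sum>t\<in>words m. circulation J (s @ t)) = (\<Sum>t\<in>words m. \<Sum>i\<in>UNIV. circulation J (s @ t @ [i]))"
    proof (rule sum.cong[OF refl])
      fix t
      show "circulation J (s @ t) = (\<Sum>i\<in>UNIV. circulation J (s @ t @ [i]))"
        using circulation_split[OF J(1), of "s @ t"] J(2)[of "s @ t"] by (simp only: append_assoc add_0_right)
    qed
    finally show ?case by (simp add: sum_words_Suc_snoc)
  qed simp
  have "\<bar>circulation J s\<bar> \<le> b (m + length s)" for m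
  proof -
    have "\<bar>circulation J s\<bar> \<le> (\<Sum>t\<in>words m. \<bar>circulation J (s @ t)\<bar>)" unfolding eq[of m] by (rule sum_abs)
    also have "\<dots> \<le> (\<Sum>r\<in>words (length s). \<Sum>t\<in>words m. \<bar>circulation J (r @ t)\<bar>)"
      by (rule member_le_sum[of s "words (length s)" "\<lambda>r. \<Sum>t\<in>words m. \<bar>circulation J (r @ t)\<bar>"])
        (auto simp: words_def finite_words[unfolded words_def] sum_nonneg)
    also have "\<dots> \<le> b (m + length s)"
      using b(1)[of "length s + m"] unfolding sum_words_add by (simp only: add.commute)
    finally show ?thesis .
  qed
  moreover have "(\<lambda>m. b (m + length s)) \<longlonglongrightarrow> 0" by (rule LIMSEQ_ignore_initial_segment[OF b(2)])
  ultimately have "\<bar>circulation J s\<bar> \<le> 0" by (intro LIMSEQ_le_const) auto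
  then show ?thesis by simp
qed

text \<open>By \<open>circulation_split\<close> a period is a difference of circulations on two
  consecutive levels; 8/5 = 1 + 3/5.\<close>

lemma decaying_periods:
  assumes "w \<in> forms"
  shows "decaying (lacuna_period (edge_integral w))"
proof -
  let ?J = "edge_integral w"
  obtain C where C: "\<And>m. (\<Sum>s\<in>words m. \<bar>circulation ?J s\<bar>) \<le> C * (3/5) ^ m"
    using circulation_edge_integral[OF assms] by blast
  have "(\<Sum>s\<in>words m. \<bar>lacuna_period ?J s\<bar>) \<le> (8/5 * C) * (3/5) ^ m" for m
  proof -
    have "\<bar>lacuna_period ?J s\<bar> \<le> \<bar>circulation ?J s\<bar> + (\<Sum>i\<in>UNIV. \<bar>circulation ?J (s @ [i])\<bar>)" for s
      using circulation_split[OF additive_edge_integral[OF assms], of s]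
        sum_abs[of "\<lambda>i. circulation ?J (s @ [i])" UNIV] by linarith
    then have "(\<Sum>s\<in>words m. \<bar>lacuna_period ?J s\<bar>) \<le>
        (\<Sum>s\<in>words m. \<bar>circulation ?J s\<bar> + (\<Sum>i\<in>UNIV. \<bar>circulation ?J (s @ [i])\<bar>))" by (rule sum_mono)
    also have "\<dots> = (\<Sum>s\<in>words m. \<bar>circulation ?J s\<bar>) + (\<Sum>s\<in>words (Suc m). \<bar>circulation ?J s\<bar>)"
      by (simp add: sum.distrib sum_words_Suc_snoc)
    also have "\<dots> \<le> C * (3/5) ^ m + C * (3/5) ^ Suc m" by (intro add_mono C)
    finally show ?thesis by (simp add: algebra_simps)
  qed
  then show ?thesis unfolding decaying_def by blast
qed

theorem proposition2p23:
  assumes "\<omega> \<in> smooth_forms"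
  shows "\<exists>U\<^sub>E \<in> finite_energy. \<exists>\<omega>\<^sub>H \<in> smooth_forms. \<exists>k.
           is_adjoint_image inverse_period_matrix (\<lambda>\<sigma>. form_integral (lacuna \<sigma>) \<omega>) k \<and>
           \<omega> = form_add (exact_form U\<^sub>E) \<omega>\<^sub>H \<and>
           form_has_sum k dz \<omega>\<^sub>H"
proof -
  obtain \<eta> where \<eta>: "\<eta> \<in> forms" "\<omega> = form_class \<eta>" using smooth_formsE[OF assms] .
  define J where "J = edge_integral \<eta>"
  define c where "c = lacuna_period J"
  define k where "k = adjoint_coeff c"
  define N where "N = (\<Sum>\<^sub>\<infinity>\<sigma>. \<bar>k \<sigma>\<bar> * weight \<sigma>)"
  have J: "additive_cochain J" unfolding J_def by (rule additive_edge_integral[OF \<eta>(1)])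
  have c: "decaying c" unfolding c_def J_def by (rule decaying_periods[OF \<eta>(1)])
  have k: "(\<lambda>\<sigma>. \<bar>k \<sigma>\<bar> * weight \<sigma>) summable_on UNIV" unfolding k_def by (rule adjoint_coeff_summable[OF c])
  \<comment> \<open>The integrals of the exact part that is still to be found.\<close>
  define I where "I = (\<lambda>\<rho> i j. J \<rho> i j - dz_series k \<rho> i j)"
  have I: "additive_cochain I" unfolding I_def by (intro additive_cochain_diff J additive_dz_series k)
  have "lacuna_period I \<upsilon> = c \<upsilon> - lacuna_period (dz_series k) \<upsilon>" for \<upsilon>
    by (simp add: I_def c_def lacuna_period_def)
  \<comment> \<open>By \<open>adjoint_coeff_period\<close> the series has the same periods c as
    \<omega>.\<close>
  then have I_lacuna: "lacuna_period I \<upsilon> = 0" for \<upsilon>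
    using lacuna_period_dz_series[OF k, of \<upsilon>] adjoint_coeff_period[OF c, of \<upsilon>] by (simp add: k_def)
  obtain C where C: "\<And>m. (\<Sum>\<sigma>\<in>words m. \<bar>circulation J \<sigma>\<bar>) \<le> C * (3/5) ^ m"
    using circulation_edge_integral[OF \<eta>(1)] unfolding J_def by blast
  have "circulation I \<sigma> = 0" for \<sigma>
  proof (rule circulation_vanishes[OF I I_lacuna])
    show "(\<Sum>\<sigma>\<in>words m. \<bar>circulation I \<sigma>\<bar>) \<le> C * (3/5) ^ m + (1 / sqrt (5/3)) ^ m * N" for m
    proof -
      have "(\<Sum>\<sigma>\<in>words m. \<bar>circulation I \<sigma>\<bar>) \<le>
          (\<Sum>\<sigma>\<in>words m. \<bar>circulation J \<sigma>\<bar> + \<bar>circulation (dz_series k) \<sigma>\<bar>)"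
        by (intro sum_mono) (simp add: I_def circulation_def)
      also have "\<dots> \<le> C * (3/5) ^ m + (1 / sqrt (5/3)) ^ m * N"
        unfolding sum.distrib N_def by (intro add_mono C sum_circulation_dz_series k)
      finally show ?thesis .
    qed
    have "\<bar>1 / sqrt (5/3)\<bar> < 1" using sqrt_five_thirds(1) by simp
    then have "(\<lambda>m. C * (3/5) ^ m + (1 / sqrt (5/3)) ^ m * N) \<longlonglongrightarrow> C * 0 + 0 * N"
      by (intro tendsto_intros LIMSEQ_power_zero) auto
    then show "(\<lambda>m. C * (3/5) ^ m + (1 / sqrt (5/3)) ^ m * N) \<longlonglongrightarrow> 0" by simp
  qed
  moreover obtain E where E: "\<And>m. level_energy J m \<le> E"
    using level_energy_bounded[OF \<eta>(1)] unfolding J_def by blast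
  \<comment> \<open>With S empty, \<open>level_norm_dz_series\<close> bounds the whole series on
    every level; the potential of I thus gets finite energy.\<close>
  have "level_energy I m \<le> (sqrt E + sqrt (5/3) * N)\<^sup>2" for m
  proof -
    have "level_norm I m \<le> level_norm J m + level_norm (\<lambda>\<rho> i j. (- 1) * dz_series k \<rho> i j) m"
      using level_norm_add[of J "\<lambda>\<rho> i j. (- 1) * dz_series k \<rho> i j" m] by (simp add: I_def)
    also have "\<dots> = level_norm J m + level_norm (dz_series k) m" by (subst level_norm_scale) simp
    also have "\<dots> \<le> sqrt E + sqrt (5/3) * N"
      using level_norm_dz_series[OF k, of "{}" m] E[of m]
      by (intro add_mono) (simp_all add: level_norm_def dz_sum_def N_def)
    finally show ?thesis
      unfolding level_norm_def by (simp add: sqrt_le_D)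
  qed
  ultimately obtain U where U: "U \<in> finite_energy" "\<And>\<sigma> i j. U (vtx \<sigma> j) - U (vtx \<sigma> i) = I \<sigma> i j"
    using ex_potential[OF I] by metis
  \<comment> \<open>A representative of \<open>\<omega>\<^sub>H\<close>: removing dU leaves exactly
    the integrals of the series.\<close>
  define \<zeta> where "\<zeta> = (\<lambda>z. \<eta> z - differential U z)"
  have dU: "differential U \<in> forms" by (rule differential_form[OF U(1)])
  have \<zeta>: "\<zeta> \<in> forms" unfolding \<zeta>_def by (intro forms_diff \<eta> dU)
  have \<zeta>_int: "edge_integral \<zeta> \<rho> i j = dz_series k \<rho> i j" for \<rho> i j
    unfolding \<zeta>_def edge_integral_diff[OF \<eta>(1) dU] edge_integral_differential U(2) by (simp add: I_def J_def)
  have "is_adjoint_image inverse_period_matrix (\<lambda>\<sigma>. form_integral (lacuna \<sigma>) \<omega>) k"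
    using is_adjoint_image_coeff[OF c] unfolding k_def c_def J_def \<eta>(2) form_integral_lacuna[OF \<eta>(1)] .
  moreover have "\<omega> = form_add (exact_form U) (form_class \<zeta>)"
    unfolding exact_form_def form_add_class[OF dU \<zeta>] \<eta>(2) by (simp add: \<zeta>_def)
  moreover have "form_has_sum k dz (form_class \<zeta>)"
    unfolding form_has_sum_def
  \<comment> \<open>The norm is squeezed between 0 and the tail of the weighted series.\<close>
  proof (rule tendsto_sandwich[where f = "\<lambda>_. 0"
        and h = "\<lambda>S. ennreal (sqrt (5/3) * (N - (\<Sum>\<sigma>\<in>S. \<bar>k \<sigma>\<bar> * weight \<sigma>)))"])
    let ?b = "\<lambda>S. ennreal (sqrt (5/3) * (N - (\<Sum>\<sigma>\<in>S. \<bar>k \<sigma>\<bar> * weight \<sigma>)))"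
    have "((\<lambda>S. sqrt (5/3) * (N - (\<Sum>\<sigma>\<in>S. \<bar>k \<sigma>\<bar> * weight \<sigma>))) \<longlongrightarrow> sqrt (5/3) * (N - N)) (finite_subsets_at_top UNIV)"
      using has_sum_infsum[OF k] unfolding has_sum_def N_def by (intro tendsto_intros)
    from tendsto_ennrealI[OF this] show "(?b \<longlongrightarrow> 0) (finite_subsets_at_top UNIV)" by simp
    show "\<forall>\<^sub>F S in finite_subsets_at_top UNIV. form_norm (form_diff (form_class \<zeta>) (form_lincomb S k dz)) \<le> ?b S"
    proof (rule eventually_finite_subsets_at_top_weakI)
      fix S :: "word set" assume S: "finite S"
      let ?\<xi> = "\<lambda>z. \<zeta> z - (\<Sum>\<sigma>\<in>S. k \<sigma> * dz_form \<sigma> z)"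
      have lin: "(\<lambda>z. \<Sum>\<sigma>\<in>S. k \<sigma> * dz_form \<sigma> z) \<in> forms" by (intro forms_lincomb S dz_form)
      have "form_lincomb S k dz = form_lincomb S k (\<lambda>\<sigma>. form_class (dz_form \<sigma>))"
        by (rule arg_cong[of dz "\<lambda>\<sigma>. form_class (dz_form \<sigma>)" "form_lincomb S k"]) (rule ext, rule dz_eq)
      then have "form_diff (form_class \<zeta>) (form_lincomb S k dz) = form_class ?\<xi>"
        by (simp add: form_lincomb_class[OF S dz_form(1)] form_diff_class[OF \<zeta> lin])
      moreover have "edge_integral ?\<xi> = (\<lambda>\<rho> i j. dz_series k \<rho> i j - dz_sum k S \<rho> i j)"
        by (intro ext) (simp add: edge_integral_diff[OF \<zeta> lin] \<zeta>_int edge_integral_lincomb dz_form(1) dz_sum_def dz_integral_def)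
      ultimately have "sqrt (Q_level m (form_diff (form_class \<zeta>) (form_lincomb S k dz))) =
          level_norm (\<lambda>\<rho> i j. dz_series k \<rho> i j - dz_sum k S \<rho> i j) m" for m
        by (simp add: Q_level_class[OF forms_diff[OF \<zeta> lin]] level_norm_def)
      then show "form_norm (form_diff (form_class \<zeta>) (form_lincomb S k dz)) \<le> ?b S"
        unfolding form_norm_def N_def
        by (intro SUP_least ennreal_leI) (simp add: level_norm_dz_series[OF k S])
    qed
  qed auto
  ultimately show ?thesis using U(1) form_class_smooth[OF \<zeta>] by blast
qed

end
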